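(* Let $K$ be a virtual knot and let $n_o$ be the minimum, over all diagrams of $K$, of the number of odd crossings of the diagram. Let $z^{e_{\max}}$ and $z^{e_{\min}}$ be, respectively, the highest and lowest powers of $z$ appearing in the z-Parity Alexander Polynomial of $K$, and set $e=\max(|e_{\max}|,|e_{\min}|)$. Then $e\le n_o$ if $e$ is even, and $e+1\le n_o$ if $e$ is odd.
   Context: Virtual knots. A virtual knot diagram is an oriented closed curve immersed in the plane whose double points are transverse and each is either a classical (real) crossing, with over/under information, or a virtual crossing. A virtual knot is an equivalence class of such diagrams under planar isotopy, the classical Reidemeister moves I, II, III, and the virtual moves (virtual Reidemeister I, II, III, and the mixed move passing a strand with two consecutive virtual crossings across a classical crossing). Each classical crossing has the usual sign (positive or negative). Parity. Traversing the diagram once from a base point and recording each passage through a classical crossing gives a cyclic word (Gauss code) of length $2n$ in which each of the $n$ classical crossings occurs twice. A classical crossing $v$ is even if the number of letters between its two occurrences is even, and odd otherwise. z-Parity Alexander Polynomial. Let $D$ be a diagram of $K$ with $n$ classical crossings. The arcs of $D$ are the $2n$ segments between consecutive passages through classical crossings (virtual crossings are ignored); if $n=0$ there is one arc $x$ with the trivial relation $x=x$. At each classical crossing let $o_{in},o_{out}$ be the incoming and outgoing arcs of the over-strand and $u_{in},u_{out}$ those of the under-strand. Impose the relations over $\mathbb{Z}[s^{\pm1},t^{\pm1},z^{\pm1}]$: - even positive crossing: $o_{out}=s\,o_{in}$, $u_{out}=t\,u_{in}+(1-st)\,o_{in}$; - even negative crossing: $o_{out}=s^{-1}o_{in}$,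 $u_{out}=t^{-1}u_{in}+(1-s^{-1}t^{-1})\,o_{in}$; - odd positive crossing: $o_{out}=z\,o_{in}$, $u_{out}=z^{-1}u_{in}$; - odd negative crossing: $o_{out}=z^{-1}o_{in}$, $u_{out}=z\,u_{in}$. Each arc is the outgoing arc of exactly one strand passage, so these relations can be written as $Mx=x$, where $x$ is the vector of arcs and $M$ is a square matrix. The z-Parity Alexander Polynomial of $K$ is $\det(M-I)$, regarded up to multiplication by $\pm s^{a}t^{b}$, $a,b\in\mathbb{Z}$; up to this ambiguity it is an invariant of $K$, so the exponents of $z$ appearing in it are well defined. If the polynomial is $0$, set $e=0$. *)

theory Defs
  imports "HOL-Analysis.Analysis" "HOL-Library.Poly_Mapping" "Jordan_Normal_Form.Determinant"
begin

section \<open>Virtual knot diagrams\<close>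

text \<open>
  The plane is \<^typ>\<open>complex\<close> and an oriented closed curve is a 1-periodic map on the reals. The
  crossing decoration is the set of times at which the curve passes through a classical crossing as
  the over-strand; a double point with no such time is virtual.
\<close>

record diagram =
  curve :: "real \<Rightarrow> complex"
  over_times :: "real set"

definition tangent :: "diagram \<Rightarrow> real \<Rightarrow> complex" where
  "tangent D t = vector_derivative (curve D) (at t)"

definition double_times :: "diagram \<Rightarrow> real set" where
  "double_times D = {t. \<exists>s. s - t \<notin> \<int> \<and> curve D s = curve D t}"

definition classical_times :: "diagram \<Rightarrow> real set" where
  "classical_times D = {t. \<exists>s \<in> over_times D. curve D s = curve D t}"

text \<open>
  The number \<open>Im (cnj v * w)\<close> is the determinant of the pair of plane vectors \<open>(v, w)\<close>, so its
  being nonzero is transversality. The last clause makes \<^const>\<open>over_times\<close> 1-periodic and says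
  that exactly one of the two strands at a classical crossing is the over-strand.
\<close>

definition virtual_diagram :: "diagram \<Rightarrow> bool" where
  "virtual_diagram D \<longleftrightarrow>
     (\<forall>t. curve D (t + 1) = curve D t) \<and>
     curve D C1_differentiable_on UNIV \<and>
     (\<forall>t. tangent D t \<noteq> 0) \<and>
     finite (double_times D \<inter> {0..<1}) \<and>
     (\<forall>s t u. curve D s = curve D t \<and> curve D t = curve D u \<longrightarrow>
        s - t \<in> \<int> \<or> t - u \<in> \<int> \<or> s - u \<in> \<int>) \<and>
     (\<forall>s t. curve D s = curve D t \<and> s - t \<notin> \<int> \<longrightarrow> Im (cnj (tangent D s) * tangent D t) \<noteq> 0) \<and>
     over_times D \<subseteq> double_times D \<and>
     (\<forall>s t. s \<in> over_times D \<and> curve D s = curve D t \<longrightarrow> (t \<in> over_times D \<longleftrightarrow> s - t \<in> \<int>))"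


section \<open>Planar isotopy\<close>

text \<open>An isotopy of the plane through \<open>C\<^sup>1\<close> diffeomorphisms, starting at the identity.\<close>

definition ambient_isotopy :: "(real \<Rightarrow> complex \<Rightarrow> complex) \<Rightarrow> bool" where
  "ambient_isotopy H \<longleftrightarrow>
     H 0 = id \<and>
     continuous_on ({0..1} \<times> UNIV) (\<lambda>(\<tau>, x). H \<tau> x) \<and>
     (\<forall>\<tau>\<in>{0..1}. bij (H \<tau>)) \<and>
     (\<exists>H'. (\<forall>\<tau>\<in>{0..1}. \<forall>x. (H \<tau> has_derivative H' \<tau> x) (at x) \<and> inj (H' \<tau> x)) \<and>
           (\<forall>v. continuous_on ({0..1} \<times> UNIV) (\<lambda>(\<tau>, x). H' \<tau> x v)))"

text \<open>Orientation-preserving \<open>C\<^sup>1\<close> reparametrizations of the circle, lifted to the line.\<close>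

definition circle_reparam :: "(real \<Rightarrow> real) \<Rightarrow> bool" where
  "circle_reparam \<rho> \<longleftrightarrow>
     (\<forall>t. \<rho> (t + 1) = \<rho> t + 1) \<and>
     (\<exists>\<rho>'. continuous_on UNIV \<rho>' \<and> (\<forall>t. (\<rho> has_real_derivative \<rho>' t) (at t) \<and> \<rho>' t > 0))"

definition planar_isotopic :: "diagram \<Rightarrow> diagram \<Rightarrow> bool" where
  "planar_isotopic D D' \<longleftrightarrow>
     (\<exists>H \<rho>. ambient_isotopy H \<and> circle_reparam \<rho> \<and>
        (\<forall>t. curve D' t = H 1 (curve D (\<rho> t))) \<and>
        (\<forall>t. t \<in> over_times D' \<longleftrightarrow> \<rho> t \<in> over_times D))"


section \<open>Reidemeister and virtual moves\<close>

text \<open>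
  Each move replaces one picture by another inside a round closed disc and leaves the diagram
  unchanged outside it. This is no restriction, because every disc that carries a move can be made
  round by a planar isotopy.

  \<open>disc_strands D c r S\<close>: the curve meets the closed disc with centre \<open>c\<close> and radius \<open>r\<close> exactly
  during the time intervals \<open>[a, b]\<close> with \<open>(a, b) \<in> S\<close> and their integer translates, and each of
  these strands runs through the interior from boundary point to boundary point.
\<close>

definition disc_strands :: "diagram \<Rightarrow> complex \<Rightarrow> real \<Rightarrow> (real \<times> real) set \<Rightarrow> bool" where
  "disc_strands D c r S \<longleftrightarrow>
     r > 0 \<and>
     (\<forall>(a, b)\<in>S. a < b \<and> b < a + 1 \<and> curve D a \<in> sphere c r \<and> curve D b \<in> sphere c r \<and>
        curve D ` {a<..<b} \<subseteq> ball c r) \<and>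
     (\<forall>t. curve D t \<in> cball c r \<longleftrightarrow> (\<exists>(a, b)\<in>S. \<exists>k::int. t + of_int k \<in> {a..b}))"

definition agree_off :: "diagram \<Rightarrow> diagram \<Rightarrow> real \<Rightarrow> real \<Rightarrow> bool" where
  "agree_off D D' a b \<longleftrightarrow>
     (\<forall>t. (\<nexists>k::int. t + of_int k \<in> {a<..<b}) \<longrightarrow>
        curve D' t = curve D t \<and> (t \<in> over_times D' \<longleftrightarrow> t \<in> over_times D))"

text \<open>
  First moves: the only strand in the disc is embedded in \<open>D\<close>, and in \<open>D'\<close> it has a single
  self-crossing, at the times \<open>s < t\<close>.
\<close>

definition adds_kink :: "diagram \<Rightarrow> diagram \<Rightarrow> real \<Rightarrow> real \<Rightarrow> bool" where
  "adds_kink D D' s t \<longleftrightarrow>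
     (\<exists>c r a b.
        disc_strands D c r {(a, b)} \<and> disc_strands D' c r {(a, b)} \<and> agree_off D D' a b \<and>
        inj_on (curve D) {a..b} \<and>
        {(x, y). x \<in> {a..b} \<and> y \<in> {a..b} \<and> x < y \<and> curve D' x = curve D' y} = {(s, t)})"

text \<open>
  In the second and third moves a single strand \<open>[a, b]\<close> moves, while the other strands in the disc
  stay fixed and run along diameters (\<open>straight_strand\<close>). Up to planar isotopy every second or third
  move has this form, and any of its strands can be taken to be the moving one; in the classical
  second and third moves the moving strand will be the top one.
\<close>

definition diameter_of :: "complex \<Rightarrow> real \<Rightarrow> complex \<Rightarrow> complex set" where
  "diameter_of c r u = closed_segment (c - of_real r * u) (c + of_real r * u)"

definition straight_strand ::
    "diagram \<Rightarrow> complex \<Rightarrow> real \<Rightarrow> complex \<Rightarrow> real \<Rightarrow> real \<Rightarrow> bool" where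
  "straight_strand D c r u a b \<longleftrightarrow>
     norm u = 1 \<and> inj_on (curve D) {a..b} \<and> curve D ` {a..b} = diameter_of c r u"

text \<open>
  Second moves: the moving strand misses the diameter in \<open>D\<close> and crosses it exactly twice in \<open>D'\<close>,
  at the times \<open>p\<close> and \<open>q\<close>.
\<close>

definition slides_across_strand :: "diagram \<Rightarrow> diagram \<Rightarrow> real \<Rightarrow> real \<Rightarrow> bool" where
  "slides_across_strand D D' p q \<longleftrightarrow>
     (\<exists>c r u a b a\<^sub>1 b\<^sub>1.
        disc_strands D c r {(a, b), (a\<^sub>1, b\<^sub>1)} \<and> disc_strands D' c r {(a, b), (a\<^sub>1, b\<^sub>1)} \<and>
        agree_off D D' a b \<and>
        straight_strand D c r u a\<^sub>1 b\<^sub>1 \<and>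
        inj_on (curve D) {a..b} \<and> inj_on (curve D') {a..b} \<and>
        curve D ` {a..b} \<inter> diameter_of c r u = {} \<and>
        p \<noteq> q \<and> {t \<in> {a..b}. curve D' t \<in> diameter_of c r u} = {p, q})"

text \<open>
  Third moves: two distinct diameters cross at the centre \<open>c\<close>. The moving strand crosses each of
  them once, at the times \<open>p\<^sub>1, p\<^sub>2\<close> in \<open>D\<close> and \<open>q\<^sub>1, q\<^sub>2\<close> in \<open>D'\<close>. Since its end points are the same in
  both diagrams, it passes \<open>c\<close> on different sides iff it meets the diameters in opposite orders.
\<close>

definition slides_across_crossing ::
    "diagram \<Rightarrow> diagram \<Rightarrow> complex \<Rightarrow> real set \<Rightarrow> real set \<Rightarrow> bool" where
  "slides_across_crossing D D' c P Q \<longleftrightarrow>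
     (\<exists>r u\<^sub>1 u\<^sub>2 a b a\<^sub>1 b\<^sub>1 a\<^sub>2 b\<^sub>2 p\<^sub>1 p\<^sub>2 q\<^sub>1 q\<^sub>2.
        disc_strands D c r {(a, b), (a\<^sub>1, b\<^sub>1), (a\<^sub>2, b\<^sub>2)} \<and>
        disc_strands D' c r {(a, b), (a\<^sub>1, b\<^sub>1), (a\<^sub>2, b\<^sub>2)} \<and>
        agree_off D D' a b \<and>
        straight_strand D c r u\<^sub>1 a\<^sub>1 b\<^sub>1 \<and> straight_strand D c r u\<^sub>2 a\<^sub>2 b\<^sub>2 \<and>
        Im (cnj u\<^sub>1 * u\<^sub>2) \<noteq> 0 \<and>
        inj_on (curve D) {a..b} \<and> inj_on (curve D') {a..b} \<and>
        {p\<^sub>1, p\<^sub>2, q\<^sub>1, q\<^sub>2} \<subseteq> {a<..<b} \<and>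
        {t \<in> {a..b}. curve D t \<in> diameter_of c r u\<^sub>1} = {p\<^sub>1} \<and>
        {t \<in> {a..b}. curve D t \<in> diameter_of c r u\<^sub>2} = {p\<^sub>2} \<and>
        {t \<in> {a..b}. curve D' t \<in> diameter_of c r u\<^sub>1} = {q\<^sub>1} \<and>
        {t \<in> {a..b}. curve D' t \<in> diameter_of c r u\<^sub>2} = {q\<^sub>2} \<and>
        (p\<^sub>1 < p\<^sub>2 \<longleftrightarrow> q\<^sub>2 < q\<^sub>1) \<and>
        P = {p\<^sub>1, p\<^sub>2} \<and> Q = {q\<^sub>1, q\<^sub>2})"

inductive diagram_move :: "diagram \<Rightarrow> diagram \<Rightarrow> bool" where
  isotopy: "planar_isotopic D D' \<Longrightarrow> diagram_move D D'"
| reidemeister1: "adds_kink D D' s t \<Longrightarrow> s \<in> over_times D' \<or> t \<in> over_times D' \<Longrightarrow>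
    diagram_move D D'"
| reidemeister2: "slides_across_strand D D' p q \<Longrightarrow> {p, q} \<subseteq> over_times D' \<Longrightarrow>
    diagram_move D D'"
| reidemeister3: "slides_across_crossing D D' c P Q \<Longrightarrow> c \<in> curve D ` over_times D \<Longrightarrow>
    P \<subseteq> over_times D \<Longrightarrow> Q \<subseteq> over_times D' \<Longrightarrow> diagram_move D D'"
| virtual1: "adds_kink D D' s t \<Longrightarrow> {s, t} \<inter> classical_times D' = {} \<Longrightarrow>
    diagram_move D D'"
| virtual2: "slides_across_strand D D' p q \<Longrightarrow> {p, q} \<inter> classical_times D' = {} \<Longrightarrow>
    diagram_move D D'"
| virtual3: "slides_across_crossing D D' c P Q \<Longrightarrow> c \<notin> curve D ` over_times D \<Longrightarrow>
    P \<inter> classical_times D = {} \<Longrightarrow> Q \<inter> classical_times D' = {} \<Longrightarrow> diagram_move D D'"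
| mixed: "slides_across_crossing D D' c P Q \<Longrightarrow> c \<in> curve D ` over_times D \<Longrightarrow>
    P \<inter> classical_times D = {} \<Longrightarrow> Q \<inter> classical_times D' = {} \<Longrightarrow> diagram_move D D'"

definition diagram_equiv :: "(diagram \<times> diagram) set" where
  "diagram_equiv = {(D, D'). virtual_diagram D \<and> virtual_diagram D' \<and>
     equivclp (\<lambda>E E'. virtual_diagram E \<and> virtual_diagram E' \<and> diagram_move E E') D D'}"

definition virtual_knots :: "diagram set set" where
  "virtual_knots = {D. virtual_diagram D} // diagram_equiv"


section \<open>Gauss code and parity\<close>

text \<open>The passages through classical crossings in one period; base point at time \<open>0\<close>.\<close>

definition passages :: "diagram \<Rightarrow> real list" where
  "passages D = sorted_list_of_set (classical_times D \<inter> {0..<1})"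

definition gauss_code :: "diagram \<Rightarrow> complex list" where
  "gauss_code D = map (curve D) (passages D)"

definition odd_crossings :: "diagram \<Rightarrow> complex set" where
  "odd_crossings D = {v. \<exists>i j. i < j \<and> j < length (gauss_code D) \<and>
     gauss_code D ! i = v \<and> gauss_code D ! j = v \<and> odd (j - i - 1)}"

definition min_odd_crossings :: "diagram set \<Rightarrow> nat" where
  "min_odd_crossings K = (LEAST n. \<exists>D\<in>K. n = card (odd_crossings D))"


section \<open>The z-parity Alexander polynomial\<close>

text \<open>
  The Laurent polynomial ring in \<open>s, t, z\<close> over the integers: the monoid ring of \<open>\<int>\<^sup>3\<close>, where
  the triple \<open>(a, b, c)\<close> stands for the monomial \<open>s\<^sup>a t\<^sup>b z\<^sup>c\<close>.
\<close>

type_synonym laurent3 = "(int \<times> int \<times> int) \<Rightarrow>\<^sub>0 int"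

definition mono3 :: "int \<Rightarrow> int \<Rightarrow> int \<Rightarrow> laurent3" where
  "mono3 a b c = Poly_Mapping.single (a, b, c) 1"

text \<open>Passages are referred to by their index \<open>k\<close> in \<^const>\<open>passages\<close>.\<close>

definition other_passage :: "diagram \<Rightarrow> nat \<Rightarrow> nat" where
  "other_passage D k =
     (THE l. l < length (gauss_code D) \<and> l \<noteq> k \<and> gauss_code D ! l = gauss_code D ! k)"

definition is_over :: "diagram \<Rightarrow> nat \<Rightarrow> bool" where
  "is_over D k \<longleftrightarrow> passages D ! k \<in> over_times D"

definition over_passage :: "diagram \<Rightarrow> nat \<Rightarrow> nat" where
  "over_passage D k = (if is_over D k then k else other_passage D k)"

definition under_passage :: "diagram \<Rightarrow> nat \<Rightarrow> nat" where
  "under_passage D k = (if is_over D k then other_passage D k else k)"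

text \<open>
  A crossing is positive iff the tangent vectors of the over- and the under-strand, in this order,
  form a positively oriented basis of the plane.
\<close>

definition crossing_sign :: "diagram \<Rightarrow> nat \<Rightarrow> int" where
  "crossing_sign D k =
     (if Im (cnj (tangent D (passages D ! over_passage D k)) *
             tangent D (passages D ! under_passage D k)) > 0 then 1 else - 1)"

text \<open>
  Arc \<open>k\<close> is the incoming arc of passage \<open>k\<close>; with \<open>N\<close> passages, the outgoing arc of passage \<open>k\<close> is
  arc \<open>(k + 1) mod N\<close>. \<open>out_coeff D k j\<close> is the coefficient of arc \<open>j\<close> in the expression for the
  outgoing arc of passage \<open>k\<close>; the relations for the two signs differ by inverting \<open>s, t, z\<close>.
\<close>

definition out_coeff :: "diagram \<Rightarrow> nat \<Rightarrow> nat \<Rightarrow> laurent3" where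
  "out_coeff D k j =
     (let \<epsilon> = crossing_sign D k in
      if gauss_code D ! k \<in> odd_crossings D then
        (if is_over D k
         then (if j = k then mono3 0 0 \<epsilon> else 0)
         else (if j = k then mono3 0 0 (- \<epsilon>) else 0))
      else
        (if is_over D k
         then (if j = k then mono3 \<epsilon> 0 0 else 0)
         else (if j = k then mono3 0 \<epsilon> 0 else 0) +
              (if j = over_passage D k then 1 - mono3 \<epsilon> \<epsilon> 0 else 0)))"

definition arc_matrix :: "diagram \<Rightarrow> laurent3 Matrix.mat" where
  "arc_matrix D =
     (let N = length (passages D) in
      if N = 0 then 1\<^sub>m 1
      else Matrix.mat N N (\<lambda>(i, j). out_coeff D ((i + N - 1) mod N) j))"

definition diagram_polynomial :: "diagram \<Rightarrow> laurent3" where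
  "diagram_polynomial D = Determinant.det (arc_matrix D - 1\<^sub>m (dim_row (arc_matrix D)))"

text \<open>
  The polynomial of a knot is only defined up to units \<open>\<plusminus>s\<^sup>a t\<^sup>b\<close>, so it is given as the set of all
  its representatives, computed from all diagrams.
\<close>

definition z_parity_alexander :: "diagram set \<Rightarrow> laurent3 set" where
  "z_parity_alexander K =
     {p. \<exists>D\<in>K. \<exists>a b. p = mono3 a b 0 * diagram_polynomial D \<or>
                     p = - (mono3 a b 0 * diagram_polynomial D)}"

definition z_exponents :: "laurent3 \<Rightarrow> int set" where
  "z_exponents p = {c. \<exists>a b. (a, b, c) \<in> Poly_Mapping.keys p}"

definition z_extent :: "laurent3 \<Rightarrow> int" where
  "z_extent p = (if p = 0 then 0 else max \<bar>Max (z_exponents p)\<bar> \<bar>Min (z_exponents p)\<bar>)"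

end

theory Submission
  imports Defs
begin

text \<open>
  Number the passages along the curve alternately by two colours; a crossing is odd iff its two
  passages have the same colour. Every odd crossing contributes one row \<open>z\<^sup>\<epsilon>\<close> and one row \<open>z\<^sup>-\<^sup>\<epsilon>\<close>
  to the matrix of arcs, so the exponents of \<open>z\<close> in the determinant of a diagram are bounded by its
  number of odd crossings. The two colours occur equally often, which forces the number of odd
  crossings to be even; this gives the refinement for odd \<open>e\<close>. It remains to see that the
  determinant is invariant under the moves up to units \<open>\<plusminus>s\<^sup>a t\<^sup>b\<close>. A point of the curve that is not a
  classical crossing may be added as an arc boundary with the relation \<open>x\<^sub>o\<^sub>u\<^sub>t = x\<^sub>i\<^sub>n\<close>, so both sides
  of a move have matrices on the same set of passages, and eliminating the arcs inside the disc
  leaves the same rows on both sides. The combinatorial constraints on a third move (which order and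
  signs go together) are read off from the signs, at the end points of the moving strand, of the
  signed distances to the two fixed diameters.
\<close>

section \<open>Determinants over finite sets\<close>

text \<open>Two facts keep the local computations manageable. Parity, in turn, uses only equality of
  colours. A first or second move inserts passages in adjacent pairs, which changes no such equality
  between old passages. In a third move the passages keep their positions up to an order
  isomorphism, while each of the three crossings shifts both of its passages to the neighbouring
  position; both colours flip and the parity survives.

  The delicate move is the third. Its algebraic identities are tied to the combinations of signs and
  orders that occur in the plane, and to parities of which none or two are odd. The constraint on
  parities follows from the colours. The one on signs and orders has to be extracted from the curves
  themselves, which is why time intervals, sides of lines and derivatives at simple zeros enter the
  argument.\<close>

definition detE :: "(nat \<Rightarrow> 'b) \<Rightarrow> nat \<Rightarrow> ('b \<Rightarrow> 'b \<Rightarrow> 'a::comm_ring_1) \<Rightarrow> 'a" where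
  "detE e n f = Determinant.det (Matrix.mat n n (\<lambda>(i, j). f (e i) (e j)))"

text \<open>The enumeration is a mere choice, harmless by \<open>detE_enum\<close>. Indexing by a
  set lets rows and columns be named by passage times, so a move does not renumber the passages that
  it leaves alone.\<close>

definition detS :: "'b set \<Rightarrow> ('b \<Rightarrow> 'b \<Rightarrow> 'a::comm_ring_1) \<Rightarrow> 'a" where
  "detS S f = detE (SOME e. bij_betw e {0..<card S} S) (card S) f"

text \<open>Rows and columns undergo the same permutation, so its sign enters twice and
  cancels.\<close>

lemma detE_permute:
  assumes p: "p permutes {0..<n}"
  shows "detE (e \<circ> p) n f = detE e n f"
proof -
  let ?A = "Matrix.mat n n (\<lambda>(i, j). f (e i) (e j))"
  let ?B = "Matrix.mat n n (\<lambda>(i, j). ?A $$ (p i, j))"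
  have pn: "p i < n" if "i < n" for i
    using permutes_in_image[OF p, of i] that by simp
  \<comment> \<open>The column permutation is turned into a row permutation by transposing.\<close>
  have "Determinant.det (Matrix.mat n n (\<lambda>(i, j). f (e (p i)) (e (p j)))) =
    Determinant.det (Matrix.mat n n (\<lambda>(i, j). ?B\<^sup>T $$ (p i, j)))"
    by (subst Determinant.det_transpose[of _ n, symmetric], simp)
       (rule arg_cong[where f = Determinant.det], rule eq_matI, auto simp: pn)
  also have "\<dots> = signof p * Determinant.det ?B"
    by (subst Determinant.det_permute_rows[OF _ p])
       (simp_all add: Determinant.det_transpose[of _ n])
  also have "Determinant.det ?B = signof p * Determinant.det ?A"
    by (rule Determinant.det_permute_rows[OF _ p]) simp
  also have "signof p * (signof p * Determinant.det ?A) = Determinant.det ?A"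
    by (cases "evenperm p") (simp_all add: sign_def)
  finally show ?thesis by (simp add: detE_def)
qed

lemma detE_enum:
  assumes e: "bij_betw e {0..<n} S" and e': "bij_betw e' {0..<n} S"
  shows "detE e n f = detE e' n f"
proof -
  \<comment> \<open>Extended by the identity, because \<open>permutes\<close> demands that indices
    outside \<open>{0..<n}\<close> stay fixed.\<close>
  define p where "p i = (if i < n then inv_into {0..<n} e (e' i) else i)" for i
  have "bij_betw (inv_into {0..<n} e \<circ> e') {0..<n} {0..<n}"
    by (rule bij_betw_trans[OF e' bij_betw_inv_into[OF e]])
  then have "bij_betw p {0..<n} {0..<n}"
    by (rule bij_betw_cong[THEN iffD1, rotated]) (auto simp: p_def)
  then have p: "p permutes {0..<n}"
    by (rule bij_imp_permutes) (auto simp: p_def)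
  have ep: "(e \<circ> p) i = e' i" if "i < n" for i
  proof -
    have "e' i \<in> e ` {0..<n}"
      unfolding bij_betw_imp_surj_on[OF e] using bij_betwE[OF e'] that by simp
    then show ?thesis
      using that by (simp add: p_def f_inv_into_f)
  qed
  have "detE (e \<circ> p) n f = detE e' n f"
    unfolding detE_def
    by (rule arg_cong[where f = Determinant.det], rule eq_matI) (use ep in auto)
  then show ?thesis using detE_permute[OF p, of e f] by simp
qed

lemma detS_enum:
  assumes "bij_betw e {0..<n} S"
  shows "detS S f = detE e n f"
proof -
  have n: "card S = n" using bij_betw_same_card[OF assms] by simp
  then have "bij_betw (SOME e. bij_betw e {0..<card S} S) {0..<n} S"
    using assms someI[of "\<lambda>e. bij_betw e {0..<n} S"] by auto
  then show ?thesis unfolding detS_def n by (rule detE_enum[OF _ assms])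
qed

lemma finite_enum:
  assumes "finite S"
  obtains e where "bij_betw e {0..<card S} S"
  using ex_bij_betw_nat_finite[OF assms] by blast

lemma enum_surj:
  assumes "bij_betw e {0..<n} S" and "m \<in> S"
  obtains x where "x < n" "e x = m"
  using assms by (auto simp: bij_betw_def)

lemma detS_reindex:
  assumes "finite S" and phi: "bij_betw \<phi> S S'"
  shows "detS S' f = detS S (\<lambda>k j. f (\<phi> k) (\<phi> j))"
proof -
  obtain e where e: "bij_betw e {0..<card S} S" using finite_enum[OF assms(1)] .
  have "bij_betw (\<phi> \<circ> e) {0..<card S} S'" by (rule bij_betw_trans[OF e phi])
  then show ?thesis
    by (simp add: detS_enum[OF e] detS_enum detE_def)
qed

lemma detS_cong:
  assumes "finite S" and "\<And>k j. k \<in> S \<Longrightarrow> j \<in> S \<Longrightarrow> f k j = g k j"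
  shows "detS S f = detS S g"
proof -
  obtain e where e: "bij_betw e {0..<card S} S" using finite_enum[OF assms(1)] .
  have "e i \<in> S" if "i < card S" for i using e that by (auto simp: bij_betw_def)
  then show ?thesis unfolding detS_enum[OF e] detE_def
    by (intro arg_cong[where f = Determinant.det] eq_matI) (auto intro: assms(2))
qed

lemma detS_addrow:
  assumes "finite S" and "m \<in> S" and "l \<in> S" and "l \<noteq> m"
  shows "detS S (f(l := (\<lambda>j. f l j + c * f m j))) = detS S f"
proof -
  obtain e where e: "bij_betw e {0..<card S} S" using finite_enum[OF assms(1)] .
  let ?n = "card S"
  let ?A = "Matrix.mat ?n ?n (\<lambda>(i, j). f (e i) (e j))"
  obtain x where x: "x < ?n" "e x = m"
    using enum_surj[OF e assms(2)] .
  obtain y where y: "y < ?n" "e y = l"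
    using enum_surj[OF e assms(3)] .
  have inj: "e i = e j \<longleftrightarrow> i = j" if "i < ?n" "j < ?n" for i j
    using e that by (auto simp: bij_betw_def inj_on_def)
  have "Matrix.mat ?n ?n (\<lambda>(i, j). (f(l := (\<lambda>j. f l j + c * f m j))) (e i) (e j)) =
    addrow c y x ?A"
    by (rule eq_matI) (use x y inj in \<open>auto simp: mat_addrow_def\<close>)
  moreover have "Determinant.det (addrow c y x ?A) = Determinant.det ?A"
    by (rule Determinant.det_addrow[OF x(1)]) (use x y assms(4) in auto)
  ultimately show ?thesis
    by (simp add: detS_enum[OF e] detE_def)
qed

lemma detS_scale_row:
  assumes "finite S" and "m \<in> S"
  shows "detS S (f(m := (\<lambda>j. c * f m j))) = c * detS S f"
proof -
  obtain e where e: "bij_betw e {0..<card S} S" using finite_enum[OF assms(1)] .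
  let ?n = "card S"
  let ?A = "Matrix.mat ?n ?n (\<lambda>(i, j). f (e i) (e j))"
  obtain x where x: "x < ?n" "e x = m"
    using enum_surj[OF e assms(2)] .
  have inj: "e i = e j \<longleftrightarrow> i = j" if "i < ?n" "j < ?n" for i j
    using e that by (auto simp: bij_betw_def inj_on_def)
  have "Matrix.mat ?n ?n (\<lambda>(i, j). (f(m := (\<lambda>j. c * f m j))) (e i) (e j)) = multrow x c ?A"
    by (rule eq_matI) (use x inj in \<open>auto simp: mat_multrow_def\<close>)
  moreover have "Determinant.det (multrow x c ?A) = c * Determinant.det ?A"
    by (rule Determinant.det_multrow[OF x(1)]) auto
  ultimately show ?thesis
    by (simp add: detS_enum[OF e] detE_def)
qed

text \<open>Row \<open>m\<close> lies outside \<open>L\<close>, so it keeps its original value while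
  the other rows are treated one at a time.\<close>

lemma detS_add_to_rows:
  assumes "finite S" and "m \<in> S" and "finite L" and "L \<subseteq> S - {m}"
  shows "detS S (\<lambda>l j. if l \<in> L then f l j + c l * f m j else f l j) = detS S f"
  using assms(3,4)
proof (induction L rule: finite_induct)
  case empty
  then show ?case by simp
next
  case (insert x L)
  let ?g = "\<lambda>l j. if l \<in> L then f l j + c l * f m j else f l j"
  have "(\<lambda>l j. if l \<in> insert x L then f l j + c l * f m j else f l j) =
    ?g(x := (\<lambda>j. ?g x j + c x * ?g m j))"
    using insert by (auto simp: fun_eq_iff)
  moreover have "detS S (?g(x := (\<lambda>j. ?g x j + c x * ?g m j))) = detS S ?g"
    by (rule detS_addrow) (use insert assms in auto)
  ultimately show ?case using insert by simp
qed

lemma detS_insert: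
  assumes "finite S" and "m \<notin> S" and row: "\<And>j. j \<in> S \<Longrightarrow> f m j = 0"
  shows "detS (insert m S) f = f m m * detS S f"
proof -
  obtain e where e: "bij_betw e {0..<card S} S" using finite_enum[OF assms(1)] .
  let ?n = "card S"
  \<comment> \<open>The new index is put last, so its diagonal cofactor is the determinant over the
    old enumeration, with sign \<open>+1\<close>.\<close>
  define e' where "e' = e(?n := m)"
  have img: "e ` {0..<?n} = S" and inj: "inj_on e {0..<?n}"
    using e by (auto simp: bij_betw_def)
  have im': "e' ` {0..<?n} = S"
    by (rule trans[OF image_cong img]) (auto simp: e'_def)
  have "inj_on e' {0..<?n}"
    using inj by (rule inj_on_cong[THEN iffD1, rotated]) (auto simp: e'_def)
  moreover have e'n: "e' ?n = m" by (simp add: e'_def)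
  ultimately have e': "bij_betw e' {0..<Suc ?n} (insert m S)"
    using im' assms(2) e'n by (simp add: bij_betw_def atLeast0_lessThan_Suc)
  have eS: "e i \<in> S" if "i < ?n" for i using e that by (auto simp: bij_betw_def)
  let ?A = "Matrix.mat (Suc ?n) (Suc ?n) (\<lambda>(i, j). f (e' i) (e' j))"
  have "Determinant.det ?A = (\<Sum>j<Suc ?n. ?A $$ (?n, j) * cofactor ?A ?n j)"
    by (rule laplace_expansion_row) auto
  also have "\<dots> = ?A $$ (?n, ?n) * cofactor ?A ?n ?n"
    by (simp add: e'_def row eS)
  also have "cofactor ?A ?n ?n = Determinant.det (mat_delete ?A ?n ?n)"
    by (simp add: cofactor_def)
  also have "mat_delete ?A ?n ?n = Matrix.mat ?n ?n (\<lambda>(i, j). f (e i) (e j))"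
    by (rule eq_matI) (auto simp: mat_delete_def e'_def)
  finally show ?thesis
    by (simp add: detS_enum[OF e] detS_enum[OF e'] detE_def) (simp add: e'_def)
qed

text \<open>Gaussian elimination of the variable \<open>m\<close> by the equation \<open>k\<close>,
  where \<open>u\<close> is meant as the inverse of the pivot \<open>f k m\<close>. Row
  \<open>k\<close> becomes the unit vector at \<open>m\<close> instead of being deleted, so the
  index set does not change.\<close>

definition elim_rows :: "'b \<Rightarrow> 'b \<Rightarrow> 'a \<Rightarrow> ('b \<Rightarrow> 'b \<Rightarrow> 'a::comm_ring_1) \<Rightarrow> 'b \<Rightarrow> 'b \<Rightarrow> 'a" where
  "elim_rows k m u f l j = (if l = k then if j = m then 1 else 0 else f l j - f l m * u * f k j)"

text \<open>Column \<open>m\<close> has at most one nonzero entry, the one in row \<open>k\<close>.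
  In the expansion along this column the only surviving minor omits row \<open>k\<close>, so the
  remaining entries of that row may be altered.\<close>

lemma detS_row_irrelevant:
  assumes "finite S" and "k \<in> S" and "m \<in> S"
    and col: "\<And>l. l \<in> S \<Longrightarrow> l \<noteq> k \<Longrightarrow> f l m = 0"
    and eq: "\<And>l j. l \<in> S \<Longrightarrow> j \<in> S \<Longrightarrow> l \<noteq> k \<or> j = m \<Longrightarrow> f l j = g l j"
  shows "detS S f = detS S g"
proof -
  obtain e where e: "bij_betw e {0..<card S} S" using finite_enum[OF assms(1)] .
  let ?n = "card S"
  obtain x where x: "x < ?n" "e x = k"
    using enum_surj[OF e assms(2)] .
  obtain y where y: "y < ?n" "e y = m"
    using enum_surj[OF e assms(3)] .
  have inj: "e i = e j \<longleftrightarrow> i = j" if "i < ?n" "j < ?n" for i j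
    using e that by (auto simp: bij_betw_def inj_on_def)
  have eS: "e i \<in> S" if "i < ?n" for i using e that by (auto simp: bij_betw_def)
  let ?A = "\<lambda>f. Matrix.mat ?n ?n (\<lambda>(i, j). f (e i) (e j))"
  have expand: "Determinant.det (?A h) = h k m * cofactor (?A h) x y"
    if "\<And>l. l \<in> S \<Longrightarrow> l \<noteq> k \<Longrightarrow> h l m = 0" for h :: "'a \<Rightarrow> 'a \<Rightarrow> 'b"
  proof -
    have "Determinant.det (?A h) = (\<Sum>i<?n. ?A h $$ (i, y) * cofactor (?A h) i y)"
      by (rule laplace_expansion_column) (use y in auto)
    also have "\<dots> = (\<Sum>i\<in>{x}. ?A h $$ (i, y) * cofactor (?A h) i y)"
    proof (rule sum.mono_neutral_right)
      show "\<forall>i\<in>{..<?n} - {x}. ?A h $$ (i, y) * cofactor (?A h) i y = 0"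
      proof
        fix i assume i: "i \<in> {..<?n} - {x}"
        then have "e i \<noteq> k" using inj[of i x] x by auto
        then show "?A h $$ (i, y) * cofactor (?A h) i y = 0"
          using that[of "e i"] eS[of i] i y by simp
      qed
    qed (use x in auto)
    finally show ?thesis using x y by simp
  qed
  have "mat_delete (?A f) x y = mat_delete (?A g) x y"
  proof (rule eq_matI, goal_cases)
    case (1 i j)
    then have ij: "i < ?n - 1" "j < ?n - 1" by auto
    let ?i = "if i < x then i else Suc i" and ?j = "if j < y then j else Suc j"
    have b: "?i < ?n" "?j < ?n" "?i \<noteq> x" using ij x y by auto
    then have "e ?i \<noteq> k" using inj[of ?i x] x by auto
    then have "f (e ?i) (e ?j) = g (e ?i) (e ?j)" using b by (intro eq eS) auto
    then show ?case using ij b by (simp add: mat_delete_def)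
  qed auto
  moreover have "f k m = g k m" by (rule eq) (use assms in auto)
  moreover have "g l m = 0" if "l \<in> S" "l \<noteq> k" for l
    using col[OF that] eq[of l m] that assms(3) by simp
  ultimately show ?thesis
    using expand[of f] expand[of g] col
    by (simp add: detS_enum[OF e] detE_def cofactor_def)
qed

lemma detS_elim:
  assumes "finite S" and "k \<in> S" and "m \<in> S" and u: "f k m * u = 1"
  shows "detS S f = f k m * detS S (elim_rows k m u f)"
proof -
  let ?g = "\<lambda>l j. if l \<in> S - {k} then f l j + (- (f l m * u)) * f k j else f l j"
  \<comment> \<open>Row \<open>k\<close> is now the pivot times the unit vector at \<open>m\<close>.
    It agrees with \<open>f\<close> in column \<open>m\<close>, which is all that counts once the
    rest of that column is cleared.\<close>
  let ?h = "(elim_rows k m u f)(k := (\<lambda>j. f k m * elim_rows k m u f k j))"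
  have "detS S f = detS S ?g"
    by (rule detS_add_to_rows[symmetric]) (use assms in auto)
  also have "\<dots> = detS S ?h"
    by (rule detS_row_irrelevant[of S k m])
       (use assms u in \<open>auto simp: elim_rows_def mult.assoc mult.commute[of u]\<close>)
  also have "\<dots> = f k m * detS S (elim_rows k m u f)"
    by (rule detS_scale_row[OF assms(1,2)])
  finally show ?thesis .
qed

section \<open>Passages on the circle\<close>

lemma frac_add_int [simp]: "frac (x + of_int n) = frac x"
  by (simp add: frac_def)

lemma frac_eq_iff: "frac x = frac y \<longleftrightarrow> (\<exists>n::int. x = y + of_int n)"
proof
  assume "frac x = frac y"
  then have "x = y + of_int (\<lfloor>x\<rfloor> - \<lfloor>y\<rfloor>)" by (simp add: frac_def)
  then show "\<exists>n::int. x = y + of_int n" ..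
qed auto

lemma frac_eq_iff_Ints: "frac x = frac y \<longleftrightarrow> x - y \<in> \<int>"
  unfolding frac_eq_iff by (auto elim!: Ints_cases simp: algebra_simps)

lemma frac_in_unit: "frac x \<in> {0..<1}"
  by (simp add: frac_lt_1)

lemma frac_unit: "x \<in> {0..<1} \<Longrightarrow> frac x = x"
  by (simp add: frac_eq)

lemma frac_neq: "(u :: 'a :: floor_ceiling) < v \<Longrightarrow> v < u + 1 \<Longrightarrow> frac u \<noteq> frac v"
proof
  assume "u < v" "v < u + 1" "frac u = frac v"
  then obtain n :: int where "u = v + of_int n" unfolding frac_eq_iff by auto
  then have "of_int n < (0::'a)" "of_int (n + 1) > (0::'a)"
    using \<open>u < v\<close> \<open>v < u + 1\<close> by (auto simp: algebra_simps)
  then show False by (simp only: of_int_less_0_iff of_int_0_less_iff)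
qed

subsection \<open>Cyclic successor\<close>

text \<open>The first point of \<open>Y\<close> met on the circle after \<open>k\<close>, found on
  the line and reduced modulo 1. The right end \<open>k + 1\<close> is included, so the only point
  of a one-element \<open>Y\<close> is its own successor.\<close>

definition nx :: "real set \<Rightarrow> real \<Rightarrow> real" where
  "nx Y k = frac (Min {x. k < x \<and> x \<le> k + 1 \<and> frac x \<in> Y})"

text \<open>The successor relation on the line, before reduction modulo 1; in this form it can be
  carried along translations and order isomorphisms.\<close>

definition adjacent :: "real set \<Rightarrow> real \<Rightarrow> real \<Rightarrow> bool" where
  "adjacent Y u v \<longleftrightarrow> u < v \<and> v \<le> u + 1 \<and> frac v \<in> Y \<and> (\<forall>x. u < x \<and> x < v \<longrightarrow> frac x \<notin> Y)"

lemma finite_lift: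
  assumes "finite Y"
  shows "finite {x::real. u \<le> x \<and> x \<le> v \<and> frac x \<in> Y}"
proof (rule finite_subset)
  show "{x. u \<le> x \<and> x \<le> v \<and> frac x \<in> Y} \<subseteq> (\<lambda>(y, n). y + of_int n) ` (Y \<times> {\<lfloor>u\<rfloor>..\<lfloor>v\<rfloor>})"
  proof
    fix x assume "x \<in> {x. u \<le> x \<and> x \<le> v \<and> frac x \<in> Y}"
    then have "frac x \<in> Y" "\<lfloor>x\<rfloor> \<in> {\<lfloor>u\<rfloor>..\<lfloor>v\<rfloor>}" "x = frac x + of_int \<lfloor>x\<rfloor>"
      by (auto simp: floor_mono frac_def)
    then show "x \<in> (\<lambda>(y, n). y + of_int n) ` (Y \<times> {\<lfloor>u\<rfloor>..\<lfloor>v\<rfloor>})"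
      by (intro image_eqI[where x = "(frac x, \<lfloor>x\<rfloor>)"]) auto
  qed
qed (use assms in auto)

lemma finite_lift': "finite Y \<Longrightarrow> finite {x::real. u < x \<and> x \<le> v \<and> frac x \<in> Y}"
  by (rule finite_subset[OF _ finite_lift[of Y u v]]) auto

lemma nx_adjacent:
  assumes "finite Y" and "adjacent Y k t"
  shows "nx Y k = frac t"
proof -
  have "Min {x. k < x \<and> x \<le> k + 1 \<and> frac x \<in> Y} = t"
    by (rule Min_eqI[OF finite_lift'[OF assms(1)]])
       (use assms(2) in \<open>auto simp: adjacent_def not_less[symmetric]\<close>)
  then show ?thesis by (simp add: nx_def)
qed

lemma adjacent_shift: "adjacent Y u v \<Longrightarrow> adjacent Y (u + of_int n) (v + of_int n)"
  unfolding adjacent_def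
  using frac_add_int[of _ n]
  by (auto simp: algebra_simps)
     (metis add.commute diff_add_cancel frac_add_int less_diff_eq diff_less_eq)

lemma ex_adjacent:
  assumes "finite Y" and "Y \<subseteq> {0..<1}" and "Y \<noteq> {}"
  obtains t where "adjacent Y k t"
proof -
  let ?Z = "{x. k < x \<and> x \<le> k + 1 \<and> frac x \<in> Y}"
  obtain y where y: "y \<in> Y" using assms(3) by auto
  \<comment> \<open>The turn in which the lift of \<open>y\<close> falls after \<open>k\<close> and
    not after \<open>k + 1\<close>, so the set whose minimum is taken is nonempty.\<close>
  define n where "n = \<lfloor>k - y\<rfloor> + 1"
  have "k < y + of_int n" "y + of_int n \<le> k + 1"
    unfolding n_def by linarith+
  moreover have "frac (y + of_int n) \<in> Y"
    using y assms(2) by (auto simp: frac_unit subset_iff)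
  ultimately have ne: "?Z \<noteq> {}" by auto
  have fin: "finite ?Z" by (rule finite_lift'[OF assms(1)])
  have m: "Min ?Z \<in> ?Z" using Min_in[OF fin ne] .
  moreover have "frac x \<notin> Y" if "k < x" "x < Min ?Z" for x
  proof
    assume "frac x \<in> Y"
    then have "x \<in> ?Z" using that m by auto
    then have "Min ?Z \<le> x" by (rule Min_le[OF fin])
    then show False using that by simp
  qed
  ultimately have "adjacent Y k (Min ?Z)" by (auto simp: adjacent_def)
  then show ?thesis using that by blast
qed

lemma nx_shift:
  assumes "finite Y" and "Y \<subseteq> {0..<1}" and "Y \<noteq> {}"
  shows "nx Y (k + of_int n) = nx Y k"
proof -
  obtain t where t: "adjacent Y k t" using ex_adjacent[OF assms] .
  show ?thesis
    using nx_adjacent[OF assms(1) t] nx_adjacent[OF assms(1) adjacent_shift[OF t, of n]] by simp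
qed

lemma nx_frac:
  assumes "finite Y" and "Y \<subseteq> {0..<1}" and "Y \<noteq> {}"
  shows "nx Y (frac k) = nx Y k"
  using nx_shift[OF assms, of "frac k" "\<lfloor>k\<rfloor>"] by (simp add: frac_def)

lemma nx_in:
  assumes "finite Y" and "Y \<subseteq> {0..<1}" and "Y \<noteq> {}"
  shows "nx Y k \<in> Y"
proof -
  obtain t where t: "adjacent Y k t" using ex_adjacent[OF assms] .
  then show ?thesis using nx_adjacent[OF assms(1) t] by (simp add: adjacent_def)
qed

text \<open>After a shift both gaps end at the same lift; if the starting points differed, the later
  one would lie inside the gap of the earlier one.\<close>

lemma nx_inj:
  assumes "finite Y" and "Y \<subseteq> {0..<1}" and "k \<in> Y" and "l \<in> Y" and "nx Y k = nx Y l"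
  shows "k = l"
proof -
  have ne: "Y \<noteq> {}" using assms by auto
  obtain t where t: "adjacent Y k t" using ex_adjacent[OF assms(1,2) ne] .
  obtain u where u: "adjacent Y l u" using ex_adjacent[OF assms(1,2) ne] .
  have "frac t = frac u" using assms(5) nx_adjacent[OF assms(1) t] nx_adjacent[OF assms(1) u] by simp
  then obtain n :: int where n: "t = u + of_int n" unfolding frac_eq_iff by auto
  define l' where "l' = l + of_int n"
  have u': "adjacent Y l' t" unfolding l'_def n by (rule adjacent_shift[OF u])
  have fk: "frac k \<in> Y" using assms by (simp add: frac_unit subset_iff)
  have fl: "frac l' \<in> Y" using assms by (simp add: l'_def frac_unit subset_iff)
  have "\<not> k < l'" using t u' fl unfolding adjacent_def by auto
  moreover have "\<not> l' < k" using t u' fk unfolding adjacent_def by auto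
  ultimately have "k = l + of_int n" unfolding l'_def by simp
  then have "frac k = frac l" by simp
  then show ?thesis using assms by (simp add: frac_unit subset_iff)
qed

text \<open>Only the gap that contains \<open>m\<close> changes: it is split at \<open>m\<close>, so
  the predecessor of \<open>m\<close> reaches its old successor in two steps.\<close>

lemma nx_insert:
  assumes "finite Y" and "Y \<subseteq> {0..<1}" and k: "k \<in> Y" and m: "m \<in> {0..<1} - Y"
  defines "Y' \<equiv> insert m Y"
  shows "nx Y k = (if nx Y' k = m then nx Y' m else nx Y' k)" and "nx Y' m \<noteq> m"
proof -
  have Y': "finite Y'" "Y' \<subseteq> {0..<1}" "Y' \<noteq> {}" using assms by (auto simp: Y'_def)
  have ne: "Y \<noteq> {}" using k by auto
  have fk: "frac (k + of_int n) = k" for n using k assms(2) by (simp add: frac_unit subset_iff)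
  have fm: "frac m = m" using m by (simp add: frac_unit)
  have meq: "k + of_int n \<noteq> m + of_int n'" for n n'
    using frac_add_int[of k n] frac_add_int[of m n'] fk fm m k by (metis DiffE)
  have mm: "nx Y' m \<noteq> m"
  proof -
    obtain t where t: "adjacent Y' m t" using ex_adjacent[OF Y'] .
    \<comment> \<open>The lift of \<open>k\<close> in the turn after \<open>m\<close>. It ends the
      gap that starts at \<open>m\<close> before the turn is complete, so \<open>m\<close> does not
      follow itself.\<close>
    define k' where "k' = k + of_int (\<lfloor>m - k\<rfloor> + 1)"
    have "m < k'" "k' \<le> m + 1" unfolding k'_def by linarith+
    moreover have "k' \<noteq> m + 1" using meq[of "\<lfloor>m - k\<rfloor> + 1" 1] by (simp add: k'_def)
    moreover have "frac k' \<in> Y'" unfolding k'_def fk using k by (simp add: Y'_def)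
    ultimately have "t < m + 1" using t unfolding adjacent_def by (cases "k' < t") auto
    then have "frac m \<noteq> frac t" using t frac_neq by (auto simp: adjacent_def)
    then show ?thesis using nx_adjacent[OF Y'(1) t] fm by simp
  qed
  then show "nx Y' m \<noteq> m" .
  obtain t where t: "adjacent Y' k t" using ex_adjacent[OF Y'] .
  note nt = nx_adjacent[OF Y'(1) t]
  show "nx Y k = (if nx Y' k = m then nx Y' m else nx Y' k)"
  proof (cases "frac t = m")
    case False
    then have "adjacent Y k t" using t by (auto simp: adjacent_def Y'_def)
    then show ?thesis using False nt nx_adjacent[OF assms(1)] by simp
  next
    case True
    obtain t' where t': "adjacent Y' t t'" using ex_adjacent[OF Y'] .
    have nt': "frac t' = nx Y' m" using nx_adjacent[OF Y'(1) t'] nx_frac[OF Y', of t] True by simp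
    have k1: "frac (k + 1) = k" using fk[of 1] by simp
    have "t \<noteq> k + 1" using True k1 k m by auto
    then have "t < k + 1" using t by (auto simp: adjacent_def)
    then have "t' \<le> k + 1" using t' k1 k by (auto simp: adjacent_def Y'_def not_less[symmetric])
    moreover have "frac x \<notin> Y" if "k < x" "x < t'" for x
      using that t t' True m by (cases x t rule: linorder_cases) (auto simp: adjacent_def Y'_def)
    ultimately have "adjacent Y k t'"
      using t t' nt' mm nx_in[OF Y', of m] by (auto simp: adjacent_def Y'_def)
    then have "nx Y k = frac t'" by (rule nx_adjacent[OF assms(1)])
    then show ?thesis using nt nt' True by simp
  qed
qed

subsection \<open>Alternating colouring\<close>

text \<open>Half-open, so that counts over consecutive intervals add up; a point of \<open>Y\<close>
  is counted once for each of its lifts.\<close>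

definition lift_count :: "real set \<Rightarrow> real \<Rightarrow> real \<Rightarrow> nat" where
  "lift_count Y u v = card {x. u \<le> x \<and> x < v \<and> frac x \<in> Y}"

text \<open>Colours alternate along \<open>Y\<close>, starting at the base point 0. For
  \<open>Y\<close> of even size they also alternate across the base point, and equality of two
  colours becomes independent of it.\<close>

definition colour :: "real set \<Rightarrow> real \<Rightarrow> bool" where
  "colour Y t \<longleftrightarrow> odd (card (Y \<inter> {0..<frac t}))"

lemma finite_lift'': "finite Y \<Longrightarrow> finite {x::real. u \<le> x \<and> x < v \<and> frac x \<in> Y}"
  by (rule finite_subset[OF _ finite_lift[of Y u v]]) auto

lemma colour_frac [simp]: "colour Y (frac t) = colour Y t"
  by (simp add: colour_def)

lemma lift_count_add:
  assumes "finite Y" "u \<le> v" "v \<le> w"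
  shows "lift_count Y u w = lift_count Y u v + lift_count Y v w"
proof -
  have "{x. u \<le> x \<and> x < w \<and> frac x \<in> Y} =
    {x. u \<le> x \<and> x < v \<and> frac x \<in> Y} \<union> {x. v \<le> x \<and> x < w \<and> frac x \<in> Y}"
    using assms by auto
  moreover have "{x. u \<le> x \<and> x < v \<and> frac x \<in> Y} \<inter> {x. v \<le> x \<and> x < w \<and> frac x \<in> Y} = {}"
    by auto
  ultimately show ?thesis unfolding lift_count_def
    by (simp only: card_Un_disjoint[OF finite_lift''[OF assms(1)] finite_lift''[OF assms(1)]])
qed

lemma lift_count_floor:
  assumes "Y \<subseteq> {0..<1}"
  shows "lift_count Y (of_int \<lfloor>v\<rfloor>) v = card (Y \<inter> {0..<frac v})"
proof -
  have "bij_betw (\<lambda>x. x + of_int \<lfloor>v\<rfloor>) (Y \<inter> {0..<frac v}) {x. of_int \<lfloor>v\<rfloor> \<le> x \<and> x < v \<and> frac x \<in> Y}"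
  proof (rule bij_betw_imageI)
    show "(\<lambda>x. x + of_int \<lfloor>v\<rfloor>) ` (Y \<inter> {0..<frac v}) = {x. of_int \<lfloor>v\<rfloor> \<le> x \<and> x < v \<and> frac x \<in> Y}"
    proof (intro equalityI subsetI)
      fix x assume "x \<in> (\<lambda>x. x + of_int \<lfloor>v\<rfloor>) ` (Y \<inter> {0..<frac v})"
      then show "x \<in> {x. of_int \<lfloor>v\<rfloor> \<le> x \<and> x < v \<and> frac x \<in> Y}"
        using assms by (auto simp: frac_unit subset_iff) (simp add: frac_def algebra_simps)
    next
      fix x assume x: "x \<in> {x. of_int \<lfloor>v\<rfloor> \<le> x \<and> x < v \<and> frac x \<in> Y}"
      then have "\<lfloor>x\<rfloor> = \<lfloor>v\<rfloor>" by (simp, linarith)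
      then have "x = frac x + of_int \<lfloor>v\<rfloor>" "frac x < frac v" using x by (auto simp: frac_def)
      then show "x \<in> (\<lambda>x. x + of_int \<lfloor>v\<rfloor>) ` (Y \<inter> {0..<frac v})"
        using x by (intro image_eqI[where x = "frac x"]) auto
    qed
  qed (auto simp: inj_on_def)
  then show ?thesis unfolding lift_count_def by (simp add: bij_betw_same_card)
qed

lemma lift_count_unit:
  assumes "Y \<subseteq> {0..<1}"
  shows "lift_count Y (of_int n) (of_int n + 1) = card Y"
proof -
  have "bij_betw (\<lambda>x. x + of_int n) Y {x. of_int n \<le> x \<and> x < of_int n + 1 \<and> frac x \<in> Y}"
  proof (rule bij_betw_imageI)
    show "(\<lambda>x. x + of_int n) ` Y = {x. of_int n \<le> x \<and> x < of_int n + 1 \<and> frac x \<in> Y}"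
    proof (intro equalityI subsetI)
      fix x assume "x \<in> (\<lambda>x. x + of_int n) ` Y"
      then show "x \<in> {x. of_int n \<le> x \<and> x < of_int n + 1 \<and> frac x \<in> Y}"
        using assms by (auto simp: frac_unit subset_iff)
    next
      fix x assume x: "x \<in> {x. of_int n \<le> x \<and> x < of_int n + 1 \<and> frac x \<in> Y}"
      then have "\<lfloor>x\<rfloor> = n" by (simp, linarith)
      then have "x = frac x + of_int n" using x by (auto simp: frac_def)
      then show "x \<in> (\<lambda>x. x + of_int n) ` Y"
        using x by (intro image_eqI[where x = "frac x"]) auto
    qed
  qed (auto simp: inj_on_def)
  then show ?thesis unfolding lift_count_def by (simp add: bij_betw_same_card)
qed

lemma lift_count_even:
  assumes "finite Y" "Y \<subseteq> {0..<1}" "even (card Y)"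
  shows "even (lift_count Y (of_int m) (of_int m + of_nat n))"
proof (induction n)
  case 0
  have "lift_count Y x x = 0" for x
  proof -
    have "{y. x \<le> y \<and> y < x \<and> frac y \<in> Y} = {}" by auto
    then show ?thesis by (simp only: lift_count_def card.empty)
  qed
  then show ?case by simp
next
  case (Suc n)
  have "lift_count Y (of_int m) (of_int m + of_nat (Suc n)) =
    lift_count Y (of_int m) (of_int m + of_nat n) +
    lift_count Y (of_int (m + int n)) (of_int (m + int n) + 1)"
    by (subst lift_count_add[OF assms(1), of _ "of_int m + of_nat n"]) (auto simp: algebra_simps)
  then show ?case using Suc assms lift_count_unit[OF assms(2), of "m + int n"] by simp
qed

text \<open>A full turn adds \<open>card Y\<close>, which is even; so the parity of a count on the
  line is determined by the colours at its two ends.\<close>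

lemma colour_diff:
  assumes "finite Y" "Y \<subseteq> {0..<1}" "even (card Y)" "u \<le> v"
  shows "colour Y u \<noteq> colour Y v \<longleftrightarrow> odd (lift_count Y u v)"
proof -
  let ?m = "\<lfloor>u\<rfloor>" and ?n = "\<lfloor>v\<rfloor>"
  have mn: "?m \<le> ?n" using assms(4) by (rule floor_mono)
  have n: "(of_int ?n :: real) = of_int ?m + of_nat (nat (?n - ?m))" using mn by simp
  have "lift_count Y (of_int ?m) v = lift_count Y (of_int ?m) u + lift_count Y u v"
    by (rule lift_count_add) (use assms in auto)
  moreover have "lift_count Y (of_int ?m) v =
    lift_count Y (of_int ?m) (of_int ?n) + lift_count Y (of_int ?n) v"
    by (rule lift_count_add) (use assms mn in auto)
  moreover have "even (lift_count Y (of_int ?m) (of_int ?n))"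
    unfolding n by (rule lift_count_even) (use assms in auto)
  ultimately show ?thesis
    unfolding colour_def lift_count_floor[OF assms(2), symmetric] by presburger
qed

lemma colour_adjacent:
  assumes "finite Y" "Y \<subseteq> {0..<1}" "even (card Y)" "frac u \<in> Y" "adjacent Y u v"
  shows "colour Y v \<longleftrightarrow> \<not> colour Y u"
proof -
  have "{x. u \<le> x \<and> x < v \<and> frac x \<in> Y} = {u}"
    using assms(4,5) by (auto simp: adjacent_def order_le_less)
  then have "lift_count Y u v = 1" by (simp add: lift_count_def)
  then show ?thesis using colour_diff[OF assms(1-3), of u v] assms(5) by (auto simp: adjacent_def)
qed

section \<open>Elimination of the arcs inside a disc\<close>

definition dl :: "'b \<Rightarrow> 'b \<Rightarrow> 'a::comm_ring_1" where
  "dl m j = (if j = m then 1 else 0)"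

lemma dl_same [simp]: "dl m m = 1" by (simp add: dl_def)
lemma dl_neq [simp]: "m \<noteq> j \<Longrightarrow> dl m j = 0" "j \<noteq> m \<Longrightarrow> dl m j = 0" by (auto simp: dl_def)

text \<open>\<open>f\<close> is the matrix with a kink, and \<open>g\<close> has markers at
  \<open>s\<close> and \<open>t\<close>. Row \<open>s\<close> of \<open>f\<close> gives the loop arc
  as \<open>- u * a\<close> times the arc entering at \<open>s\<close>. Substituted in row
  \<open>t\<close>, this yields the coefficient \<open>d - c * u * a\<close>, so \<open>comp\<close>
  says that the strand leaves the kink unchanged. The pivots \<open>b - 1\<close> and
  \<open>-1\<close> account for the factor \<open>1 - b\<close>.\<close>

lemma detS_kink:
  fixes f g :: "'b \<Rightarrow> 'b \<Rightarrow> 'a::comm_ring_1"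
  assumes S: "finite S" "s \<in> S" "t \<in> S" and neq: "s \<noteq> t" "n \<noteq> t"
    and fs: "\<And>j. j \<in> S \<Longrightarrow> f s j = a * dl s j + b * dl t j - dl t j"
    and ft: "\<And>j. j \<in> S \<Longrightarrow> f t j = c * dl t j + d * dl s j - dl n j"
    and gs: "\<And>j. j \<in> S \<Longrightarrow> g s j = dl s j - dl t j"
    and gt: "\<And>j. j \<in> S \<Longrightarrow> g t j = dl t j - dl n j"
    and unit: "(b - 1) * u = 1" and comp: "d - c * u * a = 1"
    and f0: "\<And>l. l \<in> S \<Longrightarrow> l \<noteq> s \<Longrightarrow> l \<noteq> t \<Longrightarrow> f l t = 0"
    and fg: "\<And>l j. l \<in> S \<Longrightarrow> j \<in> S \<Longrightarrow> l \<noteq> s \<Longrightarrow> l \<noteq> t \<Longrightarrow> f l j = g l j"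
  shows "detS S f = (1 - b) * detS S g"
proof -
  have "detS S f = f s t * detS S (elim_rows s t u f)"
    by (rule detS_elim) (use assms in \<open>auto simp: fs\<close>)
  moreover have "detS S g = g s t * detS S (elim_rows s t (-1) g)"
    by (rule detS_elim) (use assms in \<open>auto simp: gs\<close>)
  moreover have "detS S (elim_rows s t u f) = detS S (elim_rows s t (-1) g)"
  proof (rule detS_cong[OF S(1)])
    fix k j assume kj: "k \<in> S" "j \<in> S"
    have bu: "b * u = 1 + u" using unit by (simp add: algebra_simps)
    have d: "d = 1 + c * u * a" using comp by (simp add: algebra_simps)
    consider "k = s" | "k = t" | "k \<noteq> s" "k \<noteq> t" by auto
    then show "elim_rows s t u f k j = elim_rows s t (-1) g k j"
    proof cases
      case 2
      \<comment> \<open>The rule \<open>b * u = 1 + u\<close> in the shape that ring normalisation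
        produces.\<close>
      have key: "b * (c * (u * x)) = c * x + c * (u * x)" for x
      proof -
        have "b * (c * (u * x)) = c * ((b * u) * x)" by (simp only: ac_simps)
        also have "\<dots> = c * x + c * (u * x)" unfolding bu by (simp add: algebra_simps)
        finally show ?thesis .
      qed
      show ?thesis using 2 neq kj S
        by (simp add: elim_rows_def fs ft gs gt d key algebra_simps)
    next
      case 3
      then have "g k t = 0" using f0 fg S kj by metis
      then show ?thesis using 3 neq kj S by (simp add: elim_rows_def f0 fg)
    qed (simp add: elim_rows_def)
  qed
  ultimately show ?thesis using S neq by (simp add: fs gs algebra_simps)
qed

text \<open>\<open>A\<close> lies above \<open>B\<close>, so the rows of \<open>A\<close> contain
  arcs of \<open>A\<close> only, while those of \<open>B\<close> may contain arcs of both.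
  Eliminating the inner arcs \<open>A2\<close> and \<open>B2\<close> in this order leaves
  \<open>h\<close>, which expresses the outgoing arcs through the incoming ones. Both pivots are -1,
  so no sign remains.\<close>

lemma detS_two_strands:
  fixes f :: "'b \<Rightarrow> 'b \<Rightarrow> 'a::comm_ring_1"
  assumes S: "finite S" "{A1, A2, B1, B2} \<subseteq> S"
    and neq: "distinct [A1, A2, B1, B2]" "n1 \<notin> {A2, B2}" "n2 \<notin> {A2, B2}"
    and rA1: "\<And>j. j \<in> S \<Longrightarrow> f A1 j = a1 * dl A1 j - dl A2 j"
    and rA2: "\<And>j. j \<in> S \<Longrightarrow> f A2 j = a2 * dl A2 j - dl n1 j"
    and rB1: "\<And>j. j \<in> S \<Longrightarrow> f B1 j = b1 * dl B1 j + b11 * dl A1 j + b12 * dl A2 j - dl B2 j"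
    and rB2: "\<And>j. j \<in> S \<Longrightarrow> f B2 j = b2 * dl B2 j + b21 * dl A1 j + b22 * dl A2 j - dl n2 j"
    and f0: "\<And>l. l \<in> S - {A1, A2, B1, B2} \<Longrightarrow> f l A2 = 0 \<and> f l B2 = 0"
    and hf: "\<And>l j. l \<in> S - {A1, A2, B1, B2} \<Longrightarrow> j \<in> S \<Longrightarrow> h l j = f l j"
    and hA1: "\<And>j. j \<in> S \<Longrightarrow> h A1 j = dl A2 j" and hB1: "\<And>j. j \<in> S \<Longrightarrow> h B1 j = dl B2 j"
    and hA2: "\<And>j. j \<in> S \<Longrightarrow> h A2 j = a1 * a2 * dl A1 j - dl n1 j"
    and hB2: "\<And>j. j \<in> S \<Longrightarrow> h B2 j = b1 * b2 * dl B1 j +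
      (b2 * (b11 + b12 * a1) + b21 + b22 * a1) * dl A1 j - dl n2 j"
  shows "detS S f = detS S h"
proof -
  let ?E1 = "elim_rows A1 A2 (-1) f"
  let ?E2 = "elim_rows B1 B2 (-1) ?E1"
  have mem: "A1 \<in> S" "A2 \<in> S" "B1 \<in> S" "B2 \<in> S" using S by auto
  have "detS S f = f A1 A2 * detS S ?E1"
    by (rule detS_elim) (use S mem neq in \<open>auto simp: rA1\<close>)
  also have "detS S ?E1 = ?E1 B1 B2 * detS S ?E2"
    by (rule detS_elim) (use S mem neq in \<open>auto simp: rA1 rB1 elim_rows_def\<close>)
  also have "detS S ?E2 = detS S h"
  proof (rule detS_cong[OF S(1)])
    fix k j assume kj: "k \<in> S" "j \<in> S"
    then consider "k = A1" | "k = A2" | "k = B1" | "k = B2" | "k \<in> S - {A1, A2, B1, B2}" by auto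
    then show "?E2 k j = h k j"
    proof cases
      case 1 then show ?thesis using neq kj mem by (auto simp: elim_rows_def hA1)
    next
      case 2 then show ?thesis using neq kj mem
        by (auto simp: elim_rows_def hA2 rA1 rA2 rB1 algebra_simps)
    next
      case 3 then show ?thesis using neq kj mem by (auto simp: elim_rows_def hB1 dl_def)
    next
      case 4 then show ?thesis using neq kj mem
        by (auto simp: elim_rows_def hB2 rA1 rB1 rB2 algebra_simps)
    next
      case 5 then show ?thesis using neq kj mem
        by (auto simp: elim_rows_def hf f0 rA1 rB1)
    qed
  qed
  finally show ?thesis using S mem neq by (auto simp: rA1 rB1 elim_rows_def)
qed

text \<open>The same elimination for \<open>A\<close> above \<open>B\<close> above \<open>C\<close>,
  with inner arcs \<open>A2\<close>, \<open>B2\<close>, \<open>C2\<close>. The long coefficients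
  come from inserting the expression for each upper inner arc into the rows below; three pivots -1
  produce the sign.\<close>

lemma detS_three_strands:
  fixes f :: "'b \<Rightarrow> 'b \<Rightarrow> 'a::comm_ring_1"
  assumes S: "finite S" "{A1, A2, B1, B2, C1, C2} \<subseteq> S"
    and neq: "distinct [A1, A2, B1, B2, C1, C2]"
      "n1 \<notin> {A2, B2, C2}" "n2 \<notin> {A2, B2, C2}" "n3 \<notin> {A2, B2, C2}"
    and rA1: "\<And>j. j \<in> S \<Longrightarrow> f A1 j = a1 * dl A1 j - dl A2 j"
    and rA2: "\<And>j. j \<in> S \<Longrightarrow> f A2 j = a2 * dl A2 j - dl n1 j"
    and rB1: "\<And>j. j \<in> S \<Longrightarrow> f B1 j = b1 * dl B1 j + b11 * dl A1 j + b12 * dl A2 j - dl B2 j"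
    and rB2: "\<And>j. j \<in> S \<Longrightarrow> f B2 j = b2 * dl B2 j + b21 * dl A1 j + b22 * dl A2 j - dl n2 j"
    and rC1: "\<And>j. j \<in> S \<Longrightarrow> f C1 j = c1 * dl C1 j + c11 * dl A1 j + c12 * dl A2 j +
      d11 * dl B1 j + d12 * dl B2 j - dl C2 j"
    and rC2: "\<And>j. j \<in> S \<Longrightarrow> f C2 j = c2 * dl C2 j + c21 * dl A1 j + c22 * dl A2 j +
      d21 * dl B1 j + d22 * dl B2 j - dl n3 j"
    and f0: "\<And>l. l \<in> S - {A1, A2, B1, B2, C1, C2} \<Longrightarrow> f l A2 = 0 \<and> f l B2 = 0 \<and> f l C2 = 0"
    and hf: "\<And>l j. l \<in> S - {A1, A2, B1, B2, C1, C2} \<Longrightarrow> j \<in> S \<Longrightarrow> h l j = f l j"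
    and hA1: "\<And>j. j \<in> S \<Longrightarrow> h A1 j = dl A2 j" and hB1: "\<And>j. j \<in> S \<Longrightarrow> h B1 j = dl B2 j"
    and hC1: "\<And>j. j \<in> S \<Longrightarrow> h C1 j = dl C2 j"
    and hA2: "\<And>j. j \<in> S \<Longrightarrow> h A2 j = a1 * a2 * dl A1 j - dl n1 j"
    and hB2: "\<And>j. j \<in> S \<Longrightarrow> h B2 j = b1 * b2 * dl B1 j +
      (b2 * (b11 + b12 * a1) + b21 + b22 * a1) * dl A1 j - dl n2 j"
    and hC2: "\<And>j. j \<in> S \<Longrightarrow> h C2 j = c1 * c2 * dl C1 j +
      (c2 * (d11 + d12 * b1) + d21 + d22 * b1) * dl B1 j +
      (c2 * (c11 + c12 * a1 + d12 * (b11 + b12 * a1)) + c21 + c22 * a1 + d22 * (b11 + b12 * a1)) * dl A1 j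
      - dl n3 j"
  shows "detS S f = - detS S h"
proof -
  let ?E1 = "elim_rows A1 A2 (-1) f"
  let ?E2 = "elim_rows B1 B2 (-1) ?E1"
  let ?E3 = "elim_rows C1 C2 (-1) ?E2"
  have mem: "A1 \<in> S" "A2 \<in> S" "B1 \<in> S" "B2 \<in> S" "C1 \<in> S" "C2 \<in> S" using S by auto
  have "detS S f = f A1 A2 * detS S ?E1"
    by (rule detS_elim) (use S mem neq in \<open>auto simp: rA1\<close>)
  also have "detS S ?E1 = ?E1 B1 B2 * detS S ?E2"
    by (rule detS_elim) (use S mem neq in \<open>auto simp: rA1 rB1 elim_rows_def\<close>)
  also have "detS S ?E2 = ?E2 C1 C2 * detS S ?E3"
    by (rule detS_elim) (use S mem neq in \<open>auto simp: rA1 rB1 rC1 elim_rows_def\<close>)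
  also have "detS S ?E3 = detS S h"
  proof (rule detS_cong[OF S(1)])
    fix k j assume kj: "k \<in> S" "j \<in> S"
    then consider "k = A1" | "k = A2" | "k = B1" | "k = B2" | "k = C1" | "k = C2" |
      "k \<in> S - {A1, A2, B1, B2, C1, C2}" by auto
    then show "?E3 k j = h k j"
    proof cases
      case 1 then show ?thesis using neq kj mem by (auto simp: elim_rows_def hA1 dl_def)
    next
      case 2 then show ?thesis using neq kj mem
        by (auto simp: elim_rows_def hA2 rA1 rA2 rB1 rC1 algebra_simps)
    next
      case 3 then show ?thesis using neq kj mem by (auto simp: elim_rows_def hB1 dl_def)
    next
      case 4 then show ?thesis using neq kj mem
        by (auto simp: elim_rows_def hB2 rA1 rB1 rB2 rC1 algebra_simps)
    next
      case 5 then show ?thesis using neq kj mem by (auto simp: elim_rows_def hC1 dl_def)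
    next
      case 6 then show ?thesis using neq kj mem
        by (auto simp: elim_rows_def hC2 rA1 rB1 rC1 rC2 algebra_simps)
    next
      case 7 then show ?thesis using neq kj mem
        by (auto simp: elim_rows_def hf f0 rA1 rB1 rC1)
    qed
  qed
  finally show ?thesis using S mem neq by (auto simp: rA1 rB1 rC1 elim_rows_def)
qed

section \<open>Coefficients of the relations at a crossing\<close>

lemma mono3_mult: "mono3 a b c * mono3 a' b' c' = mono3 (a + a') (b + b') (c + c')"
  by (simp add: mono3_def Poly_Mapping.mult_single)

lemma mono3_one: "mono3 0 0 0 = 1"
  by (simp add: mono3_def zero_prod_def[symmetric])

lemma mono3_mult_left: "mono3 a b c * (mono3 a' b' c' * x) = mono3 (a + a') (b + b') (c + c') * x"
  by (simp add: mono3_mult mult.assoc[symmetric])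

text \<open>With \<open>p\<close> for odd: \<open>ocoef\<close> is the coefficient of the incoming
  over-arc in the outgoing one, \<open>ucoef\<close> the analogue for the under-strand, and
  \<open>mcoef\<close> the coefficient of the incoming over-arc in the outgoing under-arc.\<close>

definition ocoef :: "bool \<Rightarrow> int \<Rightarrow> laurent3" where
  "ocoef p \<epsilon> = (if p then mono3 0 0 \<epsilon> else mono3 \<epsilon> 0 0)"

definition ucoef :: "bool \<Rightarrow> int \<Rightarrow> laurent3" where
  "ucoef p \<epsilon> = (if p then mono3 0 0 (- \<epsilon>) else mono3 0 \<epsilon> 0)"

definition mcoef :: "bool \<Rightarrow> int \<Rightarrow> laurent3" where
  "mcoef p \<epsilon> = (if p then 0 else 1 - mono3 \<epsilon> \<epsilon> 0)"

lemmas coef_defs = ocoef_def ucoef_def mcoef_def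

text \<open>
  The crossings are \<open>x\<close> (strands \<open>A, B\<close>), \<open>y\<close> (\<open>A, C\<close>) and \<open>z\<close> (\<open>B, C\<close>), with \<open>A\<close> above \<open>B\<close> above \<open>C\<close>.
  Before the move \<open>A\<close> meets \<open>x\<close> first; \<open>\<beta>\<close> says that \<open>x\<close> precedes \<open>z\<close> on \<open>B\<close>, and \<open>\<gamma>\<close> that \<open>y\<close> precedes
  \<open>z\<close> on \<open>C\<close>. The colour of the first passage on each strand is \<open>cA, cB, cC\<close>.
\<close>

lemma third_move_identities:
  assumes e: "ex \<in> {1, -1}" "ey \<in> {1, -1}" "ez \<in> {1, -1}"
    and b: "\<beta> \<longleftrightarrow> ey = ez" and c: "\<gamma> \<longleftrightarrow> ex = ez"
    and px: "px \<longleftrightarrow> (cA = cB) = \<beta>" and py: "py \<longleftrightarrow> (cA \<noteq> cC) = \<gamma>"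
    and pz: "pz \<longleftrightarrow> ((cB \<noteq> \<beta>) = (cC \<noteq> \<gamma>))"
  shows
    "\<beta> \<Longrightarrow> ocoef pz ez * mcoef px ex = mcoef px ex * ocoef py ey"
    "\<not> \<beta> \<Longrightarrow> mcoef px ex = ocoef pz ez * (mcoef px ex * ocoef py ey)"
    "\<beta> \<Longrightarrow> \<gamma> \<Longrightarrow> mcoef pz ez * ucoef px ex = ucoef py ey * mcoef pz ez"
    "\<beta> \<Longrightarrow> \<gamma> \<Longrightarrow> ucoef pz ez * (mcoef py ey * ocoef px ex) + mcoef pz ez * mcoef px ex = mcoef py ey"
    "\<beta> \<Longrightarrow> \<not> \<gamma> \<Longrightarrow> ucoef py ey * (mcoef pz ez * ucoef px ex) = mcoef pz ez"
    "\<beta> \<Longrightarrow> \<not> \<gamma> \<Longrightarrow> ucoef py ey * (mcoef pz ez * mcoef px ex) + mcoef py ey * ocoef px ex =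
       ucoef pz ez * mcoef py ey"
    "\<not> \<beta> \<Longrightarrow> \<gamma> \<Longrightarrow> mcoef pz ez = ucoef py ey * (mcoef pz ez * ucoef px ex)"
    "\<not> \<beta> \<Longrightarrow> \<gamma> \<Longrightarrow> ucoef pz ez * (mcoef py ey * ocoef px ex) =
       ucoef py ey * (mcoef pz ez * (mcoef px ex * ocoef py ey)) + mcoef py ey"
    "\<not> \<beta> \<Longrightarrow> \<not> \<gamma> \<Longrightarrow> ucoef py ey * mcoef pz ez = mcoef pz ez * ucoef px ex"
    "\<not> \<beta> \<Longrightarrow> \<not> \<gamma> \<Longrightarrow> mcoef py ey * ocoef px ex =
       ucoef pz ez * mcoef py ey + mcoef pz ez * (mcoef px ex * ocoef py ey)"
  \<comment> \<open>Summed modulo 2, the colours and orders cancel from the three parities, so none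
    or two of the crossings are odd. What remains in each case is an identity between
    monomials.\<close>
  unfolding px py pz using e b c
  by (cases cA; cases cB; cases cC; auto simp: coef_defs mono3_mult mono3_mult_left mono3_one algebra_simps)+

section \<open>Gauss diagrams and their determinant\<close>

text \<open>
  Passages are represented by their times modulo 1: \<open>gC\<close> all passages, \<open>gO\<close> the over-passages, \<open>gM\<close> the
  other passage of the same crossing, \<open>gS\<close> the sign.
\<close>

record gauss =
  gC :: "real set"
  gO :: "real set"
  gM :: "real \<Rightarrow> real"
  gS :: "real \<Rightarrow> int"

definition wf_gauss :: "gauss \<Rightarrow> bool" where
  "wf_gauss G \<longleftrightarrow> finite (gC G) \<and> gC G \<subseteq> {0..<1} \<and> gO G \<subseteq> gC G \<and>
     (\<forall>k\<in>gC G. gM G k \<in> gC G \<and> gM G k \<noteq> k \<and> gM G (gM G k) = k \<and>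
        (gM G k \<in> gO G \<longleftrightarrow> k \<notin> gO G) \<and> gS G (gM G k) = gS G k \<and> gS G k \<in> {1, -1})"

definition g_odd :: "gauss \<Rightarrow> real \<Rightarrow> bool" where
  "g_odd G k \<longleftrightarrow> colour (gC G) k = colour (gC G) (gM G k)"

definition cf :: "gauss \<Rightarrow> real \<Rightarrow> real \<Rightarrow> laurent3" where
  "cf G k j =
     (if k \<notin> gC G then dl k j
      else if k \<in> gO G then ocoef (g_odd G k) (gS G k) * dl k j
      else ucoef (g_odd G k) (gS G k) * dl k j + mcoef (g_odd G k) (gS G k) * dl (gM G k) j)"

text \<open>An arc bears the name of the point of \<open>Y\<close> where it ends. Row
  \<open>k\<close> is the expression for the outgoing arc of \<open>k\<close> minus that arc itself,
  which ends at \<open>nx Y k\<close>.\<close>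

definition g_det :: "gauss \<Rightarrow> real set \<Rightarrow> laurent3" where
  "g_det G Y = detS Y (\<lambda>k j. cf G k j - dl (nx Y k) j)"

text \<open>The base point 0 is added so that a diagram without classical crossings still has its
  single arc. Any other nonempty finite set of points containing the passages gives the same value
  (\<open>g_det_eq_alex\<close>).\<close>

definition alex :: "gauss \<Rightarrow> laurent3" where
  "alex G = g_det G (insert 0 (gC G))"

lemma wf_finite: "wf_gauss G \<Longrightarrow> finite (gC G)"
  and wf_unit: "wf_gauss G \<Longrightarrow> gC G \<subseteq> {0..<1}"
  by (auto simp: wf_gauss_def)

text \<open>The mate map exchanges over-passages and under-passages.\<close>

lemma wf_even_card:
  assumes "wf_gauss G"
  shows "even (card (gC G))"
proof -
  have "bij_betw (gM G) (gO G) (gC G - gO G)"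
    by (rule bij_betwI[of _ _ _ "gM G"]) (use assms in \<open>auto simp: wf_gauss_def subset_iff\<close>)
  then have "card (gO G) = card (gC G - gO G)" by (rule bij_betw_same_card)
  moreover have "card (gC G) = card (gO G) + card (gC G - gO G)"
    using assms by (subst card_Un_disjoint[symmetric])
      (auto simp: wf_gauss_def finite_subset Un_absorb1)
  ultimately show ?thesis by simp
qed

lemma g_odd_mate: "wf_gauss G \<Longrightarrow> k \<in> gC G \<Longrightarrow> g_odd G (gM G k) = g_odd G k"
  by (auto simp: g_odd_def wf_gauss_def)

lemma cf_zero: "wf_gauss G \<Longrightarrow> gC G \<subseteq> Y \<Longrightarrow> k \<in> Y \<Longrightarrow> m \<notin> Y \<Longrightarrow> cf G k m = 0"
  by (auto simp: cf_def wf_gauss_def dl_def)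

text \<open>The row of the marker has pivot 1 in its own column. Eliminating this variable makes the
  predecessor of \<open>m\<close> point to the successor of \<open>m\<close>, which is exactly the
  change described by \<open>nx_insert\<close>.\<close>

lemma g_det_insert_marker:
  assumes wf: "wf_gauss G" and Y: "finite Y" "Y \<subseteq> {0..<1}" "Y \<noteq> {}" "gC G \<subseteq> Y"
    and m: "m \<in> {0..<1} - Y"
  shows "g_det G (insert m Y) = g_det G Y"
proof -
  let ?Y = "insert m Y"
  let ?f = "\<lambda>k j. cf G k j - dl (nx ?Y k) j"
  obtain k0 where k0: "k0 \<in> Y" using Y by auto
  have nm: "nx ?Y m \<noteq> m" by (rule nx_insert(2)[OF Y(1,2) k0 m])
  have cm: "cf G m j = dl m j" for j using m Y(4) by (auto simp: cf_def)
  have fmm: "?f m m = 1" using nm by (simp add: cm)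
  have "detS ?Y ?f = ?f m m * detS ?Y (elim_rows m m 1 ?f)"
    by (rule detS_elim) (use Y fmm in auto)
  also have "\<dots> = detS ?Y (elim_rows m m 1 ?f)" using fmm by simp
  also have "\<dots> = detS Y (elim_rows m m 1 ?f)"
    by (subst detS_insert[OF Y(1)]) (use m in \<open>auto simp: elim_rows_def\<close>)
  also have "\<dots> = detS Y (\<lambda>k j. cf G k j - dl (nx Y k) j)"
  proof (rule detS_cong[OF Y(1)])
    fix k j assume kj: "k \<in> Y" "j \<in> Y"
    then have ne: "k \<noteq> m" "j \<noteq> m" using m by auto
    have "cf G k m = 0" by (rule cf_zero[OF wf Y(4) kj(1)]) (use m in auto)
    then show "elim_rows m m 1 ?f k j = cf G k j - dl (nx Y k) j"
      using nx_insert(1)[OF Y(1,2) kj(1) m] ne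
      by (auto simp: elim_rows_def cm algebra_simps)
  qed
  finally show ?thesis by (simp add: g_det_def)
qed

lemma g_det_Un_marker:
  assumes wf: "wf_gauss G" and Y: "finite Y" "Y \<subseteq> {0..<1}" "Y \<noteq> {}" "gC G \<subseteq> Y"
    and Z: "finite Z" "Z \<subseteq> {0..<1}"
  shows "g_det G (Z \<union> Y) = g_det G Y"
  using Z
proof (induction Z rule: finite_induct)
  case (insert m Z)
  show ?case
  proof (cases "m \<in> Z \<union> Y")
    case True
    then show ?thesis using insert by (simp add: insert_absorb)
  next
    case False
    then show ?thesis using insert Y g_det_insert_marker[OF wf, of "Z \<union> Y" m] by auto
  qed
qed simp

text \<open>Both index sets are enlarged to their union by markers.\<close>

lemma g_det_eq_alex:
  assumes wf: "wf_gauss G" and Y: "finite Y" "Y \<subseteq> {0..<1}" "Y \<noteq> {}" "gC G \<subseteq> Y"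
  shows "g_det G Y = alex G"
proof -
  let ?Z = "insert 0 (gC G)"
  have Z: "finite ?Z" "?Z \<subseteq> {0..<1}" "?Z \<noteq> {}" "gC G \<subseteq> ?Z" using wf by (auto simp: wf_gauss_def)
  show ?thesis
    unfolding alex_def
    using g_det_Un_marker[OF wf Y Z(1,2)] g_det_Un_marker[OF wf Z Y(1,2)] by (simp add: Un_commute)
qed

lemma cf_cong:
  assumes "k \<in> gC G' \<longleftrightarrow> k \<in> gC G"
    and "k \<in> gC G \<Longrightarrow> (k \<in> gO G' \<longleftrightarrow> k \<in> gO G)" and "k \<in> gC G \<Longrightarrow> gM G' k = gM G k"
    and "k \<in> gC G \<Longrightarrow> gS G' k = gS G k" and "k \<in> gC G \<Longrightarrow> g_odd G' k = g_odd G k"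
  shows "cf G' k j = cf G k j"
  using assms by (simp add: cf_def)

subsection \<open>Adding adjacent pairs of passages\<close>

lemma colour_cong:
  assumes C: "finite C" "C \<subseteq> {0..<1}" "even (card C)"
    and C': "finite C'" "C' \<subseteq> {0..<1}" "even (card C')"
    and eq: "\<And>u v. u \<in> C \<Longrightarrow> v \<in> C \<Longrightarrow> u \<le> v \<Longrightarrow>
      even (lift_count C' u v) \<longleftrightarrow> even (lift_count C u v)"
    and "u \<in> C" "v \<in> C"
  shows "colour C' u = colour C' v \<longleftrightarrow> colour C u = colour C v"
proof (cases "u \<le> v")
  case True
  then show ?thesis using colour_diff[OF C True] colour_diff[OF C' True] eq assms by blast
next
  case False
  then have "v \<le> u" by simp
  then show ?thesis using colour_diff[OF C \<open>v \<le> u\<close>] colour_diff[OF C' \<open>v \<le> u\<close>] eq assms by blast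
qed

lemma lift_count_disjoint_Un:
  assumes "finite C" "finite P" "C \<inter> P = {}"
  shows "lift_count (C \<union> P) u v = lift_count C u v + lift_count P u v"
proof -
  have eq: "{x. u \<le> x \<and> x < v \<and> frac x \<in> C \<union> P} =
    {x. u \<le> x \<and> x < v \<and> frac x \<in> C} \<union> {x. u \<le> x \<and> x < v \<and> frac x \<in> P}"
    by auto
  have "{x. u \<le> x \<and> x < v \<and> frac x \<in> C} \<inter> {x. u \<le> x \<and> x < v \<and> frac x \<in> P} = {}"
    using assms(3) by auto
  then show ?thesis unfolding lift_count_def eq
    by (rule card_Un_disjoint[OF finite_lift''[OF assms(1)] finite_lift''[OF assms(2)]])
qed

text \<open>Translation by \<open>t - s\<close> matches the lifts of \<open>s\<close> with those of
  \<open>t\<close>. No end of the interval falls between two matched points, so they are counted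
  together or not at all.\<close>

lemma even_lift_count_pair:
  assumes st: "s < t" "frac s \<noteq> frac t"
    and uv: "\<And>x. s \<le> x \<Longrightarrow> x \<le> t \<Longrightarrow> frac x \<noteq> frac u \<and> frac x \<noteq> frac v"
  shows "even (lift_count {frac s, frac t} u v)"
proof -
  have notin: "\<not> (s + of_int n \<le> u \<and> u \<le> t + of_int n)" "\<not> (s + of_int n \<le> v \<and> v \<le> t + of_int n)" for n
    using uv[of "u - of_int n"] uv[of "v - of_int n"]
      frac_add_int[of u "-n"] frac_add_int[of v "-n"] by auto
  let ?s = "{x. u \<le> x \<and> x < v \<and> frac x \<in> {frac s}}" and ?t = "{x. u \<le> x \<and> x < v \<and> frac x \<in> {frac t}}"
  have "bij_betw (\<lambda>x. x + (t - s)) ?s ?t"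
  proof (rule bij_betwI[of _ _ _ "\<lambda>x. x - (t - s)"])
    show "(\<lambda>x. x + (t - s)) \<in> ?s \<rightarrow> ?t"
    proof
      fix x assume x: "x \<in> ?s"
      then obtain n :: int where n: "x = s + of_int n" by (auto simp: frac_eq_iff)
      have "x + (t - s) = t + of_int n" using n by simp
      then show "x + (t - s) \<in> ?t" using x notin[of n] n st(1) by auto
    qed
    show "(\<lambda>x. x - (t - s)) \<in> ?t \<rightarrow> ?s"
    proof
      fix x assume x: "x \<in> ?t"
      then obtain n :: int where n: "x = t + of_int n" by (auto simp: frac_eq_iff)
      have "x - (t - s) = s + of_int n" using n by simp
      then show "x - (t - s) \<in> ?s" using x notin[of n] n st(1) by auto
    qed
  qed auto
  then have "lift_count {frac s} u v = lift_count {frac t} u v"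
    unfolding lift_count_def by (rule bij_betw_same_card)
  moreover have "lift_count ({frac s} \<union> {frac t}) u v = lift_count {frac s} u v + lift_count {frac t} u v"
    by (rule lift_count_disjoint_Un) (use st in auto)
  ultimately show ?thesis by (simp add: insert_commute)
qed

text \<open>The two new passages are neighbours, so the new crossing is even and no other parity
  changes. The determinant of \<open>G\<close> is taken over the passages of \<open>G'\<close>, with
  markers at \<open>s\<close> and \<open>t\<close>.\<close>

theorem alex_kink:
  assumes wf: "wf_gauss G" "wf_gauss G'" and st: "s < t" "t < s + 1"
    and empty: "\<And>x. s \<le> x \<Longrightarrow> x \<le> t \<Longrightarrow> frac x \<notin> gC G"
    and C': "gC G' = gC G \<union> {frac s, frac t}" and M': "gM G' (frac s) = frac t"
    and same: "\<And>k. k \<in> gC G \<Longrightarrow> gM G' k = gM G k \<and> gS G' k = gS G k \<and> (k \<in> gO G' \<longleftrightarrow> k \<in> gO G)"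
  shows "\<exists>\<epsilon>. alex G' = mono3 \<epsilon> \<epsilon> 0 * alex G"
proof -
  let ?Y = "gC G'" and ?s = "frac s" and ?t = "frac t"
  have neq: "?s \<noteq> ?t" using frac_neq[OF st] .
  have Y: "finite ?Y" "?Y \<subseteq> {0..<1}" "?Y \<noteq> {}" "gC G \<subseteq> ?Y" "?s \<in> ?Y" "?t \<in> ?Y"
    using wf C' by (auto simp: wf_gauss_def)
  have sC: "?s \<notin> gC G" "?t \<notin> gC G" using empty[of s] empty[of t] st by auto
  have adj: "adjacent ?Y s t"
    unfolding adjacent_def
  proof (intro conjI allI impI)
    fix x assume x: "s < x \<and> x < t"
    have "frac s \<noteq> frac x" "frac x \<noteq> frac t"
      by (rule frac_neq; use x st in auto)+
    then show "frac x \<notin> ?Y" using empty[of x] x C' by auto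
  qed (use st Y in auto)
  have nxs: "nx ?Y ?s = ?t" using nx_adjacent[OF Y(1) adj] nx_frac[OF Y(1-3)] by simp
  have nx_t: "nx ?Y k \<noteq> ?t" if "k \<in> ?Y" "k \<noteq> ?s" for k
    using nx_inj[OF Y(1,2) that(1) Y(5)] nxs that(2) by auto
  have Mt: "gM G' ?t = ?s" using wf(2) Y(5) M' unfolding wf_gauss_def by metis
  have col: "colour ?Y ?t \<longleftrightarrow> \<not> colour ?Y ?s"
    using colour_adjacent[OF Y(1,2) wf_even_card[OF wf(2)] Y(5) adj] by simp
  have even_st: "\<not> g_odd G' ?s" "\<not> g_odd G' ?t" using col by (auto simp: g_odd_def M' Mt)
  have Seq: "gS G' ?t = gS G' ?s" using wf(2) Y(5) M' unfolding wf_gauss_def by metis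
  have colC: "colour ?Y u = colour ?Y v \<longleftrightarrow> colour (gC G) u = colour (gC G) v"
    if "u \<in> gC G" "v \<in> gC G" for u v
  proof (rule colour_cong[OF wf_finite[OF wf(1)] wf_unit[OF wf(1)] wf_even_card[OF wf(1)]
        Y(1,2) wf_even_card[OF wf(2)] _ that])
    fix u v assume uv: "u \<in> gC G" "v \<in> gC G"
    have fr: "frac u = u" "frac v = v" using uv wf_unit[OF wf(1)] by (auto simp: frac_unit subset_iff)
    have "lift_count ?Y u v = lift_count (gC G) u v + lift_count {?s, ?t} u v"
      unfolding C' by (rule lift_count_disjoint_Un) (use wf_finite[OF wf(1)] sC in auto)
    moreover have "even (lift_count {?s, ?t} u v)"
      by (rule even_lift_count_pair[OF st(1) neq]) (use empty uv fr in auto)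
    ultimately show "even (lift_count ?Y u v) \<longleftrightarrow> even (lift_count (gC G) u v)" by simp
  qed
  have odd_same: "g_odd G' k = g_odd G k" if "k \<in> gC G" for k
    using colC[OF that, of "gM G k"] same[OF that] wf(1) that by (auto simp: g_odd_def wf_gauss_def)
  let ?f = "\<lambda>k j. cf G' k j - dl (nx ?Y k) j" and ?g = "\<lambda>k j. cf G k j - dl (nx ?Y k) j"
  let ?n = "nx ?Y ?t" and ?e = "gS G' ?s"
  have fg: "?f l j = ?g l j" if "l \<in> ?Y" "l \<noteq> ?s" "l \<noteq> ?t" for l j
    using that C' same[of l] odd_same[of l] cf_cong[of l G' G j] by auto
  have f0: "?f l ?t = 0" if "l \<in> ?Y" "l \<noteq> ?s" "l \<noteq> ?t" for l
  proof -
    have "cf G l ?t = 0" by (rule cf_zero[OF wf(1), of "?Y - {?t}"]) (use that C' sC in auto)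
    then show ?thesis using fg[OF that, of ?t] nx_t[OF that(1,2)] by auto
  qed
  have gs: "?g ?s j = dl ?s j - dl ?t j" for j using sC nxs by (simp add: cf_def)
  have gt: "?g ?t j = dl ?t j - dl ?n j" for j using sC by (simp add: cf_def)
  have nt: "?n \<noteq> ?t" using nx_t[of ?t] Y neq by auto
  have over: "?t \<in> gO G' \<longleftrightarrow> ?s \<notin> gO G'" using wf(2) Y(5) M' unfolding wf_gauss_def by metis
  have "\<exists>\<epsilon>. detS ?Y ?f = mono3 \<epsilon> \<epsilon> 0 * detS ?Y ?g"
  proof (cases "?s \<in> gO G'")
    case True
    \<comment> \<open>Over-passage first: its relation contains no other incoming arc, so
      \<open>b = 0\<close> and the factor is 1.\<close>
    have "detS ?Y ?f = (1 - 0) * detS ?Y ?g"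
    proof (rule detS_kink[OF Y(1,5,6) neq nt, where u = "-1" and a = "mono3 ?e 0 0" and
          c = "mono3 0 ?e 0" and d = "1 - mono3 ?e ?e 0"])
      fix j
      show "?f ?s j = mono3 ?e 0 0 * dl ?s j + 0 * dl ?t j - dl ?t j"
        using Y True even_st nxs by (simp add: cf_def coef_defs)
      show "?f ?t j = mono3 0 ?e 0 * dl ?t j + (1 - mono3 ?e ?e 0) * dl ?s j - dl ?n j"
        using Y True over even_st Mt Seq by (simp add: cf_def coef_defs)
    qed (use gs gt f0 fg in \<open>auto simp: mono3_mult\<close>)
    then show ?thesis by (intro exI[of _ 0]) (simp add: mono3_one)
  next
    case False
    \<comment> \<open>Under-passage first: its relation contains the loop arc with coefficient
      \<open>b = 1 - mono3 ?e ?e 0\<close>, and \<open>1 - b\<close> is the unit by which the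
      determinant changes.\<close>
    have "detS ?Y ?f = (1 - (1 - mono3 ?e ?e 0)) * detS ?Y ?g"
    proof (rule detS_kink[OF Y(1,5,6) neq nt, where u = "- mono3 (- ?e) (- ?e) 0" and
          a = "mono3 0 ?e 0" and c = "mono3 ?e 0 0" and d = 0])
      fix j
      show "?f ?s j = mono3 0 ?e 0 * dl ?s j + (1 - mono3 ?e ?e 0) * dl ?t j - dl ?t j"
        using Y False even_st nxs M' by (simp add: cf_def coef_defs)
      show "?f ?t j = mono3 ?e 0 0 * dl ?t j + 0 * dl ?s j - dl ?n j"
        using Y False over even_st Mt Seq by (simp add: cf_def coef_defs)
    qed (use gs gt f0 fg in \<open>auto simp: mono3_mult mono3_one mult.assoc\<close>)
    then show ?thesis by auto
  qed
  then show ?thesis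
    using g_det_eq_alex[OF wf(1) Y(1-4)] g_det_eq_alex[OF wf(2) Y(1-3)] by (simp add: g_det_def)
qed

text \<open>The two crossings have opposite signs and, since the new passages are neighbours on
  either strand, the same parity. Their relations undo each other, so eliminating the inner arcs
  gives the same result as for two strands with markers.\<close>

theorem alex_slide:
  assumes wf: "wf_gauss G" "wf_gauss G'"
    and pq: "p < q" "q < p + 1" and xy: "x < y" "y < x + 1"
    and disj: "\<And>a b. p \<le> a \<Longrightarrow> a \<le> q \<Longrightarrow> x \<le> b \<Longrightarrow> b \<le> y \<Longrightarrow> frac a \<noteq> frac b"
    and empty: "\<And>a. p \<le> a \<Longrightarrow> a \<le> q \<Longrightarrow> frac a \<notin> gC G"
      "\<And>b. x \<le> b \<Longrightarrow> b \<le> y \<Longrightarrow> frac b \<notin> gC G"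
    and C': "gC G' = gC G \<union> {frac p, frac q} \<union> {frac x, frac y}"
    and over: "{frac p, frac q} \<subseteq> gO G'"
    and sign: "gS G' (frac q) = - gS G' (frac p)"
    and M': "gM G' (frac p) = frac x \<and> gM G' (frac q) = frac y \<or>
      gM G' (frac p) = frac y \<and> gM G' (frac q) = frac x"
    and same: "\<And>k. k \<in> gC G \<Longrightarrow> gM G' k = gM G k \<and> gS G' k = gS G k \<and> (k \<in> gO G' \<longleftrightarrow> k \<in> gO G)"
  shows "alex G' = alex G"
proof -
  let ?Y = "gC G'" and ?p = "frac p" and ?q = "frac q" and ?x = "frac x" and ?y = "frac y"
  have neq: "?p \<noteq> ?q" "?x \<noteq> ?y" "?p \<noteq> ?x" "?p \<noteq> ?y" "?q \<noteq> ?x" "?q \<noteq> ?y"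
    using frac_neq[OF pq] frac_neq[OF xy] disj[of p x] disj[of p y] disj[of q x] disj[of q y] pq xy
    by auto
  have dist: "distinct [?p, ?q, ?x, ?y]" using neq by auto
  have Y: "finite ?Y" "?Y \<subseteq> {0..<1}" "?Y \<noteq> {}" "gC G \<subseteq> ?Y" "?p \<in> ?Y" "?q \<in> ?Y" "?x \<in> ?Y" "?y \<in> ?Y"
    using wf C' by (auto simp: wf_gauss_def)
  have notC: "?p \<notin> gC G" "?q \<notin> gC G" "?x \<notin> gC G" "?y \<notin> gC G"
    using empty(1)[of p] empty(1)[of q] empty(2)[of x] empty(2)[of y] pq xy by auto
  have adjp: "adjacent ?Y p q"
    unfolding adjacent_def
  proof (intro conjI allI impI)
    fix z assume z: "p < z \<and> z < q"
    have "frac p \<noteq> frac z" "frac z \<noteq> frac q" by (rule frac_neq; use z pq in auto)+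
    then show "frac z \<notin> ?Y" using empty(1)[of z] disj[of z x] disj[of z y] z C' xy by auto
  qed (use pq Y in auto)
  have adjx: "adjacent ?Y x y"
    unfolding adjacent_def
  proof (intro conjI allI impI)
    fix z assume z: "x < z \<and> z < y"
    have "frac x \<noteq> frac z" "frac z \<noteq> frac y" by (rule frac_neq; use z xy in auto)+
    then show "frac z \<notin> ?Y" using empty(2)[of z] disj[of p z] disj[of q z] z C' pq by auto
  qed (use xy Y in auto)
  have nxp: "nx ?Y ?p = ?q" using nx_adjacent[OF Y(1) adjp] nx_frac[OF Y(1-3)] by simp
  have nxx: "nx ?Y ?x = ?y" using nx_adjacent[OF Y(1) adjx] nx_frac[OF Y(1-3)] by simp
  have nx_q: "nx ?Y k \<noteq> ?q" if "k \<in> ?Y" "k \<noteq> ?p" for k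
    using nx_inj[OF Y(1,2) that(1) Y(5)] nxp that(2) by auto
  have nx_y: "nx ?Y k \<noteq> ?y" if "k \<in> ?Y" "k \<noteq> ?x" for k
    using nx_inj[OF Y(1,2) that(1) Y(7)] nxx that(2) by auto
  have colp: "colour ?Y ?q \<longleftrightarrow> \<not> colour ?Y ?p"
    using colour_adjacent[OF Y(1,2) wf_even_card[OF wf(2)] Y(5) adjp] by simp
  have colx: "colour ?Y ?y \<longleftrightarrow> \<not> colour ?Y ?x"
    using colour_adjacent[OF Y(1,2) wf_even_card[OF wf(2)] Y(7) adjx] by simp
  have mate: "gM G' (gM G' k) = k" "gS G' (gM G' k) = gS G' k" "gM G' k \<in> gO G' \<longleftrightarrow> k \<notin> gO G'"
    if "k \<in> ?Y" for k using wf(2) that unfolding wf_gauss_def by auto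
  have colC: "colour ?Y u = colour ?Y v \<longleftrightarrow> colour (gC G) u = colour (gC G) v"
    if "u \<in> gC G" "v \<in> gC G" for u v
  proof (rule colour_cong[OF wf_finite[OF wf(1)] wf_unit[OF wf(1)] wf_even_card[OF wf(1)]
        Y(1,2) wf_even_card[OF wf(2)] _ that])
    fix u v assume uv: "u \<in> gC G" "v \<in> gC G"
    have fr: "frac u = u" "frac v = v" using uv wf_unit[OF wf(1)] by (auto simp: frac_unit subset_iff)
    have "lift_count ?Y u v = lift_count (gC G \<union> {?p, ?q}) u v + lift_count {?x, ?y} u v"
      unfolding C' by (rule lift_count_disjoint_Un) (use wf_finite[OF wf(1)] notC neq in auto)
    moreover have "lift_count (gC G \<union> {?p, ?q}) u v = lift_count (gC G) u v + lift_count {?p, ?q} u v"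
      by (rule lift_count_disjoint_Un) (use wf_finite[OF wf(1)] notC in auto)
    moreover have "even (lift_count {?p, ?q} u v)"
      by (rule even_lift_count_pair[OF pq(1) neq(1)]) (use empty uv fr in auto)
    moreover have "even (lift_count {?x, ?y} u v)"
      by (rule even_lift_count_pair[OF xy(1) neq(2)]) (use empty uv fr in auto)
    ultimately show "even (lift_count ?Y u v) \<longleftrightarrow> even (lift_count (gC G) u v)" by simp
  qed
  have odd_same: "g_odd G' k = g_odd G k" if "k \<in> gC G" for k
    using colC[OF that, of "gM G k"] same[OF that] wf(1) that by (auto simp: g_odd_def wf_gauss_def)
  let ?f = "\<lambda>k j. cf G' k j - dl (nx ?Y k) j" and ?g = "\<lambda>k j. cf G k j - dl (nx ?Y k) j"
  let ?n1 = "nx ?Y ?q" and ?n2 = "nx ?Y ?y" and ?e = "gS G' ?p" and ?o = "g_odd G' ?p"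
  \<comment> \<open>The common reduced matrix: each strand leaves the disc with the arc with which
    it entered.\<close>
  let ?h = "\<lambda>l j. if l = ?p then dl ?q j else if l = ?x then dl ?y j
    else if l = ?q then dl ?p j - dl ?n1 j else if l = ?y then dl ?x j - dl ?n2 j else ?g l j"
  have fg: "?f l j = ?g l j" if "l \<in> ?Y - {?p, ?q, ?x, ?y}" for l j
    using that C' same[of l] odd_same[of l] cf_cong[of l G' G j] by auto
  have g0: "?g l ?q = 0 \<and> ?g l ?y = 0" if "l \<in> ?Y - {?p, ?q, ?x, ?y}" for l
  proof -
    have "cf G l ?q = 0" "cf G l ?y = 0"
      by (rule cf_zero[OF wf(1), of "?Y - {?p, ?q, ?x, ?y}"]; use that C' notC in auto)+
    then show ?thesis using nx_q[of l] nx_y[of l] that by auto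
  qed
  have n1: "?n1 \<notin> {?q, ?y}" and n2: "?n2 \<notin> {?q, ?y}"
    using nx_q[of ?q] nx_q[of ?y] nx_y[of ?q] nx_y[of ?y] Y neq by auto
  have Y4: "{?p, ?q, ?x, ?y} \<subseteq> ?Y" using Y by auto
  have "detS ?Y ?g = detS ?Y ?h"
    by (rule detS_two_strands[OF Y(1) Y4 dist n1 n2, where ?a1.0 = 1 and ?a2.0 = 1 and ?b1.0 = 1 and
          ?b2.0 = 1 and ?b11.0 = 0 and ?b12.0 = 0 and ?b21.0 = 0 and ?b22.0 = 0])
       (use g0 notC nxp nxx neq in \<open>auto simp: cf_def\<close>)
  moreover have "detS ?Y ?f = detS ?Y ?h"
    \<comment> \<open>The lower strand meets the two crossings in the same order as the upper one or
      in the opposite order.\<close>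
    using M'
  proof
    assume M1: "gM G' ?p = ?x \<and> gM G' ?q = ?y"
    have Mx: "gM G' ?x = ?p" "gM G' ?y = ?q" using mate(1) M1 Y by metis+
    have S: "gS G' ?x = ?e" "gS G' ?y = - ?e" using mate(2)[of ?p] mate(2)[of ?q] M1 Y sign by auto
    have O: "?p \<in> gO G'" "?q \<in> gO G'" "?x \<notin> gO G'" "?y \<notin> gO G'"
      using over mate(3)[of ?p] mate(3)[of ?q] M1 Y by auto
    have od: "g_odd G' ?q = ?o" "g_odd G' ?x = ?o" "g_odd G' ?y = ?o"
      using M1 Mx colp colx by (auto simp: g_odd_def)
    have rows: "?f ?p j = ocoef ?o ?e * dl ?p j - dl ?q j"
      "?f ?q j = ocoef ?o (- ?e) * dl ?q j - dl ?n1 j"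
      "?f ?x j = ucoef ?o ?e * dl ?x j + mcoef ?o ?e * dl ?p j - dl ?y j"
      "?f ?y j = ucoef ?o (- ?e) * dl ?y j + mcoef ?o (- ?e) * dl ?q j - dl ?n2 j" for j
      using Y by (simp_all add: cf_def nxp nxx O od S sign Mx)
    show ?thesis
    proof (rule detS_two_strands[OF Y(1) Y4 dist n1 n2, where ?a1.0 = "ocoef ?o ?e" and
            ?a2.0 = "ocoef ?o (- ?e)" and ?b1.0 = "ucoef ?o ?e" and ?b2.0 = "ucoef ?o (- ?e)" and
            ?b11.0 = "mcoef ?o ?e" and ?b12.0 = 0 and ?b21.0 = 0 and ?b22.0 = "mcoef ?o (- ?e)"])
      \<comment> \<open>Besides the inverse coefficients along each strand, the two contributions of
        the over-strand to the under-strand cancel.\<close>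
      have comp: "ocoef ?o ?e * ocoef ?o (- ?e) = 1" "ucoef ?o ?e * ucoef ?o (- ?e) = 1"
        "ucoef ?o (- ?e) * ucoef ?o ?e = 1" "ucoef ?o (- ?e) * mcoef ?o ?e + mcoef ?o (- ?e) * ocoef ?o ?e = 0"
        by (simp_all add: coef_defs mono3_mult mono3_one algebra_simps)
      fix j
      show "?h ?q j = ocoef ?o ?e * ocoef ?o (- ?e) * dl ?p j - dl ?n1 j"
        using neq comp by simp
      show "?h ?y j = ucoef ?o ?e * ucoef ?o (- ?e) * dl ?x j + (ucoef ?o (- ?e) * (mcoef ?o ?e + 0 * ocoef ?o ?e) + 0 + mcoef ?o (- ?e) * ocoef ?o ?e) * dl ?p j - dl ?n2 j"
        using neq comp by simp
    qed (use fg g0 rows neq in \<open>simp_all\<close>)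
  next
    assume M2: "gM G' ?p = ?y \<and> gM G' ?q = ?x"
    have Mx: "gM G' ?y = ?p" "gM G' ?x = ?q" using mate(1) M2 Y by metis+
    have S: "gS G' ?y = ?e" "gS G' ?x = - ?e" using mate(2)[of ?p] mate(2)[of ?q] M2 Y sign by auto
    have O: "?p \<in> gO G'" "?q \<in> gO G'" "?x \<notin> gO G'" "?y \<notin> gO G'"
      using over mate(3)[of ?p] mate(3)[of ?q] M2 Y by auto
    have od: "g_odd G' ?q = ?o" "g_odd G' ?x = ?o" "g_odd G' ?y = ?o"
      using M2 Mx colp colx by (auto simp: g_odd_def)
    have rows: "?f ?p j = ocoef ?o ?e * dl ?p j - dl ?q j"
      "?f ?q j = ocoef ?o (- ?e) * dl ?q j - dl ?n1 j"
      "?f ?x j = ucoef ?o (- ?e) * dl ?x j + mcoef ?o (- ?e) * dl ?q j - dl ?y j"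
      "?f ?y j = ucoef ?o ?e * dl ?y j + mcoef ?o ?e * dl ?p j - dl ?n2 j" for j
      using Y by (simp_all add: cf_def nxp nxx O od S sign Mx)
    show ?thesis
    proof (rule detS_two_strands[OF Y(1) Y4 dist n1 n2, where ?a1.0 = "ocoef ?o ?e" and
            ?a2.0 = "ocoef ?o (- ?e)" and ?b1.0 = "ucoef ?o (- ?e)" and ?b2.0 = "ucoef ?o ?e" and
            ?b11.0 = 0 and ?b12.0 = "mcoef ?o (- ?e)" and ?b21.0 = "mcoef ?o ?e" and ?b22.0 = 0])
      have comp: "ocoef ?o ?e * ocoef ?o (- ?e) = 1" "ucoef ?o ?e * ucoef ?o (- ?e) = 1"
        "ucoef ?o (- ?e) * ucoef ?o ?e = 1" "ucoef ?o ?e * (mcoef ?o (- ?e) * ocoef ?o ?e) + mcoef ?o ?e = 0"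
        by (simp_all add: coef_defs mono3_mult mono3_one algebra_simps)
      fix j
      show "?h ?q j = ocoef ?o ?e * ocoef ?o (- ?e) * dl ?p j - dl ?n1 j"
        using neq comp by simp
      show "?h ?y j = ucoef ?o (- ?e) * ucoef ?o ?e * dl ?x j + (ucoef ?o ?e * (0 + mcoef ?o (- ?e) * ocoef ?o ?e) + mcoef ?o ?e + 0 * ocoef ?o ?e) * dl ?p j - dl ?n2 j"
        using neq comp by simp
    qed (use fg g0 rows neq in \<open>simp_all\<close>)
  qed
  ultimately show ?thesis
    using g_det_eq_alex[OF wf(1) Y(1-4)] g_det_eq_alex[OF wf(2) Y(1-3)] by (simp add: g_det_def)
qed

subsection \<open>Order isomorphisms of passages\<close>

text \<open>A lift to the line of an isomorphism of cyclically ordered sets; values away from the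
  lifts of \<open>C\<close> are left open.\<close>

definition transports :: "(real \<Rightarrow> real) \<Rightarrow> real set \<Rightarrow> real set \<Rightarrow> bool" where
  "transports \<phi> C C' \<longleftrightarrow>
     (\<forall>x. frac x \<in> C \<longrightarrow> frac (\<phi> x) \<in> C') \<and>
     (\<forall>y. frac y \<in> C' \<longrightarrow> (\<exists>x. frac x \<in> C \<and> \<phi> x = y)) \<and>
     (\<forall>x y. frac x \<in> C \<longrightarrow> frac y \<in> C \<longrightarrow> x < y \<longrightarrow> \<phi> x < \<phi> y) \<and>
     (\<forall>x. \<forall>n::int. frac x \<in> C \<longrightarrow> \<phi> (x + of_int n) = \<phi> x + of_int n)"

context
  fixes \<phi> :: "real \<Rightarrow> real" and C C' :: "real set"
  assumes tr: "transports \<phi> C C'" and C: "finite C" "C \<subseteq> {0..<1}" and C': "finite C'" "C' \<subseteq> {0..<1}"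
begin

lemma tr_in: "frac x \<in> C \<Longrightarrow> frac (\<phi> x) \<in> C'"
  and tr_surj: "frac y \<in> C' \<Longrightarrow> \<exists>x. frac x \<in> C \<and> \<phi> x = y"
  and tr_less: "frac x \<in> C \<Longrightarrow> frac y \<in> C \<Longrightarrow> x < y \<Longrightarrow> \<phi> x < \<phi> y"
  and tr_shift: "frac x \<in> C \<Longrightarrow> \<phi> (x + of_int n) = \<phi> x + of_int n"
  using tr unfolding transports_def by blast+

lemma tr_less_iff: "frac x \<in> C \<Longrightarrow> frac y \<in> C \<Longrightarrow> \<phi> x < \<phi> y \<longleftrightarrow> x < y"
  using tr_less[of x y] tr_less[of y x] by (cases x y rule: linorder_cases) auto

lemma tr_le_iff: "frac x \<in> C \<Longrightarrow> frac y \<in> C \<Longrightarrow> \<phi> x \<le> \<phi> y \<longleftrightarrow> x \<le> y"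
  using tr_less_iff[of y x] by (simp add: not_less[symmetric])

lemma tr_eq_iff: "frac x \<in> C \<Longrightarrow> frac y \<in> C \<Longrightarrow> \<phi> x = \<phi> y \<longleftrightarrow> x = y"
  using tr_less_iff[of y x] tr_less_iff[of x y] by (cases x y rule: linorder_cases) auto

lemma tr_unit: "k \<in> C \<Longrightarrow> frac k = k" "k \<in> C' \<Longrightarrow> frac k = k"
  using C C' by (auto simp: frac_unit subset_iff)

lemma tr_frac: assumes "frac x \<in> C" shows "frac (\<phi> (frac x)) = frac (\<phi> x)"
proof -
  have "frac x = x + of_int (- \<lfloor>x\<rfloor>)" by (simp add: frac_def)
  then show ?thesis using tr_shift[OF assms, of "- \<lfloor>x\<rfloor>"] frac_add_int by metis
qed

lemma tr_bij: "bij_betw (\<lambda>k. frac (\<phi> k)) C C'"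
proof (rule bij_betw_imageI)
  show "inj_on (\<lambda>k. frac (\<phi> k)) C"
  proof
    fix k l assume kl: "k \<in> C" "l \<in> C" and "frac (\<phi> k) = frac (\<phi> l)"
    then obtain n :: int where "\<phi> k = \<phi> l + of_int n" unfolding frac_eq_iff by auto
    then have "\<phi> k = \<phi> (l + of_int n)" using tr_shift[of l n] kl tr_unit by simp
    then have "k = l + of_int n" using tr_eq_iff[of k "l + of_int n"] kl tr_unit by simp
    then have "frac k = frac l" by simp
    then show "k = l" using kl tr_unit by simp
  qed
  show "(\<lambda>k. frac (\<phi> k)) ` C = C'"
  proof (intro equalityI subsetI)
    fix y assume y: "y \<in> C'"
    then obtain x where x: "frac x \<in> C" "\<phi> x = y" using tr_surj[of y] tr_unit by auto
    then have "frac (\<phi> (frac x)) = y" using tr_frac[OF x(1)] tr_unit y by simp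
    then show "y \<in> (\<lambda>k. frac (\<phi> k)) ` C" using x by blast
  qed (use tr_in tr_unit in auto)
qed

lemma tr_nx: assumes k: "k \<in> C" shows "nx C' (frac (\<phi> k)) = frac (\<phi> (nx C k))"
proof -
  have ne: "C \<noteq> {}" using k by auto
  then have ne': "C' \<noteq> {}" using tr_bij by (auto simp: bij_betw_def)
  have fk: "frac k \<in> C" using k tr_unit by simp
  obtain t where t: "adjacent C k t" using ex_adjacent[OF C ne] .
  then have ft: "frac t \<in> C" by (simp add: adjacent_def)
  have "adjacent C' (\<phi> k) (\<phi> t)"
    unfolding adjacent_def
  proof (intro conjI allI impI)
    show "\<phi> k < \<phi> t" using t tr_less[OF fk ft] by (simp add: adjacent_def)
    have "t \<le> k + of_int 1" using t by (simp add: adjacent_def)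
    then have "\<phi> t \<le> \<phi> (k + of_int 1)" using tr_le_iff[OF ft, of "k + of_int 1"] fk frac_add_int[of k 1] by simp
    then show "\<phi> t \<le> \<phi> k + 1" using tr_shift[OF fk, of 1] by simp
    show "frac (\<phi> t) \<in> C'" using tr_in[OF ft] .
    fix y assume y: "\<phi> k < y \<and> y < \<phi> t"
    show "frac y \<notin> C'"
    proof
      assume "frac y \<in> C'"
      then obtain x where x: "frac x \<in> C" "\<phi> x = y" using tr_surj by blast
      then have "k < x" "x < t" using y tr_less_iff[OF fk x(1)] tr_less_iff[OF x(1) ft] by auto
      then show False using t x(1) by (auto simp: adjacent_def)
    qed
  qed
  then have "nx C' (\<phi> k) = frac (\<phi> t)" by (rule nx_adjacent[OF C'(1)])
  moreover have "nx C k = frac t" using nx_adjacent[OF C(1) t] .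
  ultimately show ?thesis using nx_frac[OF C' ne'] tr_frac[OF ft] by simp
qed

text \<open>Stated for equality of colours, since \<open>\<phi>\<close> may carry passages across
  the base point 0. Equality depends only on the number of passages in between, which is
  preserved.\<close>

lemma tr_colour:
  assumes even: "even (card C)" and uv: "u \<in> C" "v \<in> C"
  shows "colour C' (frac (\<phi> u)) = colour C' (frac (\<phi> v)) \<longleftrightarrow> colour C u = colour C v"
proof -
  have even': "even (card C')" using even bij_betw_same_card[OF tr_bij] by simp
  have *: "colour C' (\<phi> u) = colour C' (\<phi> v) \<longleftrightarrow> colour C u = colour C v"
    if uv: "u \<in> C" "v \<in> C" "u \<le> v" for u v
  proof -
    have f: "frac u \<in> C" "frac v \<in> C" using uv tr_unit by auto
    have "bij_betw \<phi> {x. u \<le> x \<and> x < v \<and> frac x \<in> C} {x. \<phi> u \<le> x \<and> x < \<phi> v \<and> frac x \<in> C'}"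
    proof (rule bij_betw_imageI)
      show "\<phi> ` {x. u \<le> x \<and> x < v \<and> frac x \<in> C} = {x. \<phi> u \<le> x \<and> x < \<phi> v \<and> frac x \<in> C'}"
      proof (intro equalityI subsetI)
        fix y assume y: "y \<in> {x. \<phi> u \<le> x \<and> x < \<phi> v \<and> frac x \<in> C'}"
        then obtain x where x: "frac x \<in> C" "\<phi> x = y" using tr_surj by blast
        then have "u \<le> x" "x < v" using y tr_le_iff[OF f(1) x(1)] tr_less_iff[OF x(1) f(2)] by auto
        then show "y \<in> \<phi> ` {x. u \<le> x \<and> x < v \<and> frac x \<in> C}" using x by blast
      qed (use f tr_in tr_le_iff tr_less_iff in auto)
    qed (auto simp: inj_on_def tr_eq_iff)
    then have "lift_count C' (\<phi> u) (\<phi> v) = lift_count C u v"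
      unfolding lift_count_def by (rule bij_betw_same_card[symmetric])
    moreover have "\<phi> u \<le> \<phi> v" using tr_le_iff[OF f] uv by simp
    ultimately show ?thesis
      using colour_diff[OF C even, of u v] colour_diff[OF C' even', of "\<phi> u" "\<phi> v"] uv by auto
  qed
  show ?thesis
  proof (cases "u \<le> v")
    case True then show ?thesis using *[OF uv] by simp
  next
    case False then show ?thesis using *[of v u] uv by auto
  qed
qed

end

text \<open>The arcs of \<open>G'\<close> are renamed after the passages of \<open>G\<close>, so one
  successor function serves for both diagrams.\<close>

lemma alex_pullback:
  assumes wf: "wf_gauss G" "wf_gauss G'" and tr: "transports \<phi> (gC G) (gC G')" and ne: "gC G \<noteq> {}"
  shows "alex G' = detS (gC G) (\<lambda>k j. cf G' (frac (\<phi> k)) (frac (\<phi> j)) - dl (nx (gC G) k) j)"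
proof -
  let ?\<psi> = "\<lambda>k. frac (\<phi> k)"
  note C = wf_finite[OF wf(1)] wf_unit[OF wf(1)] and C' = wf_finite[OF wf(2)] wf_unit[OF wf(2)]
  note bij = tr_bij[OF tr C C']
  have ne': "gC G' \<noteq> {}" using bij ne by (auto simp: bij_betw_def)
  have "alex G' = detS (gC G') (\<lambda>k j. cf G' k j - dl (nx (gC G') k) j)"
    using g_det_eq_alex[OF wf(2) C' ne'] by (simp add: g_det_def)
  also have "\<dots> = detS (gC G) (\<lambda>k j. cf G' (?\<psi> k) (?\<psi> j) - dl (nx (gC G') (?\<psi> k)) (?\<psi> j))"
    by (rule detS_reindex[OF C(1) bij])
  also have "\<dots> = detS (gC G) (\<lambda>k j. cf G' (?\<psi> k) (?\<psi> j) - dl (nx (gC G) k) j)"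
  proof (rule detS_cong[OF C(1)])
    fix k j assume kj: "k \<in> gC G" "j \<in> gC G"
    have "?\<psi> j = ?\<psi> (nx (gC G) k) \<longleftrightarrow> j = nx (gC G) k"
      using bij kj nx_in[OF C ne, of k] by (auto simp: bij_betw_def inj_on_def)
    then show "cf G' (?\<psi> k) (?\<psi> j) - dl (nx (gC G') (?\<psi> k)) (?\<psi> j) =
      cf G' (?\<psi> k) (?\<psi> j) - dl (nx (gC G) k) j"
      using tr_nx[OF tr C C' kj(1)] by (simp add: dl_def)
  qed
  finally show ?thesis .
qed

lemma cf_pullback:
  assumes wf: "wf_gauss G" "wf_gauss G'" and tr: "transports \<phi> (gC G) (gC G')"
    and k: "k \<in> gC G" "j \<in> gC G"
    and M: "gM G' (frac (\<phi> k)) = frac (\<phi> (gM G k))" and S: "gS G' (frac (\<phi> k)) = gS G k"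
    and O: "frac (\<phi> k) \<in> gO G' \<longleftrightarrow> k \<in> gO G"
  shows "cf G' (frac (\<phi> k)) (frac (\<phi> j)) = cf G k j"
proof -
  note C = wf_finite[OF wf(1)] wf_unit[OF wf(1)] and C' = wf_finite[OF wf(2)] wf_unit[OF wf(2)]
  note bij = tr_bij[OF tr C C']
  have Mk: "gM G k \<in> gC G" using wf(1) k by (auto simp: wf_gauss_def)
  have inj: "frac (\<phi> a) = frac (\<phi> b) \<longleftrightarrow> a = b" if "a \<in> gC G" "b \<in> gC G" for a b
    using bij that by (auto simp: bij_betw_def inj_on_def)
  have "frac (\<phi> k) \<in> gC G'" using bij k by (auto simp: bij_betw_def)
  moreover have "g_odd G' (frac (\<phi> k)) = g_odd G k"
    unfolding g_odd_def M by (rule tr_colour[OF tr C C' wf_even_card[OF wf(1)] k(1) Mk])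
  ultimately show ?thesis using k S O M inj[OF k(2)] k(1) Mk by (simp add: cf_def dl_def)
qed

theorem alex_transport:
  assumes wf: "wf_gauss G" "wf_gauss G'" and tr: "transports \<phi> (gC G) (gC G')"
    and M: "\<And>k. k \<in> gC G \<Longrightarrow> gM G' (frac (\<phi> k)) = frac (\<phi> (gM G k))"
    and S: "\<And>k. k \<in> gC G \<Longrightarrow> gS G' (frac (\<phi> k)) = gS G k"
    and O: "\<And>k. k \<in> gC G \<Longrightarrow> frac (\<phi> k) \<in> gO G' \<longleftrightarrow> k \<in> gO G"
  shows "alex G' = alex G"
proof (cases "gC G = {}")
  case True
  have "gC G' = {}"
    using tr_bij[OF tr wf_finite[OF wf(1)] wf_unit[OF wf(1)] wf_finite[OF wf(2)] wf_unit[OF wf(2)]] True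
    by (auto simp: bij_betw_def)
  then show ?thesis using True by (simp add: alex_def g_det_def cf_def)
next
  case False
  have "alex G' = detS (gC G) (\<lambda>k j. cf G k j - dl (nx (gC G) k) j)"
    unfolding alex_pullback[OF wf tr False]
    by (rule detS_cong[OF wf_finite[OF wf(1)]]) (use cf_pullback[OF wf tr] M S O in auto)
  then show ?thesis
    using g_det_eq_alex[OF wf(1) wf_finite[OF wf(1)] wf_unit[OF wf(1)] False] by (simp add: g_det_def)
qed

text \<open>The map \<open>\<phi>\<close> keeps positions along the strands, so the crossings change
  places: the first position on \<open>A\<close> belongs to \<open>x\<close> before the move and to
  \<open>y\<close> after it. The naming is that of \<open>third_move_identities\<close>.\<close>

theorem alex_third_move:
  assumes wf: "wf_gauss G" "wf_gauss G'" and tr: "transports \<phi> (gC G) (gC G')"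
    and mem: "{A1, A2, B1, B2, C1, C2} \<subseteq> gC G" and dist: "distinct [A1, A2, B1, B2, C1, C2]"
    and nxs: "nx (gC G) A1 = A2" "nx (gC G) B1 = B2" "nx (gC G) C1 = C2"
    and M: "gM G A1 = (if \<beta> then B1 else B2)" "gM G A2 = (if \<gamma> then C1 else C2)"
      "gM G (if \<beta> then B2 else B1) = (if \<gamma> then C2 else C1)"
    and M': "gM G' (frac (\<phi> A1)) = frac (\<phi> (if \<gamma> then C2 else C1))"
      "gM G' (frac (\<phi> A2)) = frac (\<phi> (if \<beta> then B2 else B1))"
      "gM G' (frac (\<phi> (if \<beta> then B1 else B2))) = frac (\<phi> (if \<gamma> then C1 else C2))"
    and O: "{A1, A2, if \<beta> then B2 else B1} \<subseteq> gO G"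
    and O': "{frac (\<phi> A1), frac (\<phi> A2), frac (\<phi> (if \<beta> then B1 else B2))} \<subseteq> gO G'"
    and S: "gS G A1 = ex" "gS G A2 = ey" "gS G (if \<beta> then B2 else B1) = ez"
    and S': "gS G' (frac (\<phi> A2)) = ex" "gS G' (frac (\<phi> A1)) = ey"
      "gS G' (frac (\<phi> (if \<beta> then B1 else B2))) = ez"
    and \<beta>: "\<beta> \<longleftrightarrow> ey = ez" and \<gamma>: "\<gamma> \<longleftrightarrow> ex = ez"
    and same: "\<And>k. k \<in> gC G - {A1, A2, B1, B2, C1, C2} \<Longrightarrow>
      gM G' (frac (\<phi> k)) = frac (\<phi> (gM G k)) \<and> gS G' (frac (\<phi> k)) = gS G k \<and>
      (frac (\<phi> k) \<in> gO G' \<longleftrightarrow> k \<in> gO G)"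
  shows "alex G' = alex G"
proof -
  let ?C = "gC G" and ?\<psi> = "\<lambda>k. frac (\<phi> k)"
  note C = wf_finite[OF wf(1)] wf_unit[OF wf(1)] and C' = wf_finite[OF wf(2)] wf_unit[OF wf(2)]
  note ev = wf_even_card[OF wf(1)]
  have ne: "?C \<noteq> {}" using mem by auto
  have m: "A1 \<in> ?C" "A2 \<in> ?C" "B1 \<in> ?C" "B2 \<in> ?C" "C1 \<in> ?C" "C2 \<in> ?C" using mem by auto
  have d: "A1 \<noteq> A2" "A1 \<noteq> B1" "A1 \<noteq> B2" "A1 \<noteq> C1" "A1 \<noteq> C2" "A2 \<noteq> B1" "A2 \<noteq> B2" "A2 \<noteq> C1" "A2 \<noteq> C2"
    "B1 \<noteq> B2" "B1 \<noteq> C1" "B1 \<noteq> C2" "B2 \<noteq> C1" "B2 \<noteq> C2" "C1 \<noteq> C2" using dist by auto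
  note d' = d d[THEN not_sym]
  note bij = tr_bij[OF tr C C']
  have inj: "?\<psi> a = ?\<psi> b \<longleftrightarrow> a = b" if "a \<in> ?C" "b \<in> ?C" for a b
    using bij that by (auto simp: bij_betw_def inj_on_def)
  have \<psi>C: "?\<psi> k \<in> gC G'" if "k \<in> ?C" for k using bij that by (auto simp: bij_betw_def)
  have col: "colour ?C (nx ?C k) \<longleftrightarrow> \<not> colour ?C k" if k: "k \<in> ?C" for k
  proof -
    obtain t where t: "adjacent ?C k t" using ex_adjacent[OF C ne] .
    have "frac k \<in> ?C" using k C(2) by (simp add: frac_unit subset_iff)
    then show ?thesis using colour_adjacent[OF C ev _ t] nx_adjacent[OF C(1) t] by simp
  qed
  have cA: "colour ?C A2 \<longleftrightarrow> \<not> colour ?C A1" and cB: "colour ?C B2 \<longleftrightarrow> \<not> colour ?C B1"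
    and cC: "colour ?C C2 \<longleftrightarrow> \<not> colour ?C C1"
    using col[of A1] col[of B1] col[of C1] m nxs by auto
  have colour': "colour (gC G') (?\<psi> a) = colour (gC G') (?\<psi> b) \<longleftrightarrow> colour ?C a = colour ?C b"
    if "a \<in> ?C" "b \<in> ?C" for a b by (rule tr_colour[OF tr C C' ev that])
  have mate: "gM G (gM G k) = k" "gS G (gM G k) = gS G k" "gM G k \<in> gO G \<longleftrightarrow> k \<notin> gO G"
    "g_odd G (gM G k) = g_odd G k"
    if "k \<in> ?C" for k using wf(1) that g_odd_mate[OF wf(1) that] unfolding wf_gauss_def by auto
  have mate': "gM G' (gM G' k) = k" "gS G' (gM G' k) = gS G' k" "gM G' k \<in> gO G' \<longleftrightarrow> k \<notin> gO G'"
    "g_odd G' (gM G' k) = g_odd G' k"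
    if "k \<in> gC G'" for k using wf(2) that g_odd_mate[OF wf(2) that] unfolding wf_gauss_def by auto
  \<comment> \<open>Parities of \<open>x\<close>, \<open>y\<close>, \<open>z\<close> in terms of the
    colours of the first passages. The same formulas serve for \<open>G'\<close>, because each
    crossing moves both of its passages to the other position on their strands.\<close>
  define px py pz where "px = ((colour ?C A1 = colour ?C B1) = \<beta>)"
    and "py = ((colour ?C A1 \<noteq> colour ?C C1) = \<gamma>)"
    and "pz = ((colour ?C B1 \<noteq> \<beta>) = (colour ?C C1 \<noteq> \<gamma>))"
  let ?zB = "if \<beta> then B2 else B1" and ?xB = "if \<beta> then B1 else B2"
    and ?zC = "if \<gamma> then C2 else C1" and ?yC = "if \<gamma> then C1 else C2"
  have od: "g_odd G A1 = px" "g_odd G A2 = py" "g_odd G ?zB = pz"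
    unfolding g_odd_def M px_def py_def pz_def by (auto simp: cA cB cC)
  have zm: "?zB \<in> ?C" "?xB \<in> ?C" "?zC \<in> ?C" "?yC \<in> ?C" using m by auto
  have od': "g_odd G' (?\<psi> A1) = py" "g_odd G' (?\<psi> A2) = px" "g_odd G' (?\<psi> ?xB) = pz"
    unfolding g_odd_def M' px_def py_def pz_def
      colour'[OF m(1) zm(3)] colour'[OF m(2) zm(1)] colour'[OF zm(2) zm(4)]
    by (auto simp: cA cB cC)
  have u: "gM G ?xB = A1" "gM G ?yC = A2" "gM G ?zC = ?zB"
    "g_odd G ?xB = px" "g_odd G ?yC = py" "g_odd G ?zC = pz"
    "gS G ?xB = ex" "gS G ?yC = ey" "gS G ?zC = ez"
    "?xB \<notin> gO G" "?yC \<notin> gO G" "?zC \<notin> gO G"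
    using mate[OF m(1)] mate[OF m(2)] mate[OF zm(1)] O unfolding M od S by auto
  have u': "gM G' (?\<psi> ?zB) = ?\<psi> A2" "gM G' (?\<psi> ?zC) = ?\<psi> A1" "gM G' (?\<psi> ?yC) = ?\<psi> ?xB"
    "g_odd G' (?\<psi> ?zB) = px" "g_odd G' (?\<psi> ?zC) = py" "g_odd G' (?\<psi> ?yC) = pz"
    "gS G' (?\<psi> ?zB) = ex" "gS G' (?\<psi> ?zC) = ey" "gS G' (?\<psi> ?yC) = ez"
    "?\<psi> ?zB \<notin> gO G'" "?\<psi> ?zC \<notin> gO G'" "?\<psi> ?yC \<notin> gO G'"
    using mate'[OF \<psi>C[OF m(1)]] mate'[OF \<psi>C[OF m(2)]] mate'[OF \<psi>C[OF zm(2)]] O' unfolding M' od' S'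
    by auto
  have eps: "ex \<in> {1, -1}" "ey \<in> {1, -1}" "ez \<in> {1, -1}"
    using wf(1) m zm S unfolding wf_gauss_def by blast+
  note ids = third_move_identities[OF eps \<beta> \<gamma> px_def py_def pz_def]
  let ?f = "\<lambda>k j. cf G k j - dl (nx ?C k) j"
  let ?f' = "\<lambda>k j. cf G' (?\<psi> k) (?\<psi> j) - dl (nx ?C k) j"
  let ?n1 = "nx ?C A2" and ?n2 = "nx ?C B2" and ?n3 = "nx ?C C2"
  have n_ne: "nx ?C k \<noteq> A2" "nx ?C k \<noteq> B2" "nx ?C k \<noteq> C2" if "k \<in> ?C" "k \<notin> {A1, B1, C1}" for k
    using nx_inj[OF C that(1)] that nxs m by auto
  have n: "?n1 \<notin> {A2, B2, C2}" "?n2 \<notin> {A2, B2, C2}" "?n3 \<notin> {A2, B2, C2}"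
    using n_ne[of A2] n_ne[of B2] n_ne[of C2] m d' by auto
  have same_cf: "cf G' (?\<psi> k) (?\<psi> j) = cf G k j" if "k \<in> ?C - {A1, A2, B1, B2, C1, C2}" "j \<in> ?C" for k j
    by (rule cf_pullback[OF wf tr]) (use that same[OF that(1)] in auto)
  \<comment> \<open>The six passages form three complete crossings, so no outside passage has its
    mate among them.\<close>
  have Mout: "gM G k \<notin> {A1, A2, B1, B2, C1, C2}" if k: "k \<in> ?C - {A1, A2, B1, B2, C1, C2}" for k
  proof
    have "gM G l \<in> {A1, A2, B1, B2, C1, C2}" if "l \<in> {A1, A2, B1, B2, C1, C2}" for l
      using that M u by (cases \<beta>; cases \<gamma>) auto
    moreover assume "gM G k \<in> {A1, A2, B1, B2, C1, C2}"
    ultimately have "gM G (gM G k) \<in> {A1, A2, B1, B2, C1, C2}" by blast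
    then show False using mate(1)[of k] k by auto
  qed
  have f0: "?f l A2 = 0 \<and> ?f l B2 = 0 \<and> ?f l C2 = 0" if l: "l \<in> ?C - {A1, A2, B1, B2, C1, C2}" for l
    using n_ne[of l] Mout[OF l] l by (auto simp: cf_def)
  let ?ox = "ocoef px ex" and ?oy = "ocoef py ey" and ?oz = "ocoef pz ez"
    and ?ux = "ucoef px ex" and ?uy = "ucoef py ey" and ?uz = "ucoef pz ez"
    and ?mx = "mcoef px ex" and ?my = "mcoef py ey" and ?mz = "mcoef pz ez"
  \<comment> \<open>Coefficients of the disc as a whole, computed before the move:
    \<open>WBA\<close> is that of the arc entering along \<open>A\<close> in the arc leaving along
    \<open>B\<close>, and \<open>WCB\<close> and \<open>WCA\<close> are formed likewise.\<close>
  define WBA where "WBA = (if \<beta> then ?oz * ?mx else ?mx)"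
  define WCB where "WCB = (if \<gamma> then if \<beta> then ?mz * ?ux else ?mz else if \<beta> then ?uy * (?mz * ?ux) else ?uy * ?mz)"
  define WCA where "WCA = (if \<gamma> then if \<beta> then ?uz * (?my * ?ox) + ?mz * ?mx else ?uz * (?my * ?ox)
    else if \<beta> then ?uy * (?mz * ?mx) + ?my * ?ox else ?my * ?ox)"
  \<comment> \<open>The same coefficients as they come out after the move; the identities for the
    strand \<open>C\<close> say that both computations agree.\<close>
  have WCB': "WCB = (if \<gamma> then if \<beta> then ?uy * ?mz else ?uy * (?mz * ?ux)
    else if \<beta> then ?mz else ?mz * ?ux)"
    unfolding WCB_def by (auto intro: ids(3,5,7,9))
  have WCA': "WCA = (if \<gamma> then if \<beta> then ?my else ?uy * (?mz * (?mx * ?oy)) + ?my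
    else if \<beta> then ?uz * ?my else ?uz * ?my + ?mz * (?mx * ?oy))"
    unfolding WCA_def by (auto intro: ids(4,6,8,10))
  \<comment> \<open>The matrix left when the inner arcs are eliminated, to which both sides of the
    move are reduced.\<close>
  define h where "h l j = (if l = A1 then dl A2 j else if l = B1 then dl B2 j else if l = C1 then dl C2 j
    else if l = A2 then ?ox * ?oy * dl A1 j - dl ?n1 j
    else if l = B2 then ?ux * ?oz * dl B1 j + WBA * dl A1 j - dl ?n2 j
    else if l = C2 then ?uy * ?uz * dl C1 j + WCB * dl B1 j + WCA * dl A1 j - dl ?n3 j
    else ?f l j)" for l j
  have dlp: "dl (?\<psi> a) (?\<psi> b) = (dl a b :: laurent3)" if "a \<in> ?C" "b \<in> ?C" for a b
    using inj[OF that] inj[OF that(2) that(1)] by (simp add: dl_def)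
  note cfs = cf_def od od' u u' O O' S S' M M'
  have "detS ?C ?f = - detS ?C h"
  proof (rule detS_three_strands[OF C(1) mem dist n, where ?a1.0 = ?ox and ?a2.0 = ?oy and
        ?b1.0 = "if \<beta> then ?ux else ?oz" and ?b2.0 = "if \<beta> then ?oz else ?ux" and
        ?b11.0 = "if \<beta> then ?mx else 0" and ?b12.0 = 0 and ?b21.0 = "if \<beta> then 0 else ?mx" and ?b22.0 = 0 and
        ?c1.0 = "if \<gamma> then ?uy else ?uz" and ?c2.0 = "if \<gamma> then ?uz else ?uy" and
        ?c11.0 = 0 and ?c12.0 = "if \<gamma> then ?my else 0" and ?c21.0 = 0 and ?c22.0 = "if \<gamma> then 0 else ?my" and
        ?d11.0 = "if \<not> \<gamma> \<and> \<not> \<beta> then ?mz else 0" and ?d12.0 = "if \<not> \<gamma> \<and> \<beta> then ?mz else 0" and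
        ?d21.0 = "if \<gamma> \<and> \<not> \<beta> then ?mz else 0" and ?d22.0 = "if \<gamma> \<and> \<beta> then ?mz else 0"])
    fix j
    show "?f A1 j = ?ox * dl A1 j - dl A2 j" using m O S od by (simp add: cf_def nxs)
    show "?f A2 j = ?oy * dl A2 j - dl ?n1 j" using m O S od by (simp add: cf_def)
    show "?f B1 j = (if \<beta> then ?ux else ?oz) * dl B1 j + (if \<beta> then ?mx else 0) * dl A1 j + 0 * dl A2 j - dl B2 j"
      using m O S od u by (cases \<beta>) (simp_all add: cf_def nxs)
    show "?f B2 j = (if \<beta> then ?oz else ?ux) * dl B2 j + (if \<beta> then 0 else ?mx) * dl A1 j + 0 * dl A2 j - dl ?n2 j"
      using m O S od u by (cases \<beta>) (simp_all add: cf_def)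
    show "?f C1 j = (if \<gamma> then ?uy else ?uz) * dl C1 j + 0 * dl A1 j + (if \<gamma> then ?my else 0) * dl A2 j +
        (if \<not> \<gamma> \<and> \<not> \<beta> then ?mz else 0) * dl B1 j + (if \<not> \<gamma> \<and> \<beta> then ?mz else 0) * dl B2 j - dl C2 j"
      using m u by (cases \<beta>; cases \<gamma>) (simp_all add: cf_def nxs)
    show "?f C2 j = (if \<gamma> then ?uz else ?uy) * dl C2 j + 0 * dl A1 j + (if \<gamma> then 0 else ?my) * dl A2 j +
        (if \<gamma> \<and> \<not> \<beta> then ?mz else 0) * dl B1 j + (if \<gamma> \<and> \<beta> then ?mz else 0) * dl B2 j - dl ?n3 j"
      using m u by (cases \<beta>; cases \<gamma>) (simp_all add: cf_def)
    show "h B2 j = (if \<beta> then ?ux else ?oz) * (if \<beta> then ?oz else ?ux) * dl B1 j +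
      ((if \<beta> then ?oz else ?ux) * ((if \<beta> then ?mx else 0) + 0 * ?ox) + (if \<beta> then 0 else ?mx) + 0 * ?ox) * dl A1 j
      - dl ?n2 j"
      using d' by (cases \<beta>) (simp_all add: h_def WBA_def mult.commute[of ?oz ?ux])
    show "h C2 j = (if \<gamma> then ?uy else ?uz) * (if \<gamma> then ?uz else ?uy) * dl C1 j +
      ((if \<gamma> then ?uz else ?uy) * ((if \<not> \<gamma> \<and> \<not> \<beta> then ?mz else 0) + (if \<not> \<gamma> \<and> \<beta> then ?mz else 0) * (if \<beta> then ?ux else ?oz)) +
       (if \<gamma> \<and> \<not> \<beta> then ?mz else 0) + (if \<gamma> \<and> \<beta> then ?mz else 0) * (if \<beta> then ?ux else ?oz)) * dl B1 j +
      ((if \<gamma> then ?uz else ?uy) * (0 + (if \<gamma> then ?my else 0) * ?ox +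
          (if \<not> \<gamma> \<and> \<beta> then ?mz else 0) * ((if \<beta> then ?mx else 0) + 0 * ?ox)) +
        0 + (if \<gamma> then 0 else ?my) * ?ox + (if \<gamma> \<and> \<beta> then ?mz else 0) * ((if \<beta> then ?mx else 0) + 0 * ?ox)) * dl A1 j
      - dl ?n3 j"
      using d' by (cases \<beta>; cases \<gamma>)
        (simp_all add: h_def WCA_def WCB_def mult.commute[of ?uz ?uy] add.commute)
  qed (use d' f0 in \<open>simp_all add: h_def\<close>)
  moreover have "detS ?C ?f' = - detS ?C h"
  proof (rule detS_three_strands[OF C(1) mem dist n, where ?a1.0 = ?oy and ?a2.0 = ?ox and
        ?b1.0 = "if \<beta> then ?oz else ?ux" and ?b2.0 = "if \<beta> then ?ux else ?oz" and
        ?b11.0 = 0 and ?b12.0 = "if \<beta> then 0 else ?mx" and ?b21.0 = 0 and ?b22.0 = "if \<beta> then ?mx else 0" and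
        ?c1.0 = "if \<gamma> then ?uz else ?uy" and ?c2.0 = "if \<gamma> then ?uy else ?uz" and
        ?c11.0 = "if \<gamma> then 0 else ?my" and ?c12.0 = 0 and ?c21.0 = "if \<gamma> then ?my else 0" and ?c22.0 = 0 and
        ?d11.0 = "if \<gamma> \<and> \<beta> then ?mz else 0" and ?d12.0 = "if \<gamma> \<and> \<not> \<beta> then ?mz else 0" and
        ?d21.0 = "if \<not> \<gamma> \<and> \<beta> then ?mz else 0" and ?d22.0 = "if \<not> \<gamma> \<and> \<not> \<beta> then ?mz else 0"])
    fix j assume j: "j \<in> ?C"
    note dp = dlp[OF m(1) j] dlp[OF m(2) j] dlp[OF m(3) j] dlp[OF m(4) j] dlp[OF m(5) j] dlp[OF m(6) j]
    note pC = \<psi>C[OF m(1)] \<psi>C[OF m(2)] \<psi>C[OF m(3)] \<psi>C[OF m(4)] \<psi>C[OF m(5)] \<psi>C[OF m(6)]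
    show "?f' A1 j = ?oy * dl A1 j - dl A2 j" using pC O' S' od' by (simp add: cf_def nxs dp)
    show "?f' A2 j = ?ox * dl A2 j - dl ?n1 j" using pC O' S' od' by (simp add: cf_def dp)
    show "?f' B1 j = (if \<beta> then ?oz else ?ux) * dl B1 j + 0 * dl A1 j + (if \<beta> then 0 else ?mx) * dl A2 j - dl B2 j"
      using pC O' S' od' u' by (cases \<beta>) (simp_all add: cf_def nxs dp)
    show "?f' B2 j = (if \<beta> then ?ux else ?oz) * dl B2 j + 0 * dl A1 j + (if \<beta> then ?mx else 0) * dl A2 j - dl ?n2 j"
      using pC O' S' od' u' by (cases \<beta>) (simp_all add: cf_def dp)
    show "?f' C1 j = (if \<gamma> then ?uz else ?uy) * dl C1 j + (if \<gamma> then 0 else ?my) * dl A1 j + 0 * dl A2 j +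
        (if \<gamma> \<and> \<beta> then ?mz else 0) * dl B1 j + (if \<gamma> \<and> \<not> \<beta> then ?mz else 0) * dl B2 j - dl C2 j"
      using pC u' by (cases \<beta>; cases \<gamma>) (simp_all add: cf_def nxs dp)
    show "?f' C2 j = (if \<gamma> then ?uy else ?uz) * dl C2 j + (if \<gamma> then ?my else 0) * dl A1 j + 0 * dl A2 j +
        (if \<not> \<gamma> \<and> \<beta> then ?mz else 0) * dl B1 j + (if \<not> \<gamma> \<and> \<not> \<beta> then ?mz else 0) * dl B2 j - dl ?n3 j"
      using pC u' by (cases \<beta>; cases \<gamma>) (simp_all add: cf_def dp)
    show "h B2 j = (if \<beta> then ?oz else ?ux) * (if \<beta> then ?ux else ?oz) * dl B1 j +
      ((if \<beta> then ?ux else ?oz) * (0 + (if \<beta> then 0 else ?mx) * ?oy) + 0 + (if \<beta> then ?mx else 0) * ?oy) * dl A1 j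
      - dl ?n2 j"
      using d' ids(1) ids(2)[symmetric] by (cases \<beta>) (simp_all add: h_def WBA_def mult.commute[of ?oz ?ux])
    show "h C2 j = (if \<gamma> then ?uz else ?uy) * (if \<gamma> then ?uy else ?uz) * dl C1 j +
      ((if \<gamma> then ?uy else ?uz) * ((if \<gamma> \<and> \<beta> then ?mz else 0) + (if \<gamma> \<and> \<not> \<beta> then ?mz else 0) * (if \<beta> then ?oz else ?ux)) +
       (if \<not> \<gamma> \<and> \<beta> then ?mz else 0) + (if \<not> \<gamma> \<and> \<not> \<beta> then ?mz else 0) * (if \<beta> then ?oz else ?ux)) * dl B1 j +
      ((if \<gamma> then ?uy else ?uz) * ((if \<gamma> then 0 else ?my) + 0 * ?oy +
          (if \<gamma> \<and> \<not> \<beta> then ?mz else 0) * (0 + (if \<beta> then 0 else ?mx) * ?oy)) +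
        (if \<gamma> then ?my else 0) + 0 * ?oy + (if \<not> \<gamma> \<and> \<not> \<beta> then ?mz else 0) * (0 + (if \<beta> then 0 else ?mx) * ?oy)) * dl A1 j
      - dl ?n3 j"
      using d' by (cases \<beta>; cases \<gamma>) (simp_all add: h_def WCA' WCB' mult.commute[of ?uz ?uy])
    show "h A2 j = ?oy * ?ox * dl A1 j - dl ?n1 j" using d' by (simp add: h_def mult.commute)
  next
    fix l assume l: "l \<in> ?C - {A1, A2, B1, B2, C1, C2}"
    show "?f' l A2 = 0 \<and> ?f' l B2 = 0 \<and> ?f' l C2 = 0"
      using f0[OF l] same_cf[OF l] m by auto
    fix j assume j: "j \<in> ?C"
    show "h l j = ?f' l j" using l same_cf[OF l j] by (simp add: h_def)
  qed (use d' in \<open>auto simp: h_def\<close>)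
  ultimately show ?thesis
    using alex_pullback[OF wf tr ne] g_det_eq_alex[OF wf(1) C ne] by (simp add: g_det_def)
qed

section \<open>Exponents of \<open>z\<close> and the number of odd crossings\<close>

text \<open>A range for the exponents instead of a degree: ranges add under products, and the zero
  polynomial satisfies all of them.\<close>

definition z_between :: "int \<Rightarrow> int \<Rightarrow> laurent3 \<Rightarrow> bool" where
  "z_between lo hi p \<longleftrightarrow> (\<forall>a b c. (a, b, c) \<in> Poly_Mapping.keys p \<longrightarrow> lo \<le> c \<and> c \<le> hi)"

lemma z_between_0 [simp]: "z_between lo hi 0"
  by (simp add: z_between_def)

lemma z_between_mono3: "lo \<le> c \<Longrightarrow> c \<le> hi \<Longrightarrow> z_between lo hi (mono3 a b c)"
  by (simp add: z_between_def mono3_def)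

lemma z_between_add: "z_between lo hi p \<Longrightarrow> z_between lo hi q \<Longrightarrow> z_between lo hi (p + q)"
  using keys_add[of p q] by (auto simp: z_between_def)

lemma z_between_uminus: "z_between lo hi (- p) \<longleftrightarrow> z_between lo hi p"
  by (simp add: z_between_def)

lemma z_between_diff: "z_between lo hi p \<Longrightarrow> z_between lo hi q \<Longrightarrow> z_between lo hi (p - q)"
  using z_between_add[of lo hi p "- q"] by (simp add: z_between_uminus)

lemma z_between_mult:
  assumes "z_between lo hi p" "z_between lo' hi' q"
  shows "z_between (lo + lo') (hi + hi') (p * q)"
  unfolding z_between_def
proof (intro allI impI)
  fix a b c assume "(a, b, c) \<in> Poly_Mapping.keys (p * q)"
  then obtain x y where xy: "(a, b, c) = x + y" "x \<in> Poly_Mapping.keys p" "y \<in> Poly_Mapping.keys q"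
    using keys_mult[of p q] by blast
  obtain x1 x2 x3 y1 y2 y3 where x: "x = (x1, x2, x3)" and y: "y = (y1, y2, y3)" by (metis prod_cases3)
  have "lo \<le> x3 \<and> x3 \<le> hi" "lo' \<le> y3 \<and> y3 \<le> hi'"
    using assms xy(2,3) unfolding x y z_between_def by blast+
  then show "lo + lo' \<le> c \<and> c \<le> hi + hi'" using xy(1) x y by simp
qed

lemma z_between_1: "lo \<le> 0 \<Longrightarrow> 0 \<le> hi \<Longrightarrow> z_between lo hi 1"
  using z_between_mono3[of lo 0 hi 0 0] by (simp add: mono3_one)

lemma z_between_sum: "(\<And>x. x \<in> A \<Longrightarrow> z_between lo hi (f x)) \<Longrightarrow> z_between lo hi (sum f A)"
  by (induction A rule: infinite_finite_induct) (auto intro: z_between_add)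

lemma z_between_prod:
  "(\<And>x. x \<in> A \<Longrightarrow> z_between (lo x) (hi x) (f x)) \<Longrightarrow> z_between (sum lo A) (sum hi A) (prod f A)"
  by (induction A rule: infinite_finite_induct) (auto intro: z_between_mult z_between_1)

text \<open>Each term of the Leibniz formula takes one entry from every row, so the ranges of the
  rows add up.\<close>

lemma z_between_detS:
  assumes S: "finite S" and f: "\<And>k j. k \<in> S \<Longrightarrow> j \<in> S \<Longrightarrow> z_between (lo k) (hi k) (f k j)"
  shows "z_between (sum lo S) (sum hi S) (detS S f)"
proof -
  obtain e where e: "bij_betw e {0..<card S} S" using finite_enum[OF S] .
  have eS: "e i \<in> S" if "i < card S" for i using e that by (auto simp: bij_betw_def)
  let ?A = "Matrix.mat (card S) (card S) (\<lambda>(i, j). f (e i) (e j))"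
  have "z_between (sum lo S) (sum hi S) (signof p * (\<Prod>i = 0..<card S. ?A $$ (i, p i)))"
    if p: "p permutes {0..<card S}" for p
  proof -
    have "p i < card S" if "i < card S" for i using permutes_in_image[OF p, of i] that by simp
    then have "z_between (\<Sum>i = 0..<card S. lo (e i)) (\<Sum>i = 0..<card S. hi (e i))
      (\<Prod>i = 0..<card S. ?A $$ (i, p i))"
      by (intro z_between_prod) (auto intro!: f eS)
    then have "z_between (sum lo S) (sum hi S) (\<Prod>i = 0..<card S. ?A $$ (i, p i))"
      by (simp only: sum.reindex_bij_betw[OF e])
    then show ?thesis
      by (cases "evenperm p") (simp_all add: sign_def z_between_uminus)
  qed
  then show ?thesis
    unfolding detS_enum[OF e] detE_def
    by (subst Determinant.det_def'[of _ "card S"]) (auto intro!: z_between_sum)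
qed

lemma z_extent_le:
  assumes "z_between (- n) n p" and "0 \<le> n"
  shows "z_extent p \<le> n"
proof (cases "p = 0")
  case True
  then show ?thesis using assms by (simp add: z_extent_def)
next
  case False
  have eq: "z_exponents p = (\<lambda>(a, b, c). c) ` Poly_Mapping.keys p"
    by (force simp: z_exponents_def)
  have "finite (z_exponents p)" "z_exponents p \<noteq> {}" unfolding eq using False by auto
  then have "Max (z_exponents p) \<in> z_exponents p" "Min (z_exponents p) \<in> z_exponents p"
    by auto
  then have "\<bar>Max (z_exponents p)\<bar> \<le> n" "\<bar>Min (z_exponents p)\<bar> \<le> n"
    using assms(1) unfolding z_between_def z_exponents_def by (smt (verit) mem_Collect_eq)+
  then show ?thesis using assms(2) by (simp add: z_extent_def)
qed

text \<open>Every odd crossing is represented by its over-passage, so the cardinality is the number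
  of odd crossings.\<close>

definition odd_over :: "gauss \<Rightarrow> real set" where
  "odd_over G = {k \<in> gO G. g_odd G k}"

text \<open>The mate map is a bijection between the part of \<open>Q\<close> where \<open>P\<close>
  holds and the part where it fails.\<close>

lemma card_split_mate:
  assumes wf: "wf_gauss G" and Q: "Q \<subseteq> gC G" and MQ: "\<And>k. k \<in> Q \<Longrightarrow> gM G k \<in> Q"
    and P: "\<And>k. k \<in> Q \<Longrightarrow> P (gM G k) \<longleftrightarrow> \<not> P k"
  shows "card Q = 2 * card {k \<in> Q. P k}"
proof -
  have fin: "finite Q" using Q wf_finite[OF wf] finite_subset by blast
  have "bij_betw (gM G) {k \<in> Q. P k} {k \<in> Q. \<not> P k}"
    by (rule bij_betwI[of _ _ _ "gM G"]) (use wf Q MQ P in \<open>auto simp: wf_gauss_def subset_iff\<close>)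
  then have "card {k \<in> Q. P k} = card {k \<in> Q. \<not> P k}" by (rule bij_betw_same_card)
  moreover have "card ({k \<in> Q. P k} \<union> {k \<in> Q. \<not> P k}) = card {k \<in> Q. P k} + card {k \<in> Q. \<not> P k}"
    by (rule card_Un_disjoint) (use fin in auto)
  moreover have "{k \<in> Q. P k} \<union> {k \<in> Q. \<not> P k} = Q" by auto
  ultimately show ?thesis by simp
qed

lemma card_odd_over:
  assumes wf: "wf_gauss G"
  shows "card {k \<in> gC G. g_odd G k} = 2 * card (odd_over G)"
proof -
  let ?Q = "{k \<in> gC G. g_odd G k}"
  have "card ?Q = 2 * card {k \<in> ?Q. k \<in> gO G}"
    by (rule card_split_mate[OF wf]) (use wf g_odd_mate[OF wf] in \<open>auto simp: wf_gauss_def\<close>)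
  also have "{k \<in> ?Q. k \<in> gO G} = odd_over G" using wf by (auto simp: odd_over_def wf_gauss_def)
  finally show ?thesis .
qed

lemma z_between_alex:
  assumes wf: "wf_gauss G"
  shows "z_between (- int (card (odd_over G))) (int (card (odd_over G))) (alex G)"
proof (cases "gC G = {}")
  case True
  \<comment> \<open>A single arc that follows itself: its relation is trivial and the matrix is
    zero.\<close>
  have "nx {0} 0 = 0" using nx_in[of "{0}" 0] by simp
  then have "alex G = 0"
    using True detS_insert[of "{}" 0 "\<lambda>k j. cf G k j - dl (nx {0} k) j"]
    by (simp add: alex_def g_det_def cf_def)
  then show ?thesis by simp
next
  case False
  let ?Q = "{k \<in> gC G. g_odd G k}"
  \<comment> \<open>For odd passages, the rows with entry \<open>z\<close> rather than its inverse.
    Mates share the sign and differ in over and under, so each odd crossing has exactly one passage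
    of this kind. Hence \<open>?hi\<close> and \<open>?lo\<close> sum to plus and minus the number
    of odd crossings.\<close>
  let ?up = "\<lambda>k. k \<in> gO G \<longleftrightarrow> gS G k = 1"
  let ?hi = "\<lambda>k. if g_odd G k \<and> ?up k then 1 else 0 :: int"
  let ?lo = "\<lambda>k. if g_odd G k \<and> \<not> ?up k then - 1 else 0 :: int"
  have up: "card ?Q = 2 * card {k \<in> ?Q. ?up k}"
    by (rule card_split_mate[OF wf]) (use wf g_odd_mate[OF wf] in \<open>auto simp: wf_gauss_def\<close>)
  have dn: "card ?Q = 2 * card {k \<in> ?Q. \<not> ?up k}"
    by (rule card_split_mate[OF wf]) (use wf g_odd_mate[OF wf] in \<open>auto simp: wf_gauss_def\<close>)
  have fin: "finite (gC G)" by (rule wf_finite[OF wf])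
  have "sum ?hi (gC G) = int (card {k \<in> ?Q. ?up k})"
    using fin by (subst sum.inter_filter[symmetric]) (simp_all add: conj_assoc)
  then have hi: "sum ?hi (gC G) = int (card (odd_over G))"
    using up card_odd_over[OF wf] by simp
  have "sum ?lo (gC G) = - int (card {k \<in> ?Q. \<not> ?up k})"
    using fin by (subst sum.inter_filter[symmetric]) (simp_all add: conj_assoc)
  then have lo: "sum ?lo (gC G) = - int (card (odd_over G))"
    using dn card_odd_over[OF wf] by simp
  have dlb: "z_between l h (dl a b)" if "l \<le> 0" "0 \<le> h" for l h :: int and a b :: real
    using that by (simp add: dl_def z_between_1)
  have "z_between (?lo k) (?hi k) (cf G k j - dl (nx (gC G) k) j)" if k: "k \<in> gC G" for k j
  proof -
    have e: "gS G k = 1 \<or> gS G k = - 1" using wf k by (auto simp: wf_gauss_def)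
    have "z_between (?lo k) (?hi k) (cf G k j)"
      using k e
      by (auto simp: cf_def dl_def coef_defs intro!: z_between_mono3 z_between_add z_between_diff z_between_1)
    then show ?thesis by (rule z_between_diff) (rule dlb, auto)
  qed
  then have "z_between (sum ?lo (gC G)) (sum ?hi (gC G)) (g_det G (gC G))"
    unfolding g_det_def by (intro z_between_detS[OF fin]) auto
  then show ?thesis
    using g_det_eq_alex[OF wf fin wf_unit[OF wf] False] unfolding hi lo by simp
qed

text \<open>Even crossings use one passage of each colour. Removing them from the balanced total
  leaves a balance among the passages of odd crossings, each of which uses two of the same colour.
  So the odd crossings fall into two classes of equal size.\<close>

lemma even_odd_over:
  assumes wf: "wf_gauss G"
  shows "even (card (odd_over G))"
proof (cases "gC G = {}")
  case True
  then have "odd_over G = {}" using wf by (auto simp: odd_over_def wf_gauss_def)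
  then show ?thesis by simp
next
  case ne: False
  let ?C = "gC G" and ?c = "colour (gC G)"
  note C = wf_finite[OF wf] wf_unit[OF wf]
  have flip: "?c (nx ?C k) \<longleftrightarrow> \<not> ?c k" if k: "k \<in> ?C" for k
  proof -
    obtain t where t: "adjacent ?C k t" using ex_adjacent[OF C ne] .
    have "frac k \<in> ?C" using k C(2) by (simp add: frac_unit subset_iff)
    then show ?thesis using colour_adjacent[OF C wf_even_card[OF wf] _ t] nx_adjacent[OF C(1) t] by simp
  qed
  have inj: "inj_on (nx ?C) A" if "A \<subseteq> ?C" for A
    using nx_inj[OF C] that by (auto simp: inj_on_def subset_iff)
  \<comment> \<open>The successor map sends one colour class injectively into the other; used in
    both directions.\<close>
  have le: "card {k \<in> ?C. ?c k = b} \<le> card {k \<in> ?C. ?c k = (\<not> b)}" for b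
    by (rule card_inj_on_le[of "nx ?C"]) (use inj C flip nx_in[OF C ne] in auto)
  have eq: "card {k \<in> ?C. ?c k} = card {k \<in> ?C. \<not> ?c k}"
    using le[of True] le[of False] by simp
  let ?E = "{k \<in> ?C. \<not> g_odd G k}" and ?T = "{k \<in> ?C. g_odd G k \<and> ?c k}" and ?F = "{k \<in> ?C. g_odd G k \<and> \<not> ?c k}"
  have E1: "card ?E = 2 * card {k \<in> ?E. ?c k}" and E2: "card ?E = 2 * card {k \<in> ?E. \<not> ?c k}"
    by (rule card_split_mate[OF wf]; use wf g_odd_mate[OF wf] in \<open>auto simp: wf_gauss_def g_odd_def\<close>)+
  have T: "{k \<in> ?C. ?c k} = {k \<in> ?E. ?c k} \<union> ?T" and F: "{k \<in> ?C. \<not> ?c k} = {k \<in> ?E. \<not> ?c k} \<union> ?F"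
    by auto
  have "card ({k \<in> ?E. ?c k} \<union> ?T) = card {k \<in> ?E. ?c k} + card ?T"
    "card ({k \<in> ?E. \<not> ?c k} \<union> ?F) = card {k \<in> ?E. \<not> ?c k} + card ?F"
    by (rule card_Un_disjoint; use C in auto)+
  then have TF: "card ?T = card ?F" using eq E1 E2 unfolding T F by linarith
  have "card ?T = 2 * card {k \<in> ?T. k \<in> gO G}" "card ?F = 2 * card {k \<in> ?F. k \<in> gO G}"
    by (rule card_split_mate[OF wf]; use wf g_odd_mate[OF wf] in \<open>auto simp: wf_gauss_def g_odd_def\<close>)+
  moreover have "card {k \<in> ?C. g_odd G k} = card ?T + card ?F"
    using C by (subst card_Un_disjoint[symmetric]) (auto intro!: arg_cong[where f = card])
  ultimately show ?thesis using TF card_odd_over[OF wf] by presburger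
qed

section \<open>The Gauss diagram of a virtual knot diagram\<close>

definition mate_time :: "diagram \<Rightarrow> real \<Rightarrow> real" where
  "mate_time D k = (THE j. j \<in> {0..<1} \<and> j \<noteq> k \<and> curve D j = curve D k)"

text \<open>The sign of a crossing whose over-passage is at time \<open>x\<close>;
  \<open>gauss_of\<close> orders the arguments accordingly.\<close>

definition sign_at :: "diagram \<Rightarrow> real \<Rightarrow> real \<Rightarrow> int" where
  "sign_at D x y = (if Im (cnj (tangent D x) * tangent D y) > 0 then 1 else - 1)"

definition gauss_of :: "diagram \<Rightarrow> gauss" where
  "gauss_of D = \<lparr>gC = classical_times D \<inter> {0..<1}, gO = over_times D \<inter> {0..<1},
     gM = mate_time D,
     gS = (\<lambda>k. if k \<in> over_times D then sign_at D k (mate_time D k) else sign_at D (mate_time D k) k)\<rparr>"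

lemma gauss_of_simps [simp]:
  "gC (gauss_of D) = classical_times D \<inter> {0..<1}" "gO (gauss_of D) = over_times D \<inter> {0..<1}"
  "gM (gauss_of D) = mate_time D"
  "gS (gauss_of D) k = (if k \<in> over_times D then sign_at D k (mate_time D k) else sign_at D (mate_time D k) k)"
  by (simp_all add: gauss_of_def)

context
  fixes D :: diagram
  assumes D: "virtual_diagram D"
begin

lemma curve_plus_1: "curve D (t + 1) = curve D t"
  using D unfolding virtual_diagram_def by blast

lemma curve_periodic: "curve D (t + of_int n) = curve D t"
proof (induction n rule: int_induct[where k = 0])
  case (step1 i)
  then show ?case using curve_plus_1[of "t + of_int i"] by (simp add: add.assoc)
next
  case (step2 i)
  have "t + of_int (i - 1) + 1 = t + of_int i" by simp
  then show ?case using step2 curve_plus_1[of "t + of_int (i - 1)"] by simp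
qed simp

lemma curve_frac [simp]: "curve D (frac t) = curve D t"
  using curve_periodic[of t "- \<lfloor>t\<rfloor>"] by (simp add: frac_def)

lemma curve_cong_frac: "frac s = frac t \<Longrightarrow> curve D s = curve D t"
  by (metis curve_frac)

lemma no_triple:
  "curve D s = curve D t \<Longrightarrow> curve D t = curve D u \<Longrightarrow>
    frac s = frac t \<or> frac t = frac u \<or> frac s = frac u"
  using D unfolding virtual_diagram_def frac_eq_iff_Ints[symmetric] by blast

lemma transverse:
  "curve D s = curve D t \<Longrightarrow> frac s \<noteq> frac t \<Longrightarrow> Im (cnj (tangent D s) * tangent D t) \<noteq> 0"
  using D unfolding virtual_diagram_def frac_eq_iff_Ints[symmetric] by blast

lemma over_double: "s \<in> over_times D \<Longrightarrow> \<exists>t. frac t \<noteq> frac s \<and> curve D t = curve D s"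
  using D unfolding virtual_diagram_def double_times_def frac_eq_iff_Ints[symmetric] by blast

lemma over_iff: "s \<in> over_times D \<Longrightarrow> curve D s = curve D t \<Longrightarrow> t \<in> over_times D \<longleftrightarrow> frac s = frac t"
  using D unfolding virtual_diagram_def frac_eq_iff_Ints[symmetric] by blast

lemma over_frac [simp]: "frac t \<in> over_times D \<longleftrightarrow> t \<in> over_times D"
  using over_iff[of t "frac t"] over_iff[of "frac t" t] by auto

lemma classical_frac [simp]: "frac t \<in> classical_times D \<longleftrightarrow> t \<in> classical_times D"
  by (simp add: classical_times_def)

lemma over_classical: "t \<in> over_times D \<Longrightarrow> t \<in> classical_times D"
  by (auto simp: classical_times_def)

lemma classical_mate:
  assumes "k \<in> classical_times D"
  obtains j where "curve D j = curve D k" "frac j \<noteq> frac k" "j \<in> over_times D \<longleftrightarrow> k \<notin> over_times D"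
    "j \<in> {0..<1}" "j \<in> classical_times D"
proof -
  obtain s where s: "s \<in> over_times D" "curve D s = curve D k" using assms by (auto simp: classical_times_def)
  have "\<exists>j. curve D j = curve D k \<and> frac j \<noteq> frac k \<and> (j \<in> over_times D \<longleftrightarrow> k \<notin> over_times D)"
  \<comment> \<open>Either \<open>k\<close> is itself the over-passage, and the second time comes
    from its being a double point, or \<open>s\<close> is the other passage.\<close>
  proof (cases "frac s = frac k")
    case True
    then have k: "k \<in> over_times D" using s over_iff by blast
    then show ?thesis using over_double[OF k] over_iff[OF k] by metis
  next
    case False
    then show ?thesis using s over_iff[OF s] by blast
  qed
  then obtain j where j: "curve D j = curve D k" "frac j \<noteq> frac k" "j \<in> over_times D \<longleftrightarrow> k \<notin> over_times D"
    by blast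
  have "j \<in> classical_times D" using s j by (auto simp: classical_times_def)
  then show ?thesis using that[of "frac j"] j frac_in_unit[of j] by simp
qed

lemma mate_timeI:
  assumes "curve D j = curve D k" "frac j \<noteq> frac k"
  shows "mate_time D (frac k) = frac j"
  unfolding mate_time_def
proof (rule the_equality)
  show "frac j \<in> {0..<1} \<and> frac j \<noteq> frac k \<and> curve D (frac j) = curve D (frac k)"
    using assms frac_in_unit by simp
  fix l assume l: "l \<in> {0..<1} \<and> l \<noteq> frac k \<and> curve D l = curve D (frac k)"
  then have fl: "frac l = l" by (simp add: frac_unit)
  have "curve D l = curve D k" "curve D k = curve D j" "frac l \<noteq> frac k"
    using l assms fl by simp_all
  then have "frac l = frac j" using no_triple assms(2) by metis
  then show "l = frac j" using fl by simp
qed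

lemma finite_gC: "finite (classical_times D \<inter> {0..<1})"
proof (rule finite_subset)
  show "classical_times D \<inter> {0..<1} \<subseteq> double_times D \<inter> {0..<1}"
    using classical_mate unfolding double_times_def frac_eq_iff_Ints[symmetric] by blast
qed (use D in \<open>simp add: virtual_diagram_def\<close>)

lemma mate_props:
  assumes k: "k \<in> classical_times D" "k \<in> {0..<1}"
  shows "mate_time D k \<in> classical_times D" "mate_time D k \<in> {0..<1}" "mate_time D k \<noteq> k"
    "mate_time D (mate_time D k) = k" "mate_time D k \<in> over_times D \<longleftrightarrow> k \<notin> over_times D"
    "curve D (mate_time D k) = curve D k"
proof -
  obtain j where j: "curve D j = curve D k" "frac j \<noteq> frac k" "j \<in> over_times D \<longleftrightarrow> k \<notin> over_times D"
    "j \<in> {0..<1}" "j \<in> classical_times D" using classical_mate[OF k(1)] .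
  have fr: "frac j = j" "frac k = k" using j(4) k(2) by (simp_all add: frac_unit)
  have m: "mate_time D k = j" using mate_timeI[OF j(1,2)] fr by simp
  moreover have "mate_time D j = k" using mate_timeI[of k j] j fr by simp
  ultimately show "mate_time D k \<in> classical_times D" "mate_time D k \<in> {0..<1}" "mate_time D k \<noteq> k"
    "mate_time D (mate_time D k) = k" "mate_time D k \<in> over_times D \<longleftrightarrow> k \<notin> over_times D"
    "curve D (mate_time D k) = curve D k"
    using j fr by auto
qed

lemma mate_unique:
  assumes k: "k \<in> classical_times D" "k \<in> {0..<1}" and "j \<in> {0..<1}" "j \<noteq> k"
  shows "curve D j = curve D k \<longleftrightarrow> j = mate_time D k"
proof
  assume "curve D j = curve D k"
  moreover have "frac j = j" "frac k = k" using assms by (simp_all add: frac_unit)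
  ultimately show "j = mate_time D k" using mate_timeI[of j k] assms by simp
qed (use mate_props(6)[OF k] in simp)

lemma wf_gauss_of: "wf_gauss (gauss_of D)"
  unfolding wf_gauss_def
proof (intro conjI ballI)
  show "finite (gC (gauss_of D))" using finite_gC by simp
  show "gO (gauss_of D) \<subseteq> gC (gauss_of D)" using over_classical by auto
  fix k assume "k \<in> gC (gauss_of D)"
  then have k: "k \<in> classical_times D" "k \<in> {0..<1}" by auto
  note m = mate_props[OF k]
  show "gM (gauss_of D) k \<in> gC (gauss_of D)" "gM (gauss_of D) k \<noteq> k"
    "gM (gauss_of D) (gM (gauss_of D) k) = k"
    "gM (gauss_of D) k \<in> gO (gauss_of D) \<longleftrightarrow> k \<notin> gO (gauss_of D)"
    "gS (gauss_of D) (gM (gauss_of D) k) = gS (gauss_of D) k"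
    "gS (gauss_of D) k \<in> {1, -1}"
    using m k by (auto simp: sign_at_def)
qed auto

subsection \<open>Comparison with the matrix of arcs\<close>

lemma set_passages: "set (passages D) = classical_times D \<inter> {0..<1}" and distinct_passages: "distinct (passages D)" and sorted_passages: "sorted (passages D)"
  and length_passages: "length (passages D) = card (classical_times D \<inter> {0..<1})"
  using finite_gC by (simp_all add: passages_def)

lemma nth_in: "k < length (passages D) \<Longrightarrow> passages D ! k \<in> classical_times D \<inter> {0..<1}"
  using set_passages nth_mem by blast

lemma nth_less: "i < j \<Longrightarrow> j < length (passages D) \<Longrightarrow> passages D ! i < passages D ! j"
  using sorted_passages distinct_passages strict_sorted_iff sorted_wrt_nth_less by blast

lemma nth_less_iff: "i < length (passages D) \<Longrightarrow> j < length (passages D) \<Longrightarrow> passages D ! i < passages D ! j \<longleftrightarrow> i < j"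
  using nth_less[of i j] nth_less[of j i] by (cases i j rule: linorder_cases) auto

lemma nth_eq_iff: "i < length (passages D) \<Longrightarrow> j < length (passages D) \<Longrightarrow> passages D ! i = passages D ! j \<longleftrightarrow> i = j"
  using distinct_passages by (simp add: nth_eq_iff_index_eq)

lemma in_classical_nth: "x \<in> classical_times D \<inter> {0..<1} \<Longrightarrow> \<exists>i < length (passages D). passages D ! i = x"
  using set_passages by (metis in_set_conv_nth)

text \<open>Colours count from the base point 0, where the list of passages starts as well, so the
  points counted are those of smaller index.\<close>

lemma colour_nth: assumes k: "k < length (passages D)" shows "colour (classical_times D \<inter> {0..<1}) (passages D ! k) \<longleftrightarrow> odd k"
proof -
  have fr: "frac (passages D ! k) = passages D ! k" using nth_in[OF k] by (simp add: frac_unit)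
  have "(classical_times D \<inter> {0..<1}) \<inter> {0..<passages D ! k} = (\<lambda>i. passages D ! i) ` {..<k}"
  proof (intro equalityI subsetI)
    fix x assume x: "x \<in> (classical_times D \<inter> {0..<1}) \<inter> {0..<passages D ! k}"
    then obtain i where "i < length (passages D)" "passages D ! i = x" using in_classical_nth[of x] by blast
    then show "x \<in> (\<lambda>i. passages D ! i) ` {..<k}" using x k nth_less_iff[of i k] by auto
  next
    fix x assume "x \<in> (\<lambda>i. passages D ! i) ` {..<k}"
    then show "x \<in> (classical_times D \<inter> {0..<1}) \<inter> {0..<passages D ! k}" using k nth_in nth_less by fastforce
  qed
  moreover have "inj_on (\<lambda>i. passages D ! i) {..<k}" using k by (auto simp: inj_on_def nth_eq_iff)
  ultimately show ?thesis by (simp add: colour_def fr card_image)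
qed

lemma gauss_code_nth: "k < length (passages D) \<Longrightarrow> gauss_code D ! k = curve D (passages D ! k)"
  and length_gauss_code: "length (gauss_code D) = length (passages D)"
  by (simp_all add: gauss_code_def)

lemma mate_index:
  assumes k: "k < length (passages D)"
  shows "other_passage D k < length (passages D)" "passages D ! other_passage D k = mate_time D (passages D ! k)"
proof -
  have kC: "passages D ! k \<in> classical_times D" "passages D ! k \<in> {0..<1}" using nth_in[OF k] by auto
  note m = mate_props[OF kC]
  obtain l where l: "l < length (passages D)" "passages D ! l = mate_time D (passages D ! k)" using in_classical_nth m by blast
  have "other_passage D k = l"
    unfolding other_passage_def
  proof (rule the_equality)
    show "l < length (gauss_code D) \<and> l \<noteq> k \<and> gauss_code D ! l = gauss_code D ! k"
      using l m k by (auto simp: length_gauss_code gauss_code_nth)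
    fix l' assume l': "l' < length (gauss_code D) \<and> l' \<noteq> k \<and> gauss_code D ! l' = gauss_code D ! k"
    then have lt: "l' < length (passages D)" by (simp add: length_gauss_code)
    then have "passages D ! l' \<noteq> passages D ! k" using l' k nth_eq_iff by simp
    then have "passages D ! l' = mate_time D (passages D ! k)"
      using mate_unique[OF kC, of "passages D ! l'"] l' lt k nth_in[OF lt] by (simp add: gauss_code_nth)
    then show "l' = l" using l lt nth_eq_iff by metis
  qed
  then show "other_passage D k < length (passages D)" "passages D ! other_passage D k = mate_time D (passages D ! k)" using l by auto
qed

text \<open>The number of letters between two indices is odd iff the indices have the same parity,
  that is, the passages have the same colour.\<close>

lemma odd_crossing_iff:
  assumes k: "k < length (passages D)"
  shows "gauss_code D ! k \<in> odd_crossings D \<longleftrightarrow> g_odd (gauss_of D) (passages D ! k)"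
proof -
  let ?l = "other_passage D k"
  note m = mate_index[OF k]
  have kC: "passages D ! k \<in> classical_times D" "passages D ! k \<in> {0..<1}" using nth_in[OF k] by auto
  have lk: "?l \<noteq> k" using m mate_props(3)[OF kC] by auto
  have gl: "gauss_code D ! ?l = gauss_code D ! k"
    using mate_props(6)[OF kC] m k by (simp add: gauss_code_nth)
  have uniq: "i = k \<or> i = ?l" if "i < length (passages D)" "gauss_code D ! i = gauss_code D ! k" for i
  proof (rule ccontr)
    assume ne: "\<not> (i = k \<or> i = ?l)"
    then have "passages D ! i \<noteq> passages D ! k" using that k nth_eq_iff by simp
    then have "passages D ! i = mate_time D (passages D ! k)"
      using mate_unique[OF kC, of "passages D ! i"] that k nth_in[OF that(1)] by (simp add: gauss_code_nth)
    then show False using ne m that(1) nth_eq_iff by metis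
  qed
  have "g_odd (gauss_of D) (passages D ! k) \<longleftrightarrow> (odd k \<longleftrightarrow> odd ?l)"
    using colour_nth[OF k] colour_nth[OF m(1)] m(2) by (simp add: g_odd_def)
  also have "\<dots> \<longleftrightarrow> gauss_code D ! k \<in> odd_crossings D"
  proof
    assume par: "odd k \<longleftrightarrow> odd ?l"
    define i j where "i = min k ?l" and "j = max k ?l"
    have "i < j" "j < length (gauss_code D)" "gauss_code D ! i = gauss_code D ! k"
      "gauss_code D ! j = gauss_code D ! k"
      using lk k m gl by (auto simp: i_def j_def min_def max_def length_gauss_code)
    moreover have "odd (j - i - 1)"
      using par lk \<open>i < j\<close> by (auto simp: i_def j_def min_def max_def split: if_splits)
    ultimately show "gauss_code D ! k \<in> odd_crossings D" unfolding odd_crossings_def by blast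
  next
    assume "gauss_code D ! k \<in> odd_crossings D"
    then obtain i j where ij: "i < j" "j < length (passages D)" "gauss_code D ! i = gauss_code D ! k"
      "gauss_code D ! j = gauss_code D ! k" "odd (j - i - 1)"
      unfolding odd_crossings_def length_gauss_code by auto
    then have "i = k \<and> j = ?l \<or> i = ?l \<and> j = k" using uniq[of i] uniq[of j] by auto
    moreover have "odd i \<longleftrightarrow> odd j" using ij(1,5) by presburger
    ultimately show "odd k \<longleftrightarrow> odd ?l" by auto
  qed
  finally show ?thesis by simp
qed

text \<open>Odd crossings are points of the plane, and the curve passes over each of them exactly
  once in a period.\<close>

lemma card_odd_crossings: "card (odd_crossings D) = card (odd_over (gauss_of D))"
proof -
  have "odd_crossings D = curve D ` odd_over (gauss_of D)"
  proof (intro equalityI subsetI)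
    fix v assume v: "v \<in> odd_crossings D"
    then obtain i where i: "i < length (passages D)" "gauss_code D ! i = v"
      unfolding odd_crossings_def length_gauss_code by fastforce
    have iC: "passages D ! i \<in> classical_times D" "passages D ! i \<in> {0..<1}" using nth_in[OF i(1)] by auto
    have od: "g_odd (gauss_of D) (passages D ! i)" using odd_crossing_iff[OF i(1)] i v by simp
    show "v \<in> curve D ` odd_over (gauss_of D)"
    proof (cases "passages D ! i \<in> over_times D")
      case True
      then show ?thesis using od iC i by (auto simp: odd_over_def gauss_code_nth intro!: image_eqI[of _ _ "passages D ! i"])
    next
      case False
      then have "mate_time D (passages D ! i) \<in> odd_over (gauss_of D)"
        using mate_props[OF iC] od g_odd_mate[OF wf_gauss_of, of "passages D ! i"] iC by (simp add: odd_over_def)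
      then show ?thesis using mate_props(6)[OF iC] i by (metis gauss_code_nth imageI)
    qed
  next
    fix v assume "v \<in> curve D ` odd_over (gauss_of D)"
    then obtain k where k: "k \<in> over_times D" "k \<in> {0..<1}" "g_odd (gauss_of D) k" "v = curve D k"
      by (auto simp: odd_over_def)
    then obtain i where "i < length (passages D)" "passages D ! i = k" using in_classical_nth over_classical by blast
    then show "v \<in> odd_crossings D" using odd_crossing_iff[of i] k by (simp add: gauss_code_nth)
  qed
  moreover have "inj_on (curve D) (odd_over (gauss_of D))"
  proof (rule inj_onI)
    fix x y assume "x \<in> odd_over (gauss_of D)" "y \<in> odd_over (gauss_of D)" "curve D x = curve D y"
    then have "frac x = frac y" "frac x = x" "frac y = y"
      using over_iff[of x y] by (auto simp: odd_over_def frac_unit)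
    then show "x = y" by simp
  qed
  ultimately show ?thesis by (simp add: card_image)
qed

end

context
  fixes D :: diagram
  assumes D: "virtual_diagram D"
begin

lemma nx_nth:
  assumes k: "k < length (passages D)"
  shows "nx (classical_times D \<inter> {0..<1}) (passages D ! k) =
    passages D ! ((k + 1) mod length (passages D))"
proof -
  let ?xs = "passages D" and ?C = "classical_times D \<inter> {0..<1}"
  have unit: "0 \<le> ?xs ! i" "?xs ! i < 1" "frac (?xs ! i) = ?xs ! i" if "i < length ?xs" for i
    using nth_in[OF D that] by (auto simp: frac_unit)
  show ?thesis
  proof (cases "k + 1 < length ?xs")
    case True
    have "adjacent ?C (?xs ! k) (?xs ! (k + 1))"
      unfolding adjacent_def
    proof (intro conjI allI impI)
      show "?xs ! k < ?xs ! (k + 1)" using nth_less[OF D] True by simp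
      show "?xs ! (k + 1) \<le> ?xs ! k + 1" using unit[OF k] unit[OF True] by simp
      show "frac (?xs ! (k + 1)) \<in> ?C" using nth_in[OF D True] unit[OF True] by simp
      fix x assume x: "?xs ! k < x \<and> x < ?xs ! (k + 1)"
      then have fx: "frac x = x" using unit[OF k] unit[OF True] by (simp add: frac_unit)
      show "frac x \<notin> ?C"
      proof
        assume "frac x \<in> ?C"
        then obtain i where i: "i < length ?xs" "?xs ! i = x" using in_classical_nth[OF D, of x] fx by auto
        then have "k < i" "i < k + 1" using x nth_less_iff[OF D k i(1)] nth_less_iff[OF D i(1) True] by auto
        then show False by simp
      qed
    qed
    then show ?thesis using nx_adjacent[OF finite_gC[OF D]] unit[OF True] True by simp
  next
    case False
    then have last: "k + 1 = length ?xs" using k by simp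
    have z: "0 < length ?xs" using k by linarith
    \<comment> \<open>The last passage is followed by the first one, a turn later.\<close>
    have "adjacent ?C (?xs ! k) (?xs ! 0 + 1)"
      unfolding adjacent_def
    proof (intro conjI allI impI)
      show "?xs ! k < ?xs ! 0 + 1" using unit[OF k] unit[OF z] by simp
      have "\<not> ?xs ! k < ?xs ! 0" using nth_less_iff[OF D k z] by simp
      then show "?xs ! 0 + 1 \<le> ?xs ! k + 1" by simp
      show "frac (?xs ! 0 + 1) \<in> ?C" using nth_in[OF D z] unit[OF z] frac_add_int[of "?xs ! 0" 1] by simp
      fix x assume x: "?xs ! k < x \<and> x < ?xs ! 0 + 1"
      show "frac x \<notin> ?C"
      proof
        assume "frac x \<in> ?C"
        then obtain i where i: "i < length ?xs" "?xs ! i = frac x" using in_classical_nth[OF D, of "frac x"] by auto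
        show False
        proof (cases "x < 1")
          case True
          then have "frac x = x" using x unit[OF k] by (simp add: frac_unit)
          then have "k < i" using x i nth_less_iff[OF D k i(1)] by simp
          then show False using last i(1) by simp
        next
          case False
          then have "frac x = x - 1" using x unit[OF z] frac_add_int[of x "-1"] frac_unit[of "x - 1"] by simp
          then have "?xs ! i < ?xs ! 0" using x i by simp
          then show False using nth_less_iff[OF D i(1) z] by simp
        qed
      qed
    qed
    then show ?thesis
      using nx_adjacent[OF finite_gC[OF D]] unit[OF z] last frac_add_int[of "?xs ! 0" 1] by simp
  qed
qed

lemma crossing_sign_nth:
  assumes k: "k < length (passages D)"
  shows "crossing_sign D k = gS (gauss_of D) (passages D ! k)"
  using mate_index[OF D k]
  by (simp add: crossing_sign_def sign_at_def over_passage_def under_passage_def is_over_def)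

lemma out_coeff_nth:
  assumes k: "k < length (passages D)" and j: "j < length (passages D)"
  shows "out_coeff D k j = cf (gauss_of D) (passages D ! k) (passages D ! j)"
proof -
  let ?xs = "passages D" and ?G = "gauss_of D"
  have kC: "?xs ! k \<in> classical_times D" "?xs ! k \<in> {0..<1}" using nth_in[OF D k] by auto
  have dlk: "dl (?xs ! k) (?xs ! j) = (if j = k then 1 else 0 :: laurent3)"
    using nth_eq_iff[OF D j k] by (simp add: dl_def)
  have dlm: "dl (mate_time D (?xs ! k)) (?xs ! j) = (if j = other_passage D k then 1 else 0 :: laurent3)"
    using nth_eq_iff[OF D j mate_index(1)[OF D k]] mate_index(2)[OF D k] by (simp add: dl_def)
  have S: "gS ?G (?xs ! k) = crossing_sign D k" using crossing_sign_nth[OF k] by simp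
  have C: "?xs ! k \<in> gC ?G" and O: "?xs ! k \<in> gO ?G \<longleftrightarrow> is_over D k" and M: "gM ?G (?xs ! k) = mate_time D (?xs ! k)"
    using kC by (auto simp: is_over_def)
  have op: "over_passage D k = other_passage D k" if "\<not> is_over D k"
    using that by (simp add: over_passage_def)
  show ?thesis
    unfolding out_coeff_def cf_def Let_def S M odd_crossing_iff[OF D k]
    using C O by (simp add: dlk dlm coef_defs op)
qed

text \<open>Row \<open>i\<close> of the matrix of arcs is the relation whose outgoing arc is
  \<open>i\<close>, so it belongs to the passage before \<open>i\<close>. The two matrices differ by
  a cyclic permutation of the rows, which may change the sign.\<close>

lemma diagram_polynomial_alex:
  "diagram_polynomial D = alex (gauss_of D) \<or> diagram_polynomial D = - alex (gauss_of D)"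
proof (cases "length (passages D) = 0")
  case True
  then have C: "gC (gauss_of D) = {}" using length_passages[OF D] finite_gC[OF D] by simp
  have "nx {0} 0 = 0" using nx_in[of "{0}" 0] by simp
  then have "alex (gauss_of D) = 0"
    using C detS_insert[of "{}" 0 "\<lambda>k j. cf (gauss_of D) k j - dl (nx {0} k) j"]
    by (simp add: alex_def g_det_def cf_def)
  moreover have eq: "(1\<^sub>m 1 - 1\<^sub>m 1 :: laurent3 Matrix.mat) = 0\<^sub>m 1 1" by (rule eq_matI) auto
  have arc: "arc_matrix D = 1\<^sub>m 1" using True by (simp add: arc_matrix_def)
  have "diagram_polynomial D = 0"
    unfolding diagram_polynomial_def arc index_one_mat eq by (rule Determinant.det_zero) simp
  ultimately show ?thesis by simp
next
  case False
  let ?xs = "passages D" and ?G = "gauss_of D" and ?C = "classical_times D \<inter> {0..<1}"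
  define N where "N = length ?xs"
  have N: "0 < N" using False by (simp add: N_def)
  \<comment> \<open>Index of the passage whose outgoing arc is \<open>i\<close>, extended by the
    identity to a permutation.\<close>
  define pr where "pr i = (if i < N then (i + N - 1) mod N else i)" for i
  have pr_less: "pr i < N" if "i < N" for i using that N by (simp add: pr_def)
  have succ_pr: "(pr i + 1) mod N = i" if "i < N" for i
  proof (cases i)
    case 0
    then show ?thesis using N by (simp add: pr_def)
  next
    case (Suc i')
    then have "pr i = i'" using that by (simp add: pr_def)
    then show ?thesis using that Suc by simp
  qed
  have "inj_on pr {0..<N}" using succ_pr by (metis atLeastLessThan_iff inj_onI)
  then have "bij_betw pr {0..<N} {0..<N}"
    using pr_less by (simp add: bij_betw_def endo_inj_surj image_subset_iff)
  then have perm: "pr permutes {0..<N}"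
    by (rule bij_imp_permutes) (simp add: pr_def)
  let ?f = "\<lambda>k j. cf ?G k j - dl (nx ?C k) j"
  let ?B = "Matrix.mat N N (\<lambda>(i, j). ?f (?xs ! i) (?xs ! j))"
  have bij: "bij_betw (\<lambda>i. ?xs ! i) {0..<N} ?C"
    using bij_betw_nth[OF distinct_passages[OF D] _ set_passages[OF D, symmetric]] by (auto simp: N_def lessThan_atLeast0)
  have "alex ?G = g_det ?G ?C"
    by (rule g_det_eq_alex[OF wf_gauss_of[OF D], symmetric])
       (use finite_gC[OF D] False length_passages[OF D] in auto)
  also have "\<dots> = Determinant.det ?B" by (simp add: g_det_def detS_enum[OF bij] detE_def)
  finally have alex: "alex ?G = Determinant.det ?B" .
  have "arc_matrix D - 1\<^sub>m (dim_row (arc_matrix D)) = Matrix.mat N N (\<lambda>(i, j). ?B $$ (pr i, j))"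
  proof (rule eq_matI)
    fix i j assume "i < dim_row (Matrix.mat N N (\<lambda>(i, j). ?B $$ (pr i, j)))"
      "j < dim_col (Matrix.mat N N (\<lambda>(i, j). ?B $$ (pr i, j)))"
    then have ij: "i < N" "j < N" by auto
    have "nx ?C (?xs ! pr i) = ?xs ! i"
      using nx_nth[of "pr i"] pr_less[OF ij(1)] succ_pr[OF ij(1)] by (simp add: N_def)
    then have "dl (nx ?C (?xs ! pr i)) (?xs ! j) = (if i = j then 1 else 0 :: laurent3)"
      using nth_eq_iff[OF D, of j i] ij by (auto simp: dl_def N_def)
    then show "(arc_matrix D - 1\<^sub>m (dim_row (arc_matrix D))) $$ (i, j) =
      Matrix.mat N N (\<lambda>(i, j). ?B $$ (pr i, j)) $$ (i, j)"
      using ij N pr_less[OF ij(1)] out_coeff_nth[of "pr i" j]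
      by (simp add: arc_matrix_def Let_def N_def[symmetric]) (simp add: pr_def)
  qed (use N in \<open>simp_all add: arc_matrix_def Let_def N_def\<close>)
  then have "diagram_polynomial D = signof pr * Determinant.det ?B"
    unfolding diagram_polynomial_def by (simp only: Determinant.det_permute_rows[OF mat_carrier perm])
  then show ?thesis unfolding alex by (cases "evenperm pr") (simp_all add: sign_def)
qed

end

section \<open>The units +-s^a t^b, and reduction of the theorem to invariance under moves\<close>

definition unit_equiv :: "laurent3 \<Rightarrow> laurent3 \<Rightarrow> bool" where
  "unit_equiv p q \<longleftrightarrow> (\<exists>a b. p = mono3 a b 0 * q \<or> p = - (mono3 a b 0 * q))"

lemma unit_equiv_mono: "unit_equiv (mono3 a b 0 * p) p"
  by (auto simp: unit_equiv_def)

lemma unit_equiv_refl: "unit_equiv p p"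
  using unit_equiv_mono[of 0 0 p] by (simp add: mono3_one)

lemma unit_equiv_minus: "unit_equiv (- p) p"
  unfolding unit_equiv_def by (rule exI[of _ 0], rule exI[of _ 0]) (simp add: mono3_one)

lemma unit_equiv_sym: "unit_equiv p q \<Longrightarrow> unit_equiv q p"
  unfolding unit_equiv_def
proof (elim exE)
  fix a b assume "p = mono3 a b 0 * q \<or> p = - (mono3 a b 0 * q)"
  then have "q = mono3 (- a) (- b) 0 * p \<or> q = - (mono3 (- a) (- b) 0 * p)"
    by (auto simp: mono3_mult_left mono3_one)
  then show "\<exists>a b. q = mono3 a b 0 * p \<or> q = - (mono3 a b 0 * p)" by blast
qed

lemma unit_equiv_trans: "unit_equiv p q \<Longrightarrow> unit_equiv q r \<Longrightarrow> unit_equiv p r"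
  unfolding unit_equiv_def
proof (elim exE)
  fix a b c d
  assume "p = mono3 a b 0 * q \<or> p = - (mono3 a b 0 * q)" "q = mono3 c d 0 * r \<or> q = - (mono3 c d 0 * r)"
  then have "p = mono3 (a + c) (b + d) 0 * r \<or> p = - (mono3 (a + c) (b + d) 0 * r)"
    by (auto simp: mono3_mult_left)
  then show "\<exists>a b. p = mono3 a b 0 * r \<or> p = - (mono3 a b 0 * r)" by blast
qed

text \<open>The units contain no \<open>z\<close>, so they do not shift its exponents.\<close>

lemma z_between_unit_equiv:
  assumes "unit_equiv p q" "z_between lo hi q"
  shows "z_between lo hi p"
proof -
  have "z_between lo hi (mono3 a b 0 * q)" for a b
    using z_between_mult[OF z_between_mono3[of 0 0 0 a b] assms(2)] by simp
  then show ?thesis using assms(1) by (auto simp: unit_equiv_def z_between_uminus)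
qed

theorem z_extent_bound_of_invariance:
  assumes inv: "\<And>D D'. virtual_diagram D \<Longrightarrow> virtual_diagram D' \<Longrightarrow> diagram_move D D' \<Longrightarrow>
    unit_equiv (alex (gauss_of D')) (alex (gauss_of D))"
    and K: "K \<in> virtual_knots" and p: "p \<in> z_parity_alexander K" and e: "e = z_extent p"
  shows "(even e \<longrightarrow> e \<le> int (min_odd_crossings K)) \<and> (odd e \<longrightarrow> e + 1 \<le> int (min_odd_crossings K))"
proof -
  obtain D1 where D1: "virtual_diagram D1" and KD1: "K = diagram_equiv `` {D1}"
    using K unfolding virtual_knots_def by (auto elim!: quotientE)
  let ?R = "\<lambda>E E'. virtual_diagram E \<and> virtual_diagram E' \<and> diagram_move E E'"
  have inv': "unit_equiv (alex (gauss_of D')) (alex (gauss_of D))" if "equivclp ?R D D'" for D D'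
    using that
  proof (induction rule: equivclp_induct)
    case base
    then show ?case by (rule unit_equiv_refl)
  next
    case (step y z)
    then have "unit_equiv (alex (gauss_of z)) (alex (gauss_of y))"
      using inv unit_equiv_sym by blast
    then show ?case using step.IH by (rule unit_equiv_trans)
  qed
  have mem: "virtual_diagram D \<and> unit_equiv (alex (gauss_of D)) (alex (gauss_of D1))" if "D \<in> K" for D
    using that inv' unfolding KD1 diagram_equiv_def by auto
  have "D1 \<in> K" using D1 unfolding KD1 diagram_equiv_def by (auto intro: equivclp_refl)
  then have ex: "\<exists>n. \<exists>D\<in>K. n = card (odd_crossings D)" by blast
  obtain D0 where D0: "D0 \<in> K" "min_odd_crossings K = card (odd_crossings D0)"
    using LeastI_ex[OF ex] unfolding min_odd_crossings_def by auto
  then have v0: "virtual_diagram D0" using mem by blast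
  \<comment> \<open>The polynomial may be computed from any diagram of the knot. Invariance carries
    the bound over from \<open>D0\<close>, where the number of odd crossings is the minimum.\<close>
  obtain D where D: "D \<in> K" "unit_equiv p (diagram_polynomial D)"
    using p unfolding z_parity_alexander_def unit_equiv_def by blast
  have "unit_equiv (diagram_polynomial D) (alex (gauss_of D))"
    using diagram_polynomial_alex[of D] mem[OF D(1)] unit_equiv_refl unit_equiv_minus by metis
  then have "unit_equiv p (alex (gauss_of D0))"
    using D mem[OF D(1)] mem[OF D0(1)] unit_equiv_trans unit_equiv_sym by meson
  then have "z_between (- int (min_odd_crossings K)) (int (min_odd_crossings K)) p"
    unfolding D0(2) card_odd_crossings[OF v0]
    by (rule z_between_unit_equiv) (rule z_between_alex[OF wf_gauss_of[OF v0]])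
  then have "e \<le> int (min_odd_crossings K)" unfolding e by (rule z_extent_le) simp
  \<comment> \<open>An odd \<open>e\<close> cannot equal this even number, hence the gain of
    one.\<close>
  moreover have "even (min_odd_crossings K)"
    unfolding D0(2) card_odd_crossings[OF v0] by (rule even_odd_over[OF wf_gauss_of[OF v0]])
  ultimately show ?thesis by presburger
qed

section \<open>Invariance under moves\<close>

text \<open>A relation between times on the line that depends only on their classes modulo 1
  (\<open>crossing_cong\<close>). The geometry of the moves is expressed by it, and the data of the
  Gauss diagram are recovered with \<open>gC_crossing\<close>, \<open>crossing_mate\<close> and
  \<open>crossing_sign\<close>.\<close>

definition crossing :: "diagram \<Rightarrow> real \<Rightarrow> real \<Rightarrow> bool" where
  "crossing D x y \<longleftrightarrow> curve D x = curve D y \<and> frac x \<noteq> frac y \<and> x \<in> classical_times D"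

lemma crossing_sym: "crossing D x y \<Longrightarrow> crossing D y x"
  by (auto simp: crossing_def classical_times_def)

context
  fixes D :: diagram
  assumes D: "virtual_diagram D"
begin

lemma curve_has_derivative: "(curve D has_vector_derivative tangent D t) (at t)"
proof -
  have "curve D C1_differentiable_on UNIV" using D by (simp add: virtual_diagram_def)
  then have "curve D differentiable at t" by (simp add: C1_differentiable_on_eq)
  then show ?thesis by (simp add: tangent_def vector_derivative_works[symmetric])
qed

lemma continuous_curve: "continuous_on A (curve D)"
  by (rule continuous_at_imp_continuous_on)
    (intro ballI has_vector_derivative_continuous[OF curve_has_derivative])

lemma tangent_nonzero: "tangent D t \<noteq> 0"
  using D unfolding virtual_diagram_def by blast

lemma tangent_periodic: "tangent D (t + of_int n) = tangent D t"
proof -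
  have "((\<lambda>x. x + of_int n) has_vector_derivative 1) (at t)"
    by (auto intro!: derivative_eq_intros)
  then have "(curve D \<circ> (\<lambda>x. x + of_int n) has_vector_derivative 1 *\<^sub>R tangent D (t + of_int n)) (at t)"
    by (rule vector_diff_chain_at[OF _ curve_has_derivative])
  moreover have "curve D \<circ> (\<lambda>x. x + of_int n) = curve D"
    by (auto simp: curve_periodic[OF D])
  ultimately have "(curve D has_vector_derivative tangent D (t + of_int n)) (at t)" by simp
  then have "vector_derivative (curve D) (at t) = tangent D (t + of_int n)" by (rule vector_derivative_at)
  then show ?thesis unfolding tangent_def by simp
qed

lemma tangent_frac [simp]: "tangent D (frac t) = tangent D t"
  using tangent_periodic[of t "- \<lfloor>t\<rfloor>"] by (simp add: frac_def)

lemma sign_at_frac [simp]: "sign_at D (frac x) (frac y) = sign_at D x y"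
  by (simp add: sign_at_def)

lemma classical_crossing:
  assumes "x \<in> classical_times D"
  obtains y where "crossing D x y" "frac y = y"
proof -
  obtain j where "curve D j = curve D x" "frac j \<noteq> frac x" "j \<in> {0..<1}"
    using classical_mate[OF D assms] .
  then show ?thesis using that[of j] assms by (simp add: crossing_def frac_unit)
qed

lemma crossing_unique: "crossing D x y \<Longrightarrow> crossing D x z \<Longrightarrow> frac y = frac z"
  using no_triple[OF D, of y x z] by (auto simp: crossing_def)

lemma crossing_frac1 [simp]: "crossing D (frac x) y \<longleftrightarrow> crossing D x y"
  by (simp add: crossing_def curve_frac[OF D] classical_frac[OF D])

lemma crossing_frac2 [simp]: "crossing D x (frac y) \<longleftrightarrow> crossing D x y"
  by (simp add: crossing_def curve_frac[OF D])

lemma crossing_mate: "crossing D x y \<Longrightarrow> mate_time D (frac x) = frac y"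
  unfolding crossing_def by (rule mate_timeI[OF D]) auto

lemma crossing_over: "crossing D x y \<Longrightarrow> y \<in> over_times D \<longleftrightarrow> x \<notin> over_times D"
proof -
  assume c: "crossing D x y"
  then have x: "frac x \<in> classical_times D" "frac x \<in> {0..<1}"
    using frac_in_unit classical_frac[OF D] by (auto simp: crossing_def)
  then show ?thesis using mate_props(5)[OF D x] crossing_mate[OF c] over_frac[OF D] by simp
qed

lemma crossingI: "curve D x = curve D y \<Longrightarrow> frac x \<noteq> frac y \<Longrightarrow>
    x \<in> over_times D \<or> y \<in> over_times D \<Longrightarrow> crossing D x y"
  unfolding crossing_def classical_times_def by auto

lemma crossing_sign: "crossing D x y \<Longrightarrow>
    gS (gauss_of D) (frac x) = (if x \<in> over_times D then sign_at D x y else sign_at D y x)"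
  using crossing_mate[of x y] over_frac[OF D, of x] by simp

lemma gC_crossing: "k \<in> gC (gauss_of D) \<longleftrightarrow> frac k = k \<and> (\<exists>y. crossing D k y)"
proof
  assume "k \<in> gC (gauss_of D)"
  then have k: "k \<in> classical_times D" "frac k = k" by (auto simp: frac_unit)
  obtain y where "crossing D k y" using classical_crossing[OF k(1)] .
  then show "frac k = k \<and> (\<exists>y. crossing D k y)" using k by blast
next
  assume "frac k = k \<and> (\<exists>y. crossing D k y)"
  then show "k \<in> gC (gauss_of D)" using frac_in_unit[of k] by (auto simp: crossing_def)
qed

lemma gC_frac: "frac x \<in> gC (gauss_of D) \<longleftrightarrow> (\<exists>y. crossing D x y)"
proof -
  have "crossing D (frac x) = crossing D x" by (rule ext) simp
  then show ?thesis using gC_crossing[of "frac x"] by simp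
qed

end

lemma alex_eq_of_crossings:
  assumes D: "virtual_diagram D" and D': "virtual_diagram D'"
    and eq: "\<And>x y. crossing D x y \<longleftrightarrow> crossing D' x y"
    and over: "\<And>x y. crossing D x y \<Longrightarrow> x \<in> over_times D' \<longleftrightarrow> x \<in> over_times D"
    and sign: "\<And>x y. crossing D x y \<Longrightarrow> sign_at D' x y = sign_at D x y"
  shows "alex (gauss_of D') = alex (gauss_of D)"
proof -
  have C: "gC (gauss_of D) = gC (gauss_of D')"
    using gC_crossing[OF D] gC_crossing[OF D'] eq by blast
  show ?thesis
  proof (rule alex_transport[OF wf_gauss_of[OF D] wf_gauss_of[OF D'], where \<phi> = "\<lambda>x. x"])
    show "transports (\<lambda>x. x) (gC (gauss_of D)) (gC (gauss_of D'))"
      unfolding transports_def C by auto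
    fix k assume "k \<in> gC (gauss_of D)"
    then obtain y where k: "frac k = k" and y: "crossing D k y" using gC_crossing[OF D] by blast
    have y': "crossing D' k y" using eq y by blast
    show "gM (gauss_of D') (frac k) = frac (gM (gauss_of D) k)"
      using crossing_mate[OF D y] crossing_mate[OF D' y'] k by simp
    show "gS (gauss_of D') (frac k) = gS (gauss_of D) k"
      using crossing_sign[OF D y] crossing_sign[OF D' y'] k over[OF y] sign[OF y]
        sign[OF crossing_sym[OF y]] by metis
    show "frac k \<in> gO (gauss_of D') \<longleftrightarrow> k \<in> gO (gauss_of D)" using over[OF y] k by simp
  qed
qed

subsection \<open>Planar isotopy\<close>

lemma circle_reparam_props:
  assumes "circle_reparam \<rho>"
  shows "\<rho> (t + of_int n) = \<rho> t + of_int n" "strict_mono \<rho>" "surj \<rho>"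
proof -
  obtain \<rho>' where \<rho>': "\<And>t. (\<rho> has_real_derivative \<rho>' t) (at t)" "\<And>t. \<rho>' t > 0"
    and p1: "\<And>t. \<rho> (t + 1) = \<rho> t + 1"
    using assms unfolding circle_reparam_def by blast
  show shift: "\<rho> (t + of_int n) = \<rho> t + of_int n" for t n
  proof (induction n rule: int_induct[where k = 0])
    case (step1 i)
    then show ?case using p1[of "t + of_int i"] by (simp add: add.assoc)
  next
    case (step2 i)
    have "t + of_int (i - 1) + 1 = t + of_int i" by simp
    then show ?case using step2 p1[of "t + of_int (i - 1)"] by simp
  qed simp
  show "strict_mono \<rho>"
    by (rule strict_monoI, rule DERIV_pos_imp_increasing) (use \<rho>' in blast)+
  show "surj \<rho>"
    unfolding surj_def
  proof
    fix y
    \<comment> \<open>The images of \<open>n\<close> and \<open>n + 1\<close> are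
      \<open>\<rho> 0 + n\<close> and \<open>\<rho> 0 + n + 1\<close>, which enclose
      \<open>y\<close>.\<close>
    define n where "n = \<lfloor>y - \<rho> 0\<rfloor>"
    have "\<rho> (of_int n) \<le> y" "y \<le> \<rho> (of_int (n + 1))"
      using shift[of 0 n] shift[of 0 "n + 1"] unfolding n_def by simp_all linarith+
    moreover have "continuous_on {of_int n..of_int (n + 1)} \<rho>"
      by (rule continuous_at_imp_continuous_on) (use \<rho>'(1) DERIV_isCont in blast)
    ultimately show "\<exists>x. y = \<rho> x"
      using IVT'[of \<rho> "of_int n" y "of_int (n + 1)"] by auto
  qed
qed

text \<open>\<open>Im (cnj v * w)\<close> is the determinant of the pair \<open>v, w\<close>; a
  real-linear map multiplies it by its own determinant, the first factor on the right.\<close>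

lemma det_of_real_linear:
  assumes "linear L"
  shows "Im (cnj (L v) * L w) = Im (cnj (L 1) * L \<i>) * Im (cnj v * w)"
proof -
  have L: "L z = Re z *\<^sub>R L 1 + Im z *\<^sub>R L \<i>" for z
  proof -
    have "z = Re z *\<^sub>R 1 + Im z *\<^sub>R \<i>" by (simp add: complex_eq_iff)
    then have "L z = L (Re z *\<^sub>R 1 + Im z *\<^sub>R \<i>)" by simp
    also have "\<dots> = Re z *\<^sub>R L 1 + Im z *\<^sub>R L \<i>"
      using assms by (simp add: linear_add linear_scale)
    finally show ?thesis .
  qed
  show ?thesis by (subst (1 2) L) (simp add: algebra_simps)
qed

text \<open>The determinant of the derivative is continuous in the time of the isotopy, equals 1 at
  time 0 and never vanishes, so it is positive at time 1. This makes crossing signs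
  invariant.\<close>

lemma ambient_isotopy_derivative:
  assumes "ambient_isotopy H"
  obtains L where "\<And>x. (H 1 has_derivative L x) (at x)" "\<And>x. Im (cnj (L x 1) * L x \<i>) > 0" "inj (H 1)"
proof -
  have H0: "H 0 = id" and bij: "\<And>\<tau>. \<tau> \<in> {0..1} \<Longrightarrow> bij (H \<tau>)"
    and ex: "\<exists>H'. (\<forall>\<tau>\<in>{0..1}. \<forall>x. (H \<tau> has_derivative H' \<tau> x) (at x) \<and> inj (H' \<tau> x)) \<and>
      (\<forall>v. continuous_on ({0..1} \<times> UNIV) (\<lambda>(\<tau>, x). H' \<tau> x v))"
    using assms unfolding ambient_isotopy_def by blast+
  from ex obtain H' where H'': "\<forall>\<tau>\<in>{0..1}. \<forall>x. (H \<tau> has_derivative H' \<tau> x) (at x) \<and> inj (H' \<tau> x)"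
    and cont: "\<forall>v. continuous_on ({0..1} \<times> UNIV) (\<lambda>(\<tau>, x). H' \<tau> x v)"
    by (elim exE conjE)
  have H': "\<And>\<tau> x. \<tau> \<in> {0..1} \<Longrightarrow> (H \<tau> has_derivative H' \<tau> x) (at x)"
      "\<And>\<tau> x. \<tau> \<in> {0..1} \<Longrightarrow> inj (H' \<tau> x)"
    using H'' by blast+
  have "Im (cnj (H' 1 x 1) * H' 1 x \<i>) > 0" for x
  proof -
    let ?d = "\<lambda>\<tau>. Im (cnj (H' \<tau> x 1) * H' \<tau> x \<i>)"
    have c: "continuous_on {0..1} (\<lambda>\<tau>. H' \<tau> x v)" for v
    proof -
      have "continuous_on {0..1} (\<lambda>\<tau>. (\<lambda>(\<tau>, x). H' \<tau> x v) (\<tau>, x))"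
        by (rule continuous_on_compose2[OF cont[rule_format, of v]]) (auto intro!: continuous_intros)
      then show ?thesis by simp
    qed
    have contd: "continuous_on {0..1} ?d"
      by (intro continuous_intros c)
    have nz: "?d \<tau> \<noteq> 0" if t: "\<tau> \<in> {0..1}" for \<tau>
    proof
      assume d0: "?d \<tau> = 0"
      have lin: "linear (H' \<tau> x)" using H'(1)[OF t] by (rule has_derivative_linear)
      let ?a = "H' \<tau> x 1" and ?b = "H' \<tau> x \<i>"
      have inj: "H' \<tau> x v = 0 \<Longrightarrow> v = 0" for v
        using H'(2)[OF t, of x] linear_injective_0[OF lin] by blast
      have a: "?a \<noteq> 0" using inj[of 1] by auto
      have im: "Im (cnj ?a * ?b) = 0" using d0 by simp
      \<comment> \<open>If the determinant vanishes, the images of 1 and \<open>\<i>\<close> are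
        parallel and this combination is mapped to 0, although its imaginary part is minus the
        square of a nonzero norm.\<close>
      let ?v = "complex_of_real (Re (cnj ?a * ?b)) * 1 - complex_of_real ((cmod ?a)\<^sup>2) * \<i>"
      have "H' \<tau> x ?v = Re (cnj ?a * ?b) *\<^sub>R ?a - ((cmod ?a)\<^sup>2) *\<^sub>R ?b"
      proof -
        have v: "?v = Re (cnj ?a * ?b) *\<^sub>R 1 - ((cmod ?a)\<^sup>2) *\<^sub>R \<i>" by (simp add: scaleR_conv_of_real)
        show ?thesis unfolding v using lin by (simp only: linear_diff linear_scale)
      qed
      also have "\<dots> = (cnj ?a * ?b) * ?a - (?a * cnj ?a) * ?b"
      proof -
        have "complex_of_real (Re (cnj ?a * ?b)) = cnj ?a * ?b" using im by (simp add: complex_eq_iff)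
        moreover have "complex_of_real ((cmod ?a)\<^sup>2) = ?a * cnj ?a" by (rule complex_norm_square)
        ultimately show ?thesis by (simp only: scaleR_conv_of_real)
      qed
      also have "\<dots> = 0" by (simp add: algebra_simps)
      finally have "?v = 0" by (rule inj)
      then have "Im ?v = 0" by simp
      then show False using a by simp
    qed
    have "(H 0 has_derivative (\<lambda>v. v)) (at x)" unfolding H0 by (simp add: id_def)
    moreover have "(H 0 has_derivative H' 0 x) (at x)" by (rule H'(1)) simp
    ultimately have "H' 0 x = (\<lambda>v. v)" by (metis has_derivative_unique)
    then have d0: "?d 0 > 0" by simp
    show ?thesis
    proof (rule ccontr)
      assume "\<not> ?thesis"
      then have "\<exists>\<tau>. 0 \<le> \<tau> \<and> \<tau> \<le> 1 \<and> ?d \<tau> = 0"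
        by (intro IVT2') (use d0 contd in auto)
      then show False using nz by auto
    qed
  qed
  moreover have "inj (H 1)" using bij[of 1] by (simp add: bij_is_inj)
  ultimately show ?thesis using that[of "H' 1"] H'(1)[of 1] by auto
qed

theorem alex_isotopy:
  assumes D: "virtual_diagram D" and D': "virtual_diagram D'" and "planar_isotopic D D'"
  shows "alex (gauss_of D') = alex (gauss_of D)"
proof -
  obtain H \<rho> where H: "ambient_isotopy H" and \<rho>: "circle_reparam \<rho>"
    and curve': "\<And>t. curve D' t = H 1 (curve D (\<rho> t))"
    and over': "\<And>t. t \<in> over_times D' \<longleftrightarrow> \<rho> t \<in> over_times D"
    using assms(3) unfolding planar_isotopic_def by blast
  obtain L where L: "\<And>x. (H 1 has_derivative L x) (at x)" "\<And>x. Im (cnj (L x 1) * L x \<i>) > 0"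
    and inj: "inj (H 1)" using ambient_isotopy_derivative[OF H] by blast
  obtain \<rho>' where \<rho>': "\<And>t. (\<rho> has_real_derivative \<rho>' t) (at t)" "\<And>t. \<rho>' t > 0"
    using \<rho> unfolding circle_reparam_def by blast
  note shift = circle_reparam_props(1)[OF \<rho>] and mono = circle_reparam_props(2)[OF \<rho>]
    and surj = circle_reparam_props(3)[OF \<rho>]
  have frac: "frac (\<rho> x) = frac (\<rho> y) \<longleftrightarrow> frac x = frac y" for x y
    unfolding frac_eq_iff using shift strict_mono_eq[OF mono] by metis
  have frac': "frac (\<rho> (frac x)) = frac (\<rho> x)" for x
    using frac[of "frac x" x] by simp
  have curve_eq: "curve D' x = curve D' y \<longleftrightarrow> curve D (\<rho> x) = curve D (\<rho> y)" for x y
    using inj by (simp add: curve' inj_eq)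
  have classical': "x \<in> classical_times D' \<longleftrightarrow> \<rho> x \<in> classical_times D" for x
    unfolding classical_times_def using curve_eq over' surj by (simp add: Bex_def) (metis surj_def)
  have cr: "crossing D' x y \<longleftrightarrow> crossing D (\<rho> x) (\<rho> y)" for x y
    by (simp add: crossing_def curve_eq frac classical')
  have tangent': "tangent D' t = \<rho>' t *\<^sub>R L (curve D (\<rho> t)) (tangent D (\<rho> t))" for t
  proof -
    have 1: "(curve D \<circ> \<rho> has_vector_derivative \<rho>' t *\<^sub>R tangent D (\<rho> t)) (at t)"
      using \<rho>'(1)[of t] by (intro vector_diff_chain_at curve_has_derivative[OF D])
        (simp add: has_real_derivative_iff_has_vector_derivative)
    have "(H 1 has_derivative L (curve D (\<rho> t))) (at ((curve D \<circ> \<rho>) t) within range (curve D \<circ> \<rho>))"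
      using L(1)[of "curve D (\<rho> t)"] by (simp add: has_derivative_at_withinI)
    then have "(H 1 \<circ> (curve D \<circ> \<rho>) has_vector_derivative L (curve D (\<rho> t)) (\<rho>' t *\<^sub>R tangent D (\<rho> t))) (at t)"
      using vector_derivative_diff_chain_within[OF 1, of "H 1"] by simp
    moreover have "H 1 \<circ> (curve D \<circ> \<rho>) = curve D'" by (auto simp: curve')
    moreover have "L (curve D (\<rho> t)) (\<rho>' t *\<^sub>R tangent D (\<rho> t)) = \<rho>' t *\<^sub>R L (curve D (\<rho> t)) (tangent D (\<rho> t))"
      using L(1) has_derivative_linear linear_scale by blast
    ultimately show ?thesis unfolding tangent_def by (simp add: vector_derivative_at)
  qed
  have sign': "sign_at D' x y = sign_at D (\<rho> x) (\<rho> y)" if "crossing D' x y" for x y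
  proof -
    let ?c = "curve D (\<rho> x)"
    have c: "curve D (\<rho> y) = ?c" using that curve_eq by (simp add: crossing_def)
    have "Im (cnj (tangent D' x) * tangent D' y) =
      \<rho>' x * \<rho>' y * Im (cnj (L ?c (tangent D (\<rho> x))) * L ?c (tangent D (\<rho> y)))"
      by (simp add: tangent' c algebra_simps)
    also have "\<dots> = (\<rho>' x * \<rho>' y * Im (cnj (L ?c 1) * L ?c \<i>)) * Im (cnj (tangent D (\<rho> x)) * tangent D (\<rho> y))"
      by (subst det_of_real_linear) (use L(1) has_derivative_linear in auto)
    finally have "Im (cnj (tangent D' x) * tangent D' y) =
      (\<rho>' x * \<rho>' y * Im (cnj (L ?c 1) * L ?c \<i>)) * Im (cnj (tangent D (\<rho> x)) * tangent D (\<rho> y))" .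
    moreover have "\<rho>' x * \<rho>' y * Im (cnj (L ?c 1) * L ?c \<i>) > 0" using L(2) \<rho>'(2) by simp
    ultimately have "0 < Im (cnj (tangent D' x) * tangent D' y) \<longleftrightarrow>
      0 < Im (cnj (tangent D (\<rho> x)) * tangent D (\<rho> y))"
      by (metis zero_less_mult_pos mult_pos_pos)
    then show ?thesis by (simp only: sign_at_def)
  qed
  have "alex (gauss_of D) = alex (gauss_of D')"
  \<comment> \<open>The curve of \<open>D'\<close> at time \<open>t\<close> comes from that of
    \<open>D\<close> at time \<open>\<rho> t\<close>, so passages are transported from
    \<open>D'\<close> to \<open>D\<close>.\<close>
  proof (rule alex_transport[OF wf_gauss_of[OF D'] wf_gauss_of[OF D], where \<phi> = \<rho>])
    show "transports \<rho> (gC (gauss_of D')) (gC (gauss_of D))"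
      unfolding transports_def
    proof (intro conjI allI impI)
      fix x assume "frac x \<in> gC (gauss_of D')"
      then obtain z where "crossing D' x z" unfolding gC_frac[OF D'] ..
      then have "crossing D (\<rho> x) (\<rho> z)" unfolding cr .
      then show "frac (\<rho> x) \<in> gC (gauss_of D)" unfolding gC_frac[OF D] ..
    next
      fix y assume y: "frac y \<in> gC (gauss_of D)"
      then obtain z where z: "crossing D y z" unfolding gC_frac[OF D] ..
      obtain x w where x: "y = \<rho> x" "z = \<rho> w" using surj by (metis surj_def)
      then have "crossing D' x w" using z by (simp only: cr)
      then have "frac x \<in> gC (gauss_of D')" unfolding gC_frac[OF D'] ..
      then show "\<exists>x. frac x \<in> gC (gauss_of D') \<and> \<rho> x = y" using x by blast
    next
      fix x y :: real assume "x < y"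
      then show "\<rho> x < \<rho> y" by (rule strict_monoD[OF mono])
    next
      fix x and n :: int
      show "\<rho> (x + of_int n) = \<rho> x + of_int n" by (rule shift)
    qed
    fix k assume "k \<in> gC (gauss_of D')"
    then obtain y where k: "frac k = k" and y: "crossing D' k y" unfolding gC_crossing[OF D'] by (elim conjE exE)
    have y': "crossing D (\<rho> k) (\<rho> y)" using y by (simp only: cr)
    show "gM (gauss_of D) (frac (\<rho> k)) = frac (\<rho> (gM (gauss_of D') k))"
      using crossing_mate[OF D y'] crossing_mate[OF D' y] k frac' by simp
    show "gS (gauss_of D) (frac (\<rho> k)) = gS (gauss_of D') k"
      using crossing_sign[OF D y'] crossing_sign[OF D' y] k over'[of k] sign'[OF y]
        sign'[OF crossing_sym[OF y]] by (simp del: gauss_of_simps)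
    show "frac (\<rho> k) \<in> gO (gauss_of D) \<longleftrightarrow> k \<in> gO (gauss_of D')"
      using over' k over_frac[OF D] frac_in_unit[of "\<rho> k"] frac_in_unit[of k] by simp
  qed
  then show ?thesis by simp
qed

subsection \<open>Local changes\<close>

text \<open>The interval is closed, unlike the one in \<open>agree_off\<close>, so these times form
  an open set. Agreement of the curves there yields agreement of the tangents.\<close>

definition off :: "real \<Rightarrow> real \<Rightarrow> real \<Rightarrow> bool" where
  "off a b t \<longleftrightarrow> (\<forall>k::int. t + of_int k \<notin> {a..b})"

lemma not_offE:
  assumes "\<not> off a b t"
  obtains t' where "frac t' = frac t" "a \<le> t'" "t' \<le> b"
proof -
  obtain k :: int where "t + of_int k \<in> {a..b}" using assms unfolding off_def by blast
  then show ?thesis using that[of "t + of_int k"] by simp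
qed

lemma off_not_in: "off a b t \<Longrightarrow> frac t' = frac t \<Longrightarrow> \<not> (a \<le> t' \<and> t' \<le> b)"
  unfolding off_def frac_eq_iff by force

lemma agree_off_sym: "agree_off D D' a b \<Longrightarrow> agree_off D' D a b"
  unfolding agree_off_def by auto

lemma agree_off_eq:
  assumes "agree_off D D' a b" "off a b t"
  shows "curve D' t = curve D t" "t \<in> over_times D' \<longleftrightarrow> t \<in> over_times D"
proof -
  have "\<nexists>k::int. t + of_int k \<in> {a<..<b}"
    using assms(2) unfolding off_def by (metis atLeastAtMost_iff greaterThanLessThan_iff order_less_imp_le)
  then show "curve D' t = curve D t" "t \<in> over_times D' \<longleftrightarrow> t \<in> over_times D"
    using assms(1) unfolding agree_off_def by blast+
qed

lemma agree_off_ends: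
  assumes "agree_off D D' a b" "a < b" "b < a + 1"
  shows "curve D' a = curve D a" "curve D' b = curve D b"
proof -
  have "\<nexists>k::int. a + of_int k \<in> {a<..<b}"
  proof
    assume "\<exists>k::int. a + of_int k \<in> {a<..<b}"
    then obtain k :: int where "a < a + of_int k" "a + of_int k < b" by auto
    then have "0 < real_of_int k" "real_of_int k < 1" using assms by linarith+
    then show False by simp
  qed
  then show "curve D' a = curve D a" using assms(1) unfolding agree_off_def by blast
  have "\<nexists>k::int. b + of_int k \<in> {a<..<b}"
  proof
    assume "\<exists>k::int. b + of_int k \<in> {a<..<b}"
    then obtain k :: int where "a < b + of_int k" "b + of_int k < b" by auto
    then have "- 1 < real_of_int k" "real_of_int k < 0" using assms by linarith+
    then show False by simp
  qed
  then show "curve D' b = curve D b" using assms(1) unfolding agree_off_def by blast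
qed

lemma tangent_agree:
  assumes D: "virtual_diagram D" and agree: "agree_off D D' a b" and ab: "a < b" "b < a + 1"
    and off: "off a b t"
  shows "tangent D' t = tangent D t"
proof -
  \<comment> \<open>Moves \<open>t\<close> into the period that starts at \<open>a\<close>; being
    off the strand, it then lies strictly between \<open>b\<close> and \<open>a + 1\<close>.\<close>
  define n where "n = - \<lfloor>t - a\<rfloor>"
  have "a \<le> t + of_int n" "t + of_int n < a + 1" unfolding n_def by linarith+
  moreover have "\<not> (a \<le> t + of_int n \<and> t + of_int n \<le> b)" using off unfolding off_def by auto
  ultimately have t: "b < t + of_int n" "t + of_int n < a + 1" by auto
  let ?U = "{b - of_int n<..<a + 1 - of_int n}"
  have "curve D x = curve D' x" if x: "x \<in> ?U" for x
  proof -
    have "\<nexists>k::int. x + of_int k \<in> {a<..<b}"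
    proof
      assume "\<exists>k::int. x + of_int k \<in> {a<..<b}"
      then obtain k :: int where k: "a < x + of_int k" "x + of_int k < b" by auto
      have "real_of_int k < of_int n" "real_of_int (n - 1) < of_int k" using k x ab by auto
      then show False by (simp only: of_int_less_iff)
    qed
    then show ?thesis using agree unfolding agree_off_def by metis
  qed
  then have "(curve D' has_vector_derivative tangent D t) (at t)"
    by (intro has_vector_derivative_transform_within_open[OF curve_has_derivative[OF D], of ?U])
      (use t in auto)
  then show ?thesis by (simp add: tangent_def vector_derivative_at)
qed

lemma crossing_agree:
  assumes D: "virtual_diagram D" "virtual_diagram D'" and agree: "agree_off D D' a b"
    and ab: "a < b" "b < a + 1" and c: "crossing D x y" and off: "off a b x" "off a b y"
  shows "crossing D' x y" "x \<in> over_times D' \<longleftrightarrow> x \<in> over_times D"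
    "y \<in> over_times D' \<longleftrightarrow> y \<in> over_times D"
    "sign_at D' x y = sign_at D x y" "sign_at D' y x = sign_at D y x"
proof -
  note x = agree_off_eq[OF agree off(1)] and y = agree_off_eq[OF agree off(2)]
  show "x \<in> over_times D' \<longleftrightarrow> x \<in> over_times D" "y \<in> over_times D' \<longleftrightarrow> y \<in> over_times D"
    using x y by auto
  show "crossing D' x y"
    by (rule crossingI[OF D(2)]) (use c x y crossing_over[OF D(1) c] in \<open>auto simp: crossing_def\<close>)
  show "sign_at D' x y = sign_at D x y" "sign_at D' y x = sign_at D y x"
    using tangent_agree[OF D(1) agree ab] off by (simp_all add: sign_at_def)
qed

lemma gauss_agree:
  assumes D: "virtual_diagram D" "virtual_diagram D'" and agree: "agree_off D D' a b"
    and ab: "a < b" "b < a + 1" and k: "k \<in> gC (gauss_of D)"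
    and off: "\<And>y. crossing D k y \<Longrightarrow> off a b k \<and> off a b y"
  shows "k \<in> gC (gauss_of D')" "gM (gauss_of D') k = gM (gauss_of D) k \<and>
    gS (gauss_of D') k = gS (gauss_of D) k \<and> (k \<in> gO (gauss_of D') \<longleftrightarrow> k \<in> gO (gauss_of D))"
proof -
  obtain y where fk: "frac k = k" and y: "crossing D k y" using k unfolding gC_crossing[OF D(1)] by blast
  note o = off[OF y, THEN conjunct1] off[OF y, THEN conjunct2]
  note c = crossing_agree[OF D agree ab y o]
  show "k \<in> gC (gauss_of D')" using c(1) fk gC_crossing[OF D(2)] by blast
  show "gM (gauss_of D') k = gM (gauss_of D) k \<and>
    gS (gauss_of D') k = gS (gauss_of D) k \<and> (k \<in> gO (gauss_of D') \<longleftrightarrow> k \<in> gO (gauss_of D))"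
    using crossing_mate[OF D(1) y] crossing_mate[OF D(2) c(1)] c(2-5) fk
      crossing_sign[OF D(1) y] crossing_sign[OF D(2) c(1)] by (simp del: gauss_of_simps(4))
qed

text \<open>Made for the virtual moves, where the moving strand takes part in no classical crossing
  on either side.\<close>

lemma alex_local_eq:
  assumes D: "virtual_diagram D" "virtual_diagram D'" and agree: "agree_off D D' a b"
    and ab: "a < b" "b < a + 1"
    and off: "\<And>x y. crossing D x y \<Longrightarrow> off a b x" and off': "\<And>x y. crossing D' x y \<Longrightarrow> off a b x"
  shows "alex (gauss_of D') = alex (gauss_of D)"
proof (rule alex_eq_of_crossings[OF D])
  note c = crossing_agree[OF D agree ab]
    and c' = crossing_agree[OF D(2) D(1) agree_off_sym[OF agree] ab]
  have o: "off a b x \<and> off a b y" if "crossing D x y" for x y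
    using off[OF that] off[OF crossing_sym[OF that]] by simp
  have o': "off a b x \<and> off a b y" if "crossing D' x y" for x y
    using off'[OF that] off'[OF crossing_sym[OF that]] by simp
  fix x y
  show "crossing D x y \<longleftrightarrow> crossing D' x y" using c(1)[of x y] c'(1)[of x y] o[of x y] o'[of x y] by blast
  assume x: "crossing D x y"
  then show "x \<in> over_times D' \<longleftrightarrow> x \<in> over_times D" "sign_at D' x y = sign_at D x y"
    using c(2,4)[OF x] o[OF x] by simp_all
qed

lemma crossing_cong:
  assumes D: "virtual_diagram D" and "frac x = frac x'" "frac y = frac y'"
  shows "crossing D x y \<longleftrightarrow> crossing D x' y'"
  using crossing_frac1[OF D] crossing_frac2[OF D] assms(2,3) by metis

lemma disc_strandsD:
  assumes "disc_strands D c r S"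
  shows "r > 0"
    and "(a, b) \<in> S \<Longrightarrow> a < b \<and> b < a + 1 \<and> curve D a \<in> sphere c r \<and> curve D b \<in> sphere c r"
    and "(a, b) \<in> S \<Longrightarrow> a < t \<Longrightarrow> t < b \<Longrightarrow> curve D t \<in> ball c r"
    and "(a, b) \<in> S \<Longrightarrow> a \<le> t \<Longrightarrow> t \<le> b \<Longrightarrow> curve D t \<in> cball c r"
    and "curve D t \<in> cball c r \<Longrightarrow> \<exists>(a, b)\<in>S. \<exists>t'. frac t' = frac t \<and> a \<le> t' \<and> t' \<le> b"
proof -
  show "r > 0" using assms by (simp add: disc_strands_def)
  have all: "\<forall>(a, b)\<in>S. a < b \<and> b < a + 1 \<and> curve D a \<in> sphere c r \<and> curve D b \<in> sphere c r \<and>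
        curve D ` {a<..<b} \<subseteq> ball c r"
    and iff: "\<And>t. curve D t \<in> cball c r \<longleftrightarrow> (\<exists>(a, b)\<in>S. \<exists>k::int. t + of_int k \<in> {a..b})"
    using assms unfolding disc_strands_def by blast+
  show "(a, b) \<in> S \<Longrightarrow> a < b \<and> b < a + 1 \<and> curve D a \<in> sphere c r \<and> curve D b \<in> sphere c r"
    using all by blast
  show "curve D t \<in> ball c r" if "(a, b) \<in> S" "a < t" "t < b"
  proof -
    have "curve D ` {a<..<b} \<subseteq> ball c r" using all that(1) by blast
    then show ?thesis using that by (meson greaterThanLessThan_iff image_subset_iff)
  qed
  show "curve D t \<in> cball c r" if ab: "(a, b) \<in> S" "a \<le> t" "t \<le> b"
  proof -
    have "t + of_int 0 \<in> {a..b}" using ab by simp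
    then show ?thesis using iff ab(1) by blast
  qed
  assume "curve D t \<in> cball c r"
  then obtain a b and k :: int where "(a, b) \<in> S" "t + of_int k \<in> {a..b}" using iff by blast
  then show "\<exists>(a, b)\<in>S. \<exists>t'. frac t' = frac t \<and> a \<le> t' \<and> t' \<le> b"
    by (auto intro!: bexI[of _ "(a, b)"] exI[of _ "t + of_int k"])
qed

subsection \<open>First moves\<close>

text \<open>The disc contains a single strand, so a crossing on it is a crossing of the strand with
  itself: none in \<open>D\<close>, where it is embedded, and at most the one at \<open>s\<close>
  and \<open>t\<close> in \<open>D'\<close>.\<close>

lemma adds_kink_crossings:
  assumes D: "virtual_diagram D" "virtual_diagram D'" and kink: "adds_kink D D' s t"
  obtains a b where "a < b" "b < a + 1" "agree_off D D' a b" "a < s" "s < t" "t < b"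
    "curve D' s = curve D' t"
    "\<And>x y. crossing D x y \<Longrightarrow> off a b x"
    "\<And>x y. crossing D' x y \<Longrightarrow> off a b x \<and> off a b y \<or>
      frac x = frac s \<and> frac y = frac t \<or> frac x = frac t \<and> frac y = frac s"
proof -
  obtain c r a b where disc: "disc_strands D c r {(a, b)}" and disc': "disc_strands D' c r {(a, b)}"
    and agree: "agree_off D D' a b" and inj: "inj_on (curve D) {a..b}"
    and pairs: "{(x, y). x \<in> {a..b} \<and> y \<in> {a..b} \<and> x < y \<and> curve D' x = curve D' y} = {(s, t)}"
    using kink unfolding adds_kink_def by blast
  have ab: "a < b" "b < a + 1" using disc_strandsD(2)[OF disc, of a b] by auto
  have st: "a \<le> s" "s < t" "t \<le> b" "curve D' s = curve D' t" using pairs by auto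
  have only: "x = s \<and> y = t" if "a \<le> x" "x < y" "y \<le> b" "curve D' x = curve D' y" for x y
  proof -
    have "(x, y) \<in> {(x, y). x \<in> {a..b} \<and> y \<in> {a..b} \<and> x < y \<and> curve D' x = curve D' y}" using that by auto
    then show ?thesis unfolding pairs by simp
  qed
  note ends = agree_off_ends[OF agree ab]
  have ab': "curve D' a \<noteq> curve D' b" using ends ab inj_onD[OF inj, of a b] by auto
  have sph: "curve D' a \<notin> ball c r" "curve D' b \<notin> ball c r"
    using disc_strandsD(2)[OF disc', of a b] by auto
  \<comment> \<open>If \<open>s\<close> were the end \<open>a\<close>, the point at time
    \<open>t\<close> would lie on the boundary circle, so \<open>t\<close> would be the end
    \<open>b\<close>; but the two ends are different points.\<close>
  have sa: "a < s"
  proof (rule ccontr)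
    assume "\<not> a < s"
    then have "s = a" using st by simp
    then show False using st ab' sph(1) disc_strandsD(3)[OF disc', of a b t] by (cases "t = b") auto
  qed
  have tb: "t < b"
  proof (rule ccontr)
    assume "\<not> t < b"
    then have "t = b" using st by simp
    then show False using st sa sph(2) disc_strandsD(3)[OF disc', of a b s] by auto
  qed
  have lift: "\<exists>x'. frac x' = frac x \<and> a \<le> x' \<and> x' \<le> b"
    if "disc_strands E c r {(a, b)}" "curve E x \<in> cball c r" for E x
    using disc_strandsD(5)[OF that] by simp
  have both: "\<exists>x' y'. frac x' = frac x \<and> a \<le> x' \<and> x' \<le> b \<and> frac y' = frac y \<and> a \<le> y' \<and> y' \<le> b \<and>
      curve E x' = curve E y' \<and> x' \<noteq> y'"
    if E: "virtual_diagram E" "disc_strands E c r {(a, b)}" and xy: "crossing E x y" and o: "\<not> off a b x" for E x y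
  proof -
    obtain x' where x': "frac x' = frac x" "a \<le> x'" "x' \<le> b" using not_offE[OF o] .
    have "curve E x' \<in> cball c r" using disc_strandsD(4)[OF E(2)] x' by simp
    then have "curve E y \<in> cball c r"
      using xy curve_cong_frac[OF E(1) x'(1)] by (simp add: crossing_def)
    then obtain y' where y': "frac y' = frac y" "a \<le> y'" "y' \<le> b" using lift[OF E(2)] by blast
    have "curve E x' = curve E y'"
      using xy curve_cong_frac[OF E(1) x'(1)] curve_cong_frac[OF E(1) y'(1)] by (simp add: crossing_def)
    moreover have "x' \<noteq> y'" using xy x' y' by (auto simp: crossing_def)
    ultimately show ?thesis using x' y' by blast
  qed
  show ?thesis
  proof (rule that[OF ab agree sa st(2) tb st(4)])
    fix x y assume c: "crossing D x y"
    show "off a b x"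
    proof (rule ccontr)
      assume "\<not> off a b x"
      then obtain x' y' where "a \<le> x'" "x' \<le> b" "a \<le> y'" "y' \<le> b" "curve D x' = curve D y'" "x' \<noteq> y'"
        using both[OF D(1) disc c] by blast
      then show False using inj by (auto simp: inj_on_def)
    qed
  next
    have pair: "frac x = frac s \<and> frac y = frac t \<or> frac x = frac t \<and> frac y = frac s"
      if c: "crossing D' x y" and o: "\<not> off a b x" for x y
    proof -
      obtain x' y' where xy': "frac x' = frac x" "a \<le> x'" "x' \<le> b" "frac y' = frac y" "a \<le> y'" "y' \<le> b"
        "curve D' x' = curve D' y'" "x' \<noteq> y'"
        using both[OF D(2) disc' c o] by blast
      then have "x' = s \<and> y' = t \<or> y' = s \<and> x' = t"
        using only[of x' y'] only[of y' x'] by (cases "x' < y'") auto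
      then show ?thesis using xy' by auto
    qed
    fix x y assume c: "crossing D' x y"
    show "off a b x \<and> off a b y \<or> frac x = frac s \<and> frac y = frac t \<or> frac x = frac t \<and> frac y = frac s"
      using pair[OF c] pair[OF crossing_sym[OF c]] by blast
  qed
qed

theorem alex_virtual1:
  assumes D: "virtual_diagram D" "virtual_diagram D'" and kink: "adds_kink D D' s t"
    and virt: "{s, t} \<inter> classical_times D' = {}"
  shows "alex (gauss_of D') = alex (gauss_of D)"
proof -
  obtain a b where ab: "a < b" "b < a + 1" "agree_off D D' a b"
    and N1: "\<And>x y. crossing D x y \<Longrightarrow> off a b x"
    and N2: "\<And>x y. crossing D' x y \<Longrightarrow> off a b x \<and> off a b y \<or>
      frac x = frac s \<and> frac y = frac t \<or> frac x = frac t \<and> frac y = frac s"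
    using adds_kink_crossings[OF D kink] by metis
  have "off a b x" if c: "crossing D' x y" for x y
  proof -
    have "frac x \<in> classical_times D'" using c classical_frac[OF D(2)] by (simp add: crossing_def)
    moreover have "frac s \<notin> classical_times D'" "frac t \<notin> classical_times D'"
      using virt classical_frac[OF D(2)] by auto
    ultimately show ?thesis using N2[OF c] by auto
  qed
  then show ?thesis using alex_local_eq[OF D ab(3,1,2)] N1 by blast
qed

theorem alex_reidemeister1:
  assumes D: "virtual_diagram D" "virtual_diagram D'" and kink: "adds_kink D D' s t"
    and over: "s \<in> over_times D' \<or> t \<in> over_times D'"
  shows "unit_equiv (alex (gauss_of D')) (alex (gauss_of D))"
proof -
  obtain a b where ab: "a < b" "b < a + 1" "agree_off D D' a b" and st: "a < s" "s < t" "t < b"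
    "curve D' s = curve D' t"
    and N1: "\<And>x y. crossing D x y \<Longrightarrow> off a b x"
    and N2: "\<And>x y. crossing D' x y \<Longrightarrow> off a b x \<and> off a b y \<or>
      frac x = frac s \<and> frac y = frac t \<or> frac x = frac t \<and> frac y = frac s"
    using adds_kink_crossings[OF D kink] by metis
  have t1: "t < s + 1" using st ab by simp
  have cst: "crossing D' s t"
    by (rule crossingI[OF D(2) st(4) frac_neq[OF st(2) t1] over])
  note w = wf_gauss_of[OF D(1)] wf_gauss_of[OF D(2)]
  have N1': "off a b x \<and> off a b y" if "crossing D x y" for x y
    using N1[OF that] N1[OF crossing_sym[OF that]] by simp
  note same = gauss_agree[OF D ab(3,1,2) _ N1']
  have "\<exists>\<epsilon>. alex (gauss_of D') = mono3 \<epsilon> \<epsilon> 0 * alex (gauss_of D)"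
  proof (rule alex_kink[OF w st(2) t1])
    fix x assume x: "s \<le> x" "x \<le> t"
    show "frac x \<notin> gC (gauss_of D)"
    proof
      assume "frac x \<in> gC (gauss_of D)"
      then obtain y where "crossing D x y" using gC_frac[OF D(1)] by blast
      then have "off a b x" by (rule N1)
      then show False using off_not_in[of a b x x] x st by auto
    qed
  next
    show "gC (gauss_of D') = gC (gauss_of D) \<union> {frac s, frac t}"
    proof (intro equalityI subsetI)
      fix k assume k: "k \<in> gC (gauss_of D')"
      then obtain y where fk: "frac k = k" and c: "crossing D' k y" unfolding gC_crossing[OF D(2)] by blast
      show "k \<in> gC (gauss_of D) \<union> {frac s, frac t}"
      proof (cases "off a b k \<and> off a b y")
        case True
        then have "crossing D k y"
          using crossing_agree(1)[OF D(2) D(1) agree_off_sym[OF ab(3)] ab(1,2) c] by blast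
        then show ?thesis using fk gC_crossing[OF D(1)] by blast
      next
        case False
        then show ?thesis using N2[OF c] fk by auto
      qed
    next
      fix k assume "k \<in> gC (gauss_of D) \<union> {frac s, frac t}"
      moreover have "frac s \<in> gC (gauss_of D')" "frac t \<in> gC (gauss_of D')"
        using cst crossing_sym[OF cst] gC_frac[OF D(2)] by blast+
      ultimately show "k \<in> gC (gauss_of D')" using same(1) by blast
    qed
  next
    show "gM (gauss_of D') (frac s) = frac t" using crossing_mate[OF D(2) cst] by simp
  qed (use same(2) in blast)
  then show ?thesis using unit_equiv_mono by metis
qed

subsection \<open>Functions with simple zeros\<close>

lemma positive_before_zero:
  fixes f :: "real \<Rightarrow> real"
  assumes "continuous_on {a..b} f" "p \<le> b" "f a > 0" "\<And>t. a \<le> t \<Longrightarrow> t < p \<Longrightarrow> f t \<noteq> 0" "a \<le> t" "t < p"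
  shows "f t > 0"
proof (rule ccontr)
  assume "\<not> f t > 0"
  moreover have "continuous_on {a..t} f" using assms by (auto intro: continuous_on_subset)
  ultimately obtain x where "a \<le> x" "x \<le> t" "f x = 0"
    using IVT2'[of f t 0 a] assms by auto
  then show False using assms(4)[of x] assms(6) by auto
qed

lemma positive_after_zero:
  fixes f :: "real \<Rightarrow> real"
  assumes "continuous_on {a..b} f" "a \<le> p" "f b > 0" "\<And>t. p < t \<Longrightarrow> t \<le> b \<Longrightarrow> f t \<noteq> 0" "p < t" "t \<le> b"
  shows "f t > 0"
proof (rule ccontr)
  assume "\<not> f t > 0"
  moreover have "continuous_on {t..b} f" using assms by (auto intro: continuous_on_subset)
  ultimately obtain x where "t \<le> x" "x \<le> b" "f x = 0"
    using IVT'[of f t 0 b] assms by auto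
  then show False using assms(4)[of x] assms(5) by auto
qed

lemma derivative_neg_of_positive_before:
  fixes f :: "real \<Rightarrow> real"
  assumes d: "(f has_real_derivative d) (at p)" "d \<noteq> 0" and p: "f p = 0" "a < p"
    and pos: "\<And>t. a \<le> t \<Longrightarrow> t < p \<Longrightarrow> f t > 0"
  shows "d < 0"
proof (rule ccontr)
  assume "\<not> d < 0"
  then have "d > 0" using d by simp
  then obtain e where e: "e > 0" "\<forall>h>0. h < e \<longrightarrow> f (p - h) < f p"
    using DERIV_pos_inc_left[OF d(1)] by blast
  define h where "h = min (e / 2) (p - a)"
  have "h > 0" "h < e" "h \<le> p - a" using e p by (auto simp: h_def)
  then show False using e(2) pos[of "p - h"] p by force
qed

lemma derivative_pos_of_positive_after:
  fixes f :: "real \<Rightarrow> real"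
  assumes d: "(f has_real_derivative d) (at p)" "d \<noteq> 0" and p: "f p = 0" "p < b"
    and pos: "\<And>t. p < t \<Longrightarrow> t \<le> b \<Longrightarrow> f t > 0"
  shows "d > 0"
proof (rule ccontr)
  assume "\<not> d > 0"
  then have "d < 0" using d by simp
  then obtain e where e: "e > 0" "\<forall>h>0. h < e \<longrightarrow> f p > f (p + h)"
    using DERIV_neg_dec_right[OF d(1)] by blast
  define h where "h = min (e / 2) (b - p)"
  have "h > 0" "h < e" "h \<le> b - p" using e p by (auto simp: h_def)
  then show False using e(2) pos[of "p + h"] p by force
qed

text \<open>Positive values before a simple zero force a negative derivative. A positive value later
  on would make the function positive right after the zero and force a positive derivative
  there.\<close>

lemma single_zero_aux:
  fixes f :: "real \<Rightarrow> real"
  assumes cont: "continuous_on {a..b} f" and p: "a < p" "p < b"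
    and d: "(f has_real_derivative d) (at p)" "d \<noteq> 0"
    and zero: "{t \<in> {a..b}. f t = 0} = {p}" and fa: "f a > 0"
  shows "d < 0" "\<And>t. a \<le> t \<Longrightarrow> t < p \<Longrightarrow> f t > 0" "\<And>t. p < t \<Longrightarrow> t \<le> b \<Longrightarrow> f t < 0"
proof -
  have nz: "f t \<noteq> 0" if "a \<le> t" "t \<le> b" "t \<noteq> p" for t using zero that by auto
  have fp: "f p = 0" using zero by auto
  show pos: "f t > 0" if "a \<le> t" "t < p" for t
    by (rule positive_before_zero[OF cont _ fa _ that]) (use p nz in auto)
  show dneg: "d < 0"
    by (rule derivative_neg_of_positive_before[OF d fp p(1) pos])
  show "f t < 0" if t: "p < t" "t \<le> b" for t
  proof (rule ccontr)
    assume "\<not> f t < 0"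
    then have ft: "f t > 0" using nz[of t] t p by auto
    have cont': "continuous_on {p..t} f" using cont by (rule continuous_on_subset) (use t p in auto)
    have "d > 0"
    proof (rule derivative_pos_of_positive_after[OF d fp t(1)])
      fix x assume x: "p < x" "x \<le> t"
      show "f x > 0"
        by (rule positive_after_zero[OF cont' _ ft _ x]) (use p t nz in auto)
    qed
    then show False using dneg by simp
  qed
qed

text \<open>All signs are expressed by the one at the left end, passing to \<open>- f\<close> if
  necessary. In a third move this end of the moving strand is common to both diagrams.\<close>

lemma single_zero:
  fixes f :: "real \<Rightarrow> real"
  assumes cont: "continuous_on {a..b} f" and p: "a < p" "p < b"
    and d: "(f has_real_derivative d) (at p)" "d \<noteq> 0"
    and zero: "{t \<in> {a..b}. f t = 0} = {p}"
  shows "d < 0 \<longleftrightarrow> f a > 0" "\<And>t. a \<le> t \<Longrightarrow> t < p \<Longrightarrow> f t > 0 \<longleftrightarrow> f a > 0"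
    "\<And>t. p < t \<Longrightarrow> t \<le> b \<Longrightarrow> f t > 0 \<longleftrightarrow> f a < 0" "f a \<noteq> 0"
proof -
  have fa: "f a \<noteq> 0" using zero p by (metis (mono_tags, lifting) atLeastAtMost_iff less_eq_real_def mem_Collect_eq
      order_less_trans singletonD order_less_irrefl)
  show "f a \<noteq> 0" by (rule fa)
  let ?g = "\<lambda>t. - f t"
  have g: "continuous_on {a..b} ?g" "(?g has_real_derivative - d) (at p)" "- d \<noteq> 0" "{t \<in> {a..b}. ?g t = 0} = {p}"
    using cont d zero by (auto intro!: continuous_intros derivative_eq_intros)
  note P = single_zero_aux[OF cont p d zero] and N = single_zero_aux[OF g(1) p g(2-4)]
  show "d < 0 \<longleftrightarrow> f a > 0" using P(1) N(1) fa by (cases "f a > 0") auto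
  show "f t > 0 \<longleftrightarrow> f a > 0" if "a \<le> t" "t < p" for t
    using P(2)[OF _ that] N(2)[OF _ that] fa by (cases "f a > 0") auto
  show "f t > 0 \<longleftrightarrow> f a < 0" if "p < t" "t \<le> b" for t
    using P(3)[OF _ that] N(3)[OF _ that] fa by (cases "f a > 0") auto
qed

lemma two_zeros_aux:
  fixes f :: "real \<Rightarrow> real"
  assumes cont: "continuous_on {a..b} f" and pq: "a < p" "p < q" "q < b"
    and dp: "(f has_real_derivative dp) (at p)" "dp \<noteq> 0" and dq: "(f has_real_derivative dq) (at q)" "dq \<noteq> 0"
    and zero: "{t \<in> {a..b}. f t = 0} = {p, q}" and f: "f a > 0" "f b > 0"
  shows "dp < 0 \<and> dq > 0"
proof
  have nz: "f t \<noteq> 0" if "a \<le> t" "t \<le> b" "t \<noteq> p" "t \<noteq> q" for t using zero that by auto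
  have z: "f p = 0" "f q = 0" using zero by auto
  show "dp < 0"
    by (rule derivative_neg_of_positive_before[OF dp z(1) pq(1)])
       (rule positive_before_zero[OF cont _ f(1)], use pq nz in auto)
  show "dq > 0"
    by (rule derivative_pos_of_positive_after[OF dq z(2) pq(3)])
       (rule positive_after_zero[OF cont _ f(2)], use pq nz in auto)
qed

text \<open>With equal signs at its ends, the function leaves its half-line through one simple zero
  and returns through the other.\<close>

lemma two_zeros:
  fixes f :: "real \<Rightarrow> real"
  assumes cont: "continuous_on {a..b} f" and pq: "a < p" "p < q" "q < b"
    and dp: "(f has_real_derivative dp) (at p)" "dp \<noteq> 0" and dq: "(f has_real_derivative dq) (at q)" "dq \<noteq> 0"
    and zero: "{t \<in> {a..b}. f t = 0} = {p, q}" and f: "f a * f b > 0"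
  shows "dp < 0 \<longleftrightarrow> dq > 0"
proof (cases "f a > 0")
  case True
  then show ?thesis using two_zeros_aux[OF cont pq dp dq zero True] f by (simp add: zero_less_mult_iff)
next
  case False
  let ?g = "\<lambda>t. - f t"
  have g: "continuous_on {a..b} ?g" "(?g has_real_derivative - dp) (at p)" "- dp \<noteq> 0"
    "(?g has_real_derivative - dq) (at q)" "- dq \<noteq> 0" "{t \<in> {a..b}. ?g t = 0} = {p, q}"
    using cont dp dq zero by (auto intro!: continuous_intros derivative_eq_intros)
  show ?thesis using two_zeros_aux[OF g(1) pq g(2-6)] False f dp(2) dq(2) by (auto simp: zero_less_mult_iff)
qed

subsection \<open>Straight strands\<close>

text \<open>For a unit vector \<open>v\<close>, the signed distance of \<open>w\<close> from the
  line through \<open>c\<close> in direction \<open>v\<close>, positive on the left.\<close>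

definition side :: "complex \<Rightarrow> complex \<Rightarrow> complex \<Rightarrow> real" where
  "side c v w = Im (cnj v * (w - c))"

lemma side_derivative:
  assumes "virtual_diagram D"
  shows "((\<lambda>t. side c v (curve D t)) has_real_derivative Im (cnj v * tangent D t)) (at t)"
proof -
  have "((\<lambda>t. curve D t - c) has_vector_derivative tangent D t) (at t)"
    using curve_has_derivative[OF assms, of t] by (auto intro!: derivative_eq_intros)
  then have "((\<lambda>t. Im (cnj v * (curve D t - c))) has_vector_derivative Im (cnj v * tangent D t)) (at t)"
    by (intro bounded_linear.has_vector_derivative[OF bounded_linear_compose[OF bounded_linear_Im bounded_linear_mult_right]])
  then show ?thesis unfolding side_def by (simp add: has_real_derivative_iff_has_vector_derivative)
qed

lemma continuous_side:
  assumes "virtual_diagram D"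
  shows "continuous_on A (\<lambda>t. side c v (curve D t))"
  unfolding side_def by (intro continuous_intros continuous_curve[OF assms])

lemma diameter_of_uminus: "diameter_of c r (- u) = diameter_of c r u"
  unfolding diameter_of_def by (simp add: closed_segment_commute)

lemma diameter_ofE:
  assumes "w \<in> diameter_of c r u"
  obtains x where "w = c + of_real x * u"
proof -
  obtain \<theta> where "w = (1 - \<theta>) *\<^sub>R (c - of_real r * u) + \<theta> *\<^sub>R (c + of_real r * u)"
    using assms unfolding diameter_of_def closed_segment_def by blast
  then have "w = c + of_real ((2 * \<theta> - 1) * r) * u"
    by (simp add: scaleR_conv_of_real algebra_simps)
  then show ?thesis using that by blast
qed

lemma cnj_mult_unit: "norm u = 1 \<Longrightarrow> cnj u * (of_real x * u) = of_real x"
  using complex_norm_square[of u] by (simp add: mult.left_commute mult.commute[of "cnj u"])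

lemma diameter_of_iff:
  assumes u: "norm u = 1" and r: "r > 0" and w: "w \<in> cball c r"
  shows "w \<in> diameter_of c r u \<longleftrightarrow> side c u w = 0"
proof
  assume "w \<in> diameter_of c r u"
  then obtain x where x: "w = c + of_real x * u" by (rule diameter_ofE)
  show "side c u w = 0" unfolding side_def x add_diff_cancel_left' cnj_mult_unit[OF u] by simp
next
  assume s: "side c u w = 0"
  define x where "x = Re (cnj u * (w - c))"
  have x: "cnj u * (w - c) = of_real x" using s by (simp add: side_def x_def complex_eq_iff)
  have "u * (cnj u * (w - c)) = w - c" using u complex_norm_square[of u] by (simp add: mult.assoc[symmetric])
  then have w': "w = c + of_real x * u" using x by (simp add: algebra_simps)
  have "\<bar>x\<bar> \<le> r" using w u unfolding w' by (simp add: dist_norm norm_mult)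
  \<comment> \<open>Turns a position between \<open>-r\<close> and \<open>r\<close> into a parameter
    of the segment.\<close>
  define \<theta> where "\<theta> = (x / r + 1) / 2"
  have th: "0 \<le> \<theta>" "\<theta> \<le> 1" "x = (2 * \<theta> - 1) * r"
    using \<open>\<bar>x\<bar> \<le> r\<close> r by (auto simp: \<theta>_def field_simps)
  have "w = (1 - \<theta>) *\<^sub>R (c - of_real r * u) + \<theta> *\<^sub>R (c + of_real r * u)"
    unfolding w' th(3) by (simp add: scaleR_conv_of_real algebra_simps)
  then show "w \<in> diameter_of c r u" unfolding diameter_of_def closed_segment_def using th by blast
qed

text \<open>The coordinate along the diameter is continuous and injective in time, hence monotone.
  The vector \<open>v\<close> is the direction of travel, chosen so that the tangent is a positive
  multiple of it.\<close>

lemma straight_strand_oriented: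
  assumes D: "virtual_diagram D" and ab: "a < b" and st: "straight_strand D c r u a b"
  obtains v g where "v = u \<or> v = - u" "norm v = 1" "\<And>t. a \<le> t \<Longrightarrow> t \<le> b \<Longrightarrow> curve D t = c + of_real (g t) * v"
    "strict_mono_on {a..b} g" "\<And>t. a < t \<Longrightarrow> t < b \<Longrightarrow> \<exists>l>0. tangent D t = of_real l * v"
proof -
  have u: "norm u = 1" and inj: "inj_on (curve D) {a..b}" and img: "curve D ` {a..b} = diameter_of c r u"
    using st unfolding straight_strand_def by auto
  define g0 where "g0 t = Re (cnj u * (curve D t - c))" for t
  have g0: "curve D t = c + of_real (g0 t) * u" if "a \<le> t" "t \<le> b" for t
  proof -
    have "curve D t \<in> diameter_of c r u" using img that by auto
    then obtain x where x: "curve D t = c + of_real x * u" by (rule diameter_ofE)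
    have "g0 t = x" unfolding g0_def x add_diff_cancel_left' cnj_mult_unit[OF u] by simp
    then show ?thesis using x by simp
  qed
  have cont: "continuous_on {a..b} g0"
    unfolding g0_def by (intro continuous_intros continuous_curve[OF D])
  have "inj_on g0 {a..b}"
  proof
    fix x y assume xy: "x \<in> {a..b}" "y \<in> {a..b}" "g0 x = g0 y"
    then have "curve D x = curve D y" using g0[of x] g0[of y] by simp
    then show "x = y" using inj xy by (auto dest: inj_onD)
  qed
  then have mono: "strict_mono_on {a..b} g0 \<or> strict_antimono_on {a..b} g0"
    using injective_eq_monotone_map[of "{a..b}" g0] cont by (simp add: is_interval_cc)
  define \<sigma> :: real where "\<sigma> = (if strict_mono_on {a..b} g0 then 1 else - 1)"
  have \<sigma>: "\<sigma> * \<sigma> = 1" by (simp add: \<sigma>_def)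
  define g where "g t = \<sigma> * g0 t" for t
  define v where "v = of_real \<sigma> * u"
  have gm: "strict_mono_on {a..b} g"
  proof (rule strict_mono_onI)
    fix x y assume xy: "x \<in> {a..b}" "y \<in> {a..b}" "x < y"
    show "g x < g y"
    proof (cases "strict_mono_on {a..b} g0")
      case True
      then show ?thesis using strict_mono_onD[OF True xy] by (simp add: g_def \<sigma>_def)
    next
      case False
      then have "strict_antimono_on {a..b} g0" using mono by blast
      then have "g0 y < g0 x" using xy by (auto simp: monotone_on_def)
      then show ?thesis using False by (simp add: g_def \<sigma>_def)
    qed
  qed
  have gv: "of_real (g t) * v = of_real (g0 t) * u" for t
  proof -
    have "of_real (g t) * v = of_real (\<sigma> * \<sigma>) * (of_real (g0 t) * u)"
      by (simp only: g_def v_def of_real_mult ac_simps)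
    then show ?thesis using \<sigma> by simp
  qed
  show ?thesis
  proof (rule that[of v g])
    show "v = u \<or> v = - u" by (simp add: v_def \<sigma>_def)
    show "norm v = 1" using u by (simp add: v_def norm_mult \<sigma>_def)
    show "curve D t = c + of_real (g t) * v" if "a \<le> t" "t \<le> b" for t using g0[OF that] gv by simp
    show "strict_mono_on {a..b} g" by (rule gm)
    fix t assume t: "a < t" "t < b"
    define d where "d = \<sigma> * Re (cnj u * tangent D t)"
    have "((\<lambda>t. curve D t - c) has_vector_derivative tangent D t) (at t)"
      using curve_has_derivative[OF D, of t] by (auto intro!: derivative_eq_intros)
    then have "((\<lambda>t. Re (cnj u * (curve D t - c))) has_vector_derivative Re (cnj u * tangent D t)) (at t)"
      by (intro bounded_linear.has_vector_derivative[OF bounded_linear_compose[OF bounded_linear_Re bounded_linear_mult_right]])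
    then have "(g0 has_real_derivative Re (cnj u * tangent D t)) (at t)"
      unfolding g0_def by (simp add: has_real_derivative_iff_has_vector_derivative)
    then have gd: "(g has_real_derivative d) (at t)" unfolding g_def d_def by (rule DERIV_cmult)
    then have "((\<lambda>t. c + of_real (g t) * v) has_vector_derivative of_real d * v) (at t)"
      by (auto intro!: derivative_eq_intros simp: has_real_derivative_iff_has_vector_derivative)
    then have "(curve D has_vector_derivative of_real d * v) (at t)"
      by (rule has_vector_derivative_transform_within_open[of _ _ _ "{a<..<b}"])
         (use t g0 gv in auto)
    then have tan: "tangent D t = of_real d * v" by (simp add: tangent_def vector_derivative_at)
    \<comment> \<open>Regularity of the curve makes the speed nonzero, and monotonicity excludes a
      negative one.\<close>
    then have "d \<noteq> 0" using tangent_nonzero[OF D, of t] by auto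
    moreover have "\<not> d < 0"
    proof
      assume "d < 0"
      then obtain e where e: "e > 0" "\<forall>h>0. h < e \<longrightarrow> g t > g (t + h)"
        using DERIV_neg_dec_right[OF gd] by blast
      define h where "h = min (e / 2) (b - t)"
      have h: "h > 0" "h < e" "h \<le> b - t" using e t by (auto simp: h_def)
      then have "g t < g (t + h)" using strict_mono_onD[OF gm, of t "t + h"] t by auto
      then show False using e(2) h by force
    qed
    ultimately show "\<exists>l>0. tangent D t = of_real l * v" using tan by (auto intro: exI[of _ d])
  qed
qed

text \<open>\<open>Im (cnj v * tangent D x)\<close> is the derivative of \<open>side\<close> along
  the other strand, so the sign tells in which direction that strand crosses the line.\<close>

lemma sign_at_straight:
  assumes "tangent D y = of_real l * v" "l > 0"
  shows "sign_at D x y = (if Im (cnj v * tangent D x) < 0 then 1 else - 1)"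
proof -
  have "Im (cnj (tangent D x) * tangent D y) = - (l * Im (cnj v * tangent D x))"
    unfolding assms(1) by (simp add: algebra_simps)
  then show ?thesis using assms(2) by (simp add: sign_at_def mult_less_0_iff)
qed

text \<open>The direction \<open>v\<close> and the coordinate \<open>g\<close> are parameters, so
  that the same ones serve on both sides of a move (\<open>oriented_strand_agree\<close>).\<close>

definition oriented_strand ::
    "diagram \<Rightarrow> complex \<Rightarrow> real \<Rightarrow> complex \<Rightarrow> (real \<Rightarrow> real) \<Rightarrow> real \<Rightarrow> real \<Rightarrow> bool" where
  "oriented_strand D c r v g a b \<longleftrightarrow> norm v = 1 \<and> strict_mono_on {a..b} g \<and>
     (\<forall>t. a \<le> t \<and> t \<le> b \<longrightarrow> curve D t = c + of_real (g t) * v) \<and>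
     (\<forall>t. a < t \<and> t < b \<longrightarrow> (\<exists>l>0. tangent D t = of_real l * v)) \<and>
     curve D ` {a..b} = diameter_of c r v"

lemma straight_imp_oriented:
  assumes D: "virtual_diagram D" and ab: "a < b" and st: "straight_strand D c r u a b"
  obtains v g where "v = u \<or> v = - u" "oriented_strand D c r v g a b"
proof (rule straight_strand_oriented[OF assms])
  fix v g
  assume v: "v = u \<or> v = - u" "norm v = 1" "\<And>t. a \<le> t \<Longrightarrow> t \<le> b \<Longrightarrow> curve D t = c + of_real (g t) * v"
    "strict_mono_on {a..b} g" "\<And>t. a < t \<Longrightarrow> t < b \<Longrightarrow> \<exists>l>0. tangent D t = of_real l * v"
  have "curve D ` {a..b} = diameter_of c r u" using st by (simp add: straight_strand_def)
  then have "curve D ` {a..b} = diameter_of c r v" using v(1) diameter_of_uminus by auto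
  then have "oriented_strand D c r v g a b" unfolding oriented_strand_def using v by blast
  then show ?thesis using that v(1) by blast
qed

lemma oriented_strandD:
  assumes "oriented_strand D c r v g a b"
  shows "norm v = 1" "a \<le> t \<Longrightarrow> t \<le> b \<Longrightarrow> curve D t = c + of_real (g t) * v"
    "a < t \<Longrightarrow> t < b \<Longrightarrow> \<exists>l>0. tangent D t = of_real l * v"
    "a \<le> t \<Longrightarrow> t \<le> b \<Longrightarrow> side c v (curve D t) = 0"
    "a \<le> s \<Longrightarrow> s \<le> b \<Longrightarrow> a \<le> t \<Longrightarrow> t \<le> b \<Longrightarrow> g s < g t \<longleftrightarrow> s < t"
    "a \<le> s \<Longrightarrow> s \<le> b \<Longrightarrow> a \<le> t \<Longrightarrow> t \<le> b \<Longrightarrow> curve D s = curve D t \<longleftrightarrow> s = t"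
    "w \<in> cball c r \<Longrightarrow> r > 0 \<Longrightarrow> side c v w = 0 \<Longrightarrow> \<exists>t. a \<le> t \<and> t \<le> b \<and> curve D t = w"
proof -
  have o: "norm v = 1" "strict_mono_on {a..b} g"
    "\<And>t. a \<le> t \<Longrightarrow> t \<le> b \<Longrightarrow> curve D t = c + of_real (g t) * v"
    "\<And>t. a < t \<Longrightarrow> t < b \<Longrightarrow> \<exists>l>0. tangent D t = of_real l * v"
    "curve D ` {a..b} = diameter_of c r v"
    using assms unfolding oriented_strand_def by blast+
  show "norm v = 1" by (rule o(1))
  show "a \<le> t \<Longrightarrow> t \<le> b \<Longrightarrow> curve D t = c + of_real (g t) * v" by (rule o(3))
  show "a < t \<Longrightarrow> t < b \<Longrightarrow> \<exists>l>0. tangent D t = of_real l * v" by (rule o(4))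
  show "side c v (curve D t) = 0" if "a \<le> t" "t \<le> b"
    unfolding side_def o(3)[OF that] add_diff_cancel_left' cnj_mult_unit[OF o(1)] by simp
  show less: "g s < g t \<longleftrightarrow> s < t" if "a \<le> s" "s \<le> b" "a \<le> t" "t \<le> b" for s t
    using strict_mono_onD[OF o(2), of s t] strict_mono_onD[OF o(2), of t s] that
    by (cases s t rule: linorder_cases) auto
  show "curve D s = curve D t \<longleftrightarrow> s = t" if "a \<le> s" "s \<le> b" "a \<le> t" "t \<le> b"
  proof
    assume "curve D s = curve D t"
    then have "g s = g t" using o(1) o(3)[OF that(1,2)] o(3)[OF that(3,4)] by auto
    then show "s = t" using less[OF that] less[OF that(3,4,1,2)] by (cases s t rule: linorder_cases) auto
  qed simp
  show "\<exists>t. a \<le> t \<and> t \<le> b \<and> curve D t = w" if "w \<in> cball c r" "r > 0" "side c v w = 0"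
    using diameter_of_iff[OF o(1) that(2,1)] that(3) o(5) by (metis atLeastAtMost_iff imageE)
qed

lemma oriented_strand_agree:
  assumes D: "virtual_diagram D" and agree: "agree_off D D' a b" and ab: "a < b" "b < a + 1"
    and off: "\<And>t. a1 \<le> t \<Longrightarrow> t \<le> b1 \<Longrightarrow> off a b t" and o: "oriented_strand D c r v g a1 b1"
  shows "oriented_strand D' c r v g a1 b1"
proof -
  have img: "curve D' ` {a1..b1} = curve D ` {a1..b1}"
    by (rule image_cong) (use agree_off_eq(1)[OF agree off] in auto)
  note o' = o[unfolded oriented_strand_def]
  show ?thesis
    unfolding oriented_strand_def img
  proof (intro conjI allI impI)
    fix t
    show "curve D' t = c + of_real (g t) * v" if "a1 \<le> t \<and> t \<le> b1"
      using that agree_off_eq(1)[OF agree off] o' by simp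
    show "\<exists>l>0. tangent D' t = of_real l * v" if "a1 < t \<and> t < b1"
      using that tangent_agree[OF D agree ab off] o' by simp
  qed (use o' in blast)+
qed

subsection \<open>Second moves\<close>

lemma slide_data:
  assumes D: "virtual_diagram D" "virtual_diagram D'" and slide: "slides_across_strand D D' p q"
  obtains c r v g a b a1 b1 where "a < b" "b < a + 1" "agree_off D D' a b" "a1 < b1" "b1 < a1 + 1"
    "disc_strands D c r {(a, b), (a1, b1)}" "disc_strands D' c r {(a, b), (a1, b1)}"
    "oriented_strand D c r v g a1 b1" "oriented_strand D' c r v g a1 b1"
    "inj_on (curve D) {a..b}" "inj_on (curve D') {a..b}"
    "\<And>t. a \<le> t \<Longrightarrow> t \<le> b \<Longrightarrow> side c v (curve D t) \<noteq> 0"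
    "{t \<in> {a..b}. side c v (curve D' t) = 0} = {p, q}" "p \<noteq> q"
    "\<And>t t'. a \<le> t \<Longrightarrow> t \<le> b \<Longrightarrow> a1 \<le> t' \<Longrightarrow> t' \<le> b1 \<Longrightarrow> frac t \<noteq> frac t'"
proof -
  obtain c r u a b a1 b1 where disc: "disc_strands D c r {(a, b), (a1, b1)}"
    and disc': "disc_strands D' c r {(a, b), (a1, b1)}" and agree: "agree_off D D' a b"
    and st: "straight_strand D c r u a1 b1" and inj: "inj_on (curve D) {a..b}" "inj_on (curve D') {a..b}"
    and miss: "curve D ` {a..b} \<inter> diameter_of c r u = {}" and pq: "p \<noteq> q"
    and zeros: "{t \<in> {a..b}. curve D' t \<in> diameter_of c r u} = {p, q}"
    using slide unfolding slides_across_strand_def by (elim exE conjE) (rule that)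
  have ab: "a < b" "b < a + 1" "a1 < b1" "b1 < a1 + 1"
    using disc_strandsD(2)[OF disc, of a b] disc_strandsD(2)[OF disc, of a1 b1] by auto
  have r: "r > 0" by (rule disc_strandsD(1)[OF disc])
  obtain v g where v: "v = u \<or> v = - u" and o: "oriented_strand D c r v g a1 b1"
    using straight_imp_oriented[OF D(1) ab(3) st] by blast
  have dv: "diameter_of c r u = diameter_of c r v" using v diameter_of_uminus by auto
  have side: "curve E t \<in> diameter_of c r u \<longleftrightarrow> side c v (curve E t) = 0"
    if "disc_strands E c r {(a, b), (a1, b1)}" "a \<le> t" "t \<le> b" for E t
    unfolding dv by (rule diameter_of_iff[OF oriented_strandD(1)[OF o] r disc_strandsD(4)[OF that(1) _ that(2,3)]]) simp
  have miss': "side c v (curve D t) \<noteq> 0" if "a \<le> t" "t \<le> b" for t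
  proof -
    have "curve D t \<in> curve D ` {a..b}" using that by auto
    then have "curve D t \<notin> diameter_of c r u" using miss by blast
    then show ?thesis unfolding side[OF disc that] .
  qed
  have zeros': "{t \<in> {a..b}. side c v (curve D' t) = 0} = {p, q}"
    unfolding zeros[symmetric] by (rule Collect_cong) (use side[OF disc'] in auto)
  \<comment> \<open>In \<open>D\<close> the moving strand misses the diameter on which the fixed
    strand runs, so their time intervals are disjoint modulo 1.\<close>
  have dis: "frac t \<noteq> frac t'" if "a \<le> t" "t \<le> b" "a1 \<le> t'" "t' \<le> b1" for t t'
    using miss'[OF that(1,2)] oriented_strandD(4)[OF o that(3,4)] curve_cong_frac[OF D(1), of t t'] by auto
  have off: "off a b t" if "a1 \<le> t" "t \<le> b1" for t
  proof (rule ccontr)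
    assume "\<not> off a b t"
    then obtain t' where "frac t' = frac t" "a \<le> t'" "t' \<le> b" by (rule not_offE)
    then show False using dis[OF _ _ that] by blast
  qed
  have o': "oriented_strand D' c r v g a1 b1"
    by (rule oriented_strand_agree[OF D(1) agree ab(1,2) off o])
  show ?thesis by (rule that[OF ab(1,2) agree ab(3,4) disc disc' o o' inj miss' zeros' pq dis])
qed

lemma no_zero_same_sign:
  fixes f :: "real \<Rightarrow> real"
  assumes "continuous_on {a..b} f" "a \<le> b" "\<And>t. a \<le> t \<Longrightarrow> t \<le> b \<Longrightarrow> f t \<noteq> 0"
  shows "f a * f b > 0"
proof (rule ccontr)
  assume "\<not> f a * f b > 0"
  then have "f a < 0 \<and> f b > 0 \<or> f a > 0 \<and> f b < 0"
    using assms(3)[of a] assms(3)[of b] assms(2) by (auto simp: zero_less_mult_iff not_less)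
  then obtain x where "a \<le> x" "x \<le> b" "f x = 0"
    using IVT'[of f a 0 b] IVT2'[of f b 0 a] assms(1,2) by auto
  then show False using assms(3) by blast
qed

text \<open>The moving strand is embedded, so the partner of a crossing on it must run on the fixed
  strand.\<close>

lemma slide_crossing_lift:
  assumes D: "virtual_diagram D" and disc: "disc_strands D c r {(a, b), (a1, b1)}"
    and inj: "inj_on (curve D) {a..b}" and c: "crossing D x y" and x: "a \<le> x" "x \<le> b"
  obtains y' where "frac y' = frac y" "a1 \<le> y'" "y' \<le> b1" "curve D y' = curve D x"
proof -
  have "curve D x \<in> cball c r" using disc_strandsD(4)[OF disc _ x] by simp
  then have "curve D y \<in> cball c r" using c by (simp add: crossing_def)
  then obtain a' b' y' where y': "(a', b') \<in> {(a, b), (a1, b1)}" "frac y' = frac y" "a' \<le> y'" "y' \<le> b'"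
    using disc_strandsD(5)[OF disc] by blast
  have e: "curve D y' = curve D x" using c curve_cong_frac[OF D y'(2)] by (simp add: crossing_def)
  have "\<not> (a \<le> y' \<and> y' \<le> b)"
  proof
    assume "a \<le> y' \<and> y' \<le> b"
    then have "y' = x" using inj_onD[OF inj e] x by simp
    then show False using c y'(2) by (simp add: crossing_def)
  qed
  then show ?thesis using y' e that by auto
qed

theorem alex_virtual2:
  assumes D: "virtual_diagram D" "virtual_diagram D'" and slide: "slides_across_strand D D' p q"
    and virt: "{p, q} \<inter> classical_times D' = {}"
  shows "alex (gauss_of D') = alex (gauss_of D)"
proof -
  obtain c r v g a b a1 b1 where ab: "a < b" "b < a + 1" "agree_off D D' a b" "a1 < b1" "b1 < a1 + 1"
    and disc: "disc_strands D c r {(a, b), (a1, b1)}" and disc': "disc_strands D' c r {(a, b), (a1, b1)}"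
    and o: "oriented_strand D c r v g a1 b1" and o': "oriented_strand D' c r v g a1 b1"
    and inj: "inj_on (curve D) {a..b}" "inj_on (curve D') {a..b}"
    and miss: "\<And>t. a \<le> t \<Longrightarrow> t \<le> b \<Longrightarrow> side c v (curve D t) \<noteq> 0"
    and zeros: "{t \<in> {a..b}. side c v (curve D' t) = 0} = {p, q}" "p \<noteq> q"
    and dis: "\<And>t t'. a \<le> t \<Longrightarrow> t \<le> b \<Longrightarrow> a1 \<le> t' \<Longrightarrow> t' \<le> b1 \<Longrightarrow> frac t \<noteq> frac t'"
    by (rule slide_data[OF D slide]) blast
  show ?thesis
  proof (rule alex_local_eq[OF D ab(3,1,2)])
    fix x y assume cr: "crossing D x y"
    show "off a b x"
    proof (rule ccontr)
      assume "\<not> off a b x"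
      then obtain x' where x': "frac x' = frac x" "a \<le> x'" "x' \<le> b" by (rule not_offE)
      have cr': "crossing D x' y" using crossing_cong[OF D(1) x'(1)] cr by blast
      obtain y' where y': "a1 \<le> y'" "y' \<le> b1" "curve D y' = curve D x'"
        by (rule slide_crossing_lift[OF D(1) disc inj(1) cr' x'(2,3)])
      show False using miss[OF x'(2,3)] oriented_strandD(4)[OF o y'(1,2)] y'(3) by simp
    qed
  next
    fix x y assume cr: "crossing D' x y"
    show "off a b x"
    proof (rule ccontr)
      assume "\<not> off a b x"
      then obtain x' where x': "frac x' = frac x" "a \<le> x'" "x' \<le> b" by (rule not_offE)
      have cr': "crossing D' x' y" using crossing_cong[OF D(2) x'(1)] cr by blast
      obtain y' where y': "a1 \<le> y'" "y' \<le> b1" "curve D' y' = curve D' x'"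
        by (rule slide_crossing_lift[OF D(2) disc' inj(2) cr' x'(2,3)])
      have "side c v (curve D' x') = 0" using oriented_strandD(4)[OF o' y'(1,2)] y'(3) by simp
      then have "x' \<in> {t \<in> {a..b}. side c v (curve D' t) = 0}" using x' by simp
      then have "x' \<in> {p, q}" unfolding zeros(1) .
      moreover have "x' \<in> classical_times D'" using cr' by (simp add: crossing_def)
      ultimately show False using virt by auto
    qed
  qed
qed

lemma alex_reidemeister2_aux:
  assumes D: "virtual_diagram D" "virtual_diagram D'" and slide: "slides_across_strand D D' p q"
    and over: "{p, q} \<subseteq> over_times D'" and pq: "p < q"
  shows "alex (gauss_of D') = alex (gauss_of D)"
proof -
  obtain c r v g a b a1 b1 where ab: "a < b" "b < a + 1" "agree_off D D' a b" "a1 < b1" "b1 < a1 + 1"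
    and disc: "disc_strands D c r {(a, b), (a1, b1)}" and disc': "disc_strands D' c r {(a, b), (a1, b1)}"
    and o: "oriented_strand D c r v g a1 b1" and o': "oriented_strand D' c r v g a1 b1"
    and inj: "inj_on (curve D) {a..b}" "inj_on (curve D') {a..b}"
    and miss: "\<And>t. a \<le> t \<Longrightarrow> t \<le> b \<Longrightarrow> side c v (curve D t) \<noteq> 0"
    and zeros: "{t \<in> {a..b}. side c v (curve D' t) = 0} = {p, q}" "p \<noteq> q"
    and dis: "\<And>t t'. a \<le> t \<Longrightarrow> t \<le> b \<Longrightarrow> a1 \<le> t' \<Longrightarrow> t' \<le> b1 \<Longrightarrow> frac t \<noteq> frac t'"
    by (rule slide_data[OF D slide]) blast
  have r: "r > 0" by (rule disc_strandsD(1)[OF disc])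
  let ?f = "\<lambda>t. side c v (curve D' t)"
  note ends = agree_off_ends[OF ab(3,1,2)]
  have z: "?f p = 0" "?f q = 0" "a \<le> p" "p \<le> b" "a \<le> q" "q \<le> b" using zeros by auto
  have fa: "?f a \<noteq> 0" "?f b \<noteq> 0" using miss[of a] miss[of b] ab unfolding ends by auto
  have pos: "a < p" "q < b" using z fa by (metis order_le_less)+
  have N1: "off a b x \<and> off a b y" if cr: "crossing D x y" for x y
  proof -
    have "off a b x" if cr: "crossing D x y" for x y
    proof (rule ccontr)
      assume "\<not> off a b x"
      then obtain x' where x': "frac x' = frac x" "a \<le> x'" "x' \<le> b" by (rule not_offE)
      have cr': "crossing D x' y" using crossing_cong[OF D(1) x'(1)] cr by blast
      obtain y' where y': "a1 \<le> y'" "y' \<le> b1" "curve D y' = curve D x'"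
        by (rule slide_crossing_lift[OF D(1) disc inj(1) cr' x'(2,3)])
      show False using miss[OF x'(2,3)] oriented_strandD(4)[OF o y'(1,2)] y'(3) by simp
    qed
    from this[OF cr] this[OF crossing_sym[OF cr]] show ?thesis ..
  qed
  have N2: "frac x \<in> {frac p, frac q}" if cr: "crossing D' x y" and no: "\<not> off a b x" for x y
  proof -
    obtain x' where x': "frac x' = frac x" "a \<le> x'" "x' \<le> b" using not_offE[OF no] .
    have cr': "crossing D' x' y" using crossing_cong[OF D(2) x'(1)] cr by blast
    obtain y' where y': "a1 \<le> y'" "y' \<le> b1" "curve D' y' = curve D' x'"
      by (rule slide_crossing_lift[OF D(2) disc' inj(2) cr' x'(2,3)])
    have "?f x' = 0" using oriented_strandD(4)[OF o' y'(1,2)] y'(3) by simp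
    then have "x' \<in> {t \<in> {a..b}. ?f t = 0}" using x' by simp
    then have "x' \<in> {p, q}" unfolding zeros(1) .
    then show ?thesis using x' by auto
  qed
  have ex: "\<exists>x. a1 < x \<and> x < b1 \<and> curve D' x = curve D' s \<and> frac s \<noteq> frac x \<and>
      sign_at D' s x = (if Im (cnj v * tangent D' s) < 0 then 1 else - 1) \<and> Im (cnj v * tangent D' s) \<noteq> 0"
    if s: "a < s" "s < b" "?f s = 0" for s
  proof -
    have bs: "curve D' s \<in> ball c r" using disc_strandsD(3)[OF disc' _ s(1,2)] by simp
    then have "curve D' s \<in> cball c r" using ball_subset_cball by blast
    then obtain x where x: "a1 \<le> x" "x \<le> b1" "curve D' x = curve D' s"
      using oriented_strandD(7)[OF o' _ r s(3)] by blast
    have "curve D' a1 \<notin> ball c r" "curve D' b1 \<notin> ball c r"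
      using disc_strandsD(2)[OF disc', of a1 b1] by auto
    then have x': "a1 < x" "x < b1" using x bs by (metis order_le_less)+
    have fr: "frac s \<noteq> frac x" using dis[of s x] s x by auto
    obtain l where l: "l > 0" "tangent D' x = of_real l * v" using oriented_strandD(3)[OF o' x'] by blast
    have "Im (cnj (tangent D' x) * tangent D' s) \<noteq> 0" using transverse[OF D(2) x(3)] fr by metis
    then have "Im (cnj v * tangent D' s) \<noteq> 0" unfolding l(2) by (auto simp: algebra_simps)
    then show ?thesis using x' x fr sign_at_straight[OF l(2,1)] by blast
  qed
  obtain xp where xp: "a1 < xp" "xp < b1" "curve D' xp = curve D' p" "frac p \<noteq> frac xp"
    and sp: "sign_at D' p xp = (if Im (cnj v * tangent D' p) < 0 then 1 else - 1)" "Im (cnj v * tangent D' p) \<noteq> 0"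
    using ex[of p] pos pq z by auto
  obtain xq where xq: "a1 < xq" "xq < b1" "curve D' xq = curve D' q" "frac q \<noteq> frac xq"
    and sq: "sign_at D' q xq = (if Im (cnj v * tangent D' q) < 0 then 1 else - 1)" "Im (cnj v * tangent D' q) \<noteq> 0"
    using ex[of q] pos pq z by auto
  have cp: "crossing D' p xp" using crossingI[OF D(2) xp(3)[symmetric] xp(4)] over by simp
  have cq: "crossing D' q xq" using crossingI[OF D(2) xq(3)[symmetric] xq(4)] over by simp
  have xpq: "xp \<noteq> xq" using inj_onD[OF inj(2), of p q] xp(3) xq(3) z pq by auto
  \<comment> \<open>The two mates on the fixed strand, sorted by time; both orders occur.\<close>
  define x y where "x = min xp xq" and "y = max xp xq"
  have xy: "x < y" "y < x + 1" "a1 < x" "y < b1" using xp xq xpq ab by (auto simp: x_def y_def)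
  have xy_cases: "x = xp \<and> y = xq \<or> x = xq \<and> y = xp" by (auto simp: x_def y_def min_def max_def)
  \<comment> \<open>The ends are common to both diagrams, and in \<open>D\<close> the strand never
    changes sides. So in \<open>D'\<close> it crosses the diameter back and forth, with opposite
    signs.\<close>
  have ff: "?f a * ?f b > 0"
    unfolding ends by (rule no_zero_same_sign[OF continuous_side[OF D(1)] _ miss]) (use ab in auto)
  have op: "Im (cnj v * tangent D' p) < 0 \<longleftrightarrow> Im (cnj v * tangent D' q) > 0"
    by (rule two_zeros[OF continuous_side[OF D(2)] pos(1) pq pos(2) side_derivative[OF D(2)] sp(2)
          side_derivative[OF D(2)] sq(2) zeros(1) ff])
  note w = wf_gauss_of[OF D(1)] wf_gauss_of[OF D(2)]
  note same = gauss_agree[OF D ab(3,1,2) _ N1]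
  show ?thesis
  proof (rule alex_slide[OF w pq _ xy(1,2)])
    show "q < p + 1" using pos ab by simp
    show "frac t \<noteq> frac t'" if "p \<le> t" "t \<le> q" "x \<le> t'" "t' \<le> y" for t t'
      using dis[of t t'] that pos xy by auto
    show "frac t \<notin> gC (gauss_of D)" if t: "p \<le> t" "t \<le> q" for t
    proof
      assume "frac t \<in> gC (gauss_of D)"
      then obtain y where "crossing D t y" using gC_frac[OF D(1)] by blast
      then have "off a b t" using N1 by blast
      then show False using off_not_in[of a b t t] t pos by auto
    qed
    show "frac t \<notin> gC (gauss_of D)" if t: "x \<le> t" "t \<le> y" for t
    proof
      have t1: "a1 \<le> t" "t \<le> b1" using t xy by auto
      assume "frac t \<in> gC (gauss_of D)"
      then obtain z where cz: "crossing D t z" using gC_frac[OF D(1)] by blast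
      have "curve D t \<in> cball c r" using disc_strandsD(4)[OF disc _ t1] by simp
      then have "curve D z \<in> cball c r" using cz by (simp add: crossing_def)
      then obtain a' b' z' where z': "(a', b') \<in> {(a, b), (a1, b1)}" "frac z' = frac z" "a' \<le> z'" "z' \<le> b'"
        using disc_strandsD(5)[OF disc] by blast
      have "\<not> (a \<le> z' \<and> z' \<le> b)" using N1[OF cz] off_not_in z'(2) by blast
      then have z1: "a1 \<le> z'" "z' \<le> b1" using z' by auto
      have "curve D t = curve D z'" using cz curve_cong_frac[OF D(1) z'(2)] by (simp add: crossing_def)
      then have "t = z'" using oriented_strandD(6)[OF o t1 z1] by simp
      then show False using cz z'(2) by (simp add: crossing_def)
    qed
    show "gC (gauss_of D') = gC (gauss_of D) \<union> {frac p, frac q} \<union> {frac x, frac y}"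
    proof (intro equalityI subsetI)
      fix k assume k: "k \<in> gC (gauss_of D')"
      then obtain y0 where fk: "frac k = k" and cr: "crossing D' k y0" unfolding gC_crossing[OF D(2)] by blast
      consider "off a b k \<and> off a b y0" | "\<not> off a b k" | "\<not> off a b y0" by blast
      then show "k \<in> gC (gauss_of D) \<union> {frac p, frac q} \<union> {frac x, frac y}"
      proof cases
        case 1
        then have "crossing D k y0"
          using crossing_agree(1)[OF D(2) D(1) agree_off_sym[OF ab(3)] ab(1,2) cr] by blast
        then show ?thesis using fk gC_crossing[OF D(1)] by blast
      next
        case 2
        then show ?thesis using N2[OF cr] fk by auto
      next
        case 3
        note cr' = crossing_sym[OF cr]
        have "frac k = frac xp" if "frac y0 = frac p"
          using crossing_unique[OF D(2) cr'] crossing_cong[OF D(2) that refl] cp by blast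
        moreover have "frac k = frac xq" if "frac y0 = frac q"
          using crossing_unique[OF D(2) cr'] crossing_cong[OF D(2) that refl] cq by blast
        ultimately show ?thesis using N2[OF cr' 3] fk xy_cases by auto
      qed
    next
      fix k assume "k \<in> gC (gauss_of D) \<union> {frac p, frac q} \<union> {frac x, frac y}"
      moreover have "{frac p, frac q, frac xp, frac xq} \<subseteq> gC (gauss_of D')"
        using cp cq crossing_sym[OF cp] crossing_sym[OF cq] gC_frac[OF D(2)] by blast
      ultimately show "k \<in> gC (gauss_of D')" using same(1) xy_cases by blast
    qed
    show "{frac p, frac q} \<subseteq> gO (gauss_of D')"
      using over over_frac[OF D(2)] frac_in_unit[of p] frac_in_unit[of q] by simp
    have "gS (gauss_of D') (frac p) = sign_at D' p xp" "gS (gauss_of D') (frac q) = sign_at D' q xq"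
      using crossing_sign[OF D(2) cp] crossing_sign[OF D(2) cq] over by (simp_all del: gauss_of_simps)
    then show "gS (gauss_of D') (frac q) = - gS (gauss_of D') (frac p)"
      using sp sq op by (simp del: gauss_of_simps split: if_splits)
    have "gM (gauss_of D') (frac p) = frac xp" "gM (gauss_of D') (frac q) = frac xq"
      using crossing_mate[OF D(2) cp] crossing_mate[OF D(2) cq] by simp_all
    then show "gM (gauss_of D') (frac p) = frac x \<and> gM (gauss_of D') (frac q) = frac y \<or>
      gM (gauss_of D') (frac p) = frac y \<and> gM (gauss_of D') (frac q) = frac x"
      using xy_cases by auto
  qed (use same(2) in blast)
qed

theorem alex_reidemeister2:
  assumes D: "virtual_diagram D" "virtual_diagram D'" and slide: "slides_across_strand D D' p q"
    and over: "{p, q} \<subseteq> over_times D'"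
  shows "alex (gauss_of D') = alex (gauss_of D)"
proof -
  have ne: "p \<noteq> q" using slide unfolding slides_across_strand_def by blast
  have "slides_across_strand D D' q p \<longleftrightarrow> slides_across_strand D D' p q"
    unfolding slides_across_strand_def by (simp only: insert_commute[of q p "{}"] eq_commute[of q p])
  then have sym: "slides_across_strand D D' q p" using slide by blast
  show ?thesis
  proof (cases "p < q")
    case True
    then show ?thesis by (rule alex_reidemeister2_aux[OF D slide over])
  next
    case False
    then have "q < p" using ne by simp
    moreover have "{q, p} \<subseteq> over_times D'" using over by auto
    ultimately show ?thesis using alex_reidemeister2_aux[OF D sym] by blast
  qed
qed

section \<open>Combinatorial preparation for third moves\<close>

lemma alex_third_move':
  assumes wf: "wf_gauss G" "wf_gauss G'" and tr: "transports \<phi> (gC G) (gC G')"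
    and mem: "{A1, A2, bx, bz, cy, cz} \<subseteq> gC G" and dist: "distinct [A1, A2, bx, bz, cy, cz]"
    and nxA: "nx (gC G) A1 = A2"
    and nxB: "if ey = ez then nx (gC G) bx = bz else nx (gC G) bz = bx"
    and nxC: "if ex = ez then nx (gC G) cy = cz else nx (gC G) cz = cy"
    and M: "gM G A1 = bx" "gM G A2 = cy" "gM G bz = cz"
    and M': "gM G' (frac (\<phi> A1)) = frac (\<phi> cz)" "gM G' (frac (\<phi> A2)) = frac (\<phi> bz)"
      "gM G' (frac (\<phi> bx)) = frac (\<phi> cy)"
    and O: "{A1, A2, bz} \<subseteq> gO G" and O': "{frac (\<phi> A1), frac (\<phi> A2), frac (\<phi> bx)} \<subseteq> gO G'"
    and S: "gS G A1 = ex" "gS G A2 = ey" "gS G bz = ez"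
    and S': "gS G' (frac (\<phi> A2)) = ex" "gS G' (frac (\<phi> A1)) = ey" "gS G' (frac (\<phi> bx)) = ez"
    and same: "\<And>k. k \<in> gC G - {A1, A2, bx, bz, cy, cz} \<Longrightarrow>
      gM G' (frac (\<phi> k)) = frac (\<phi> (gM G k)) \<and> gS G' (frac (\<phi> k)) = gS G k \<and>
      (frac (\<phi> k) \<in> gO G' \<longleftrightarrow> k \<in> gO G)"
  shows "alex G' = alex G"
proof -
  let ?\<beta> = "ey = ez" and ?\<gamma> = "ex = ez"
  \<comment> \<open>\<open>bx\<close> and \<open>bz\<close> are the passages of \<open>B\<close>
    through \<open>x\<close> and \<open>z\<close>, in either order. The signs decide which comes
    first, and the positions are assigned accordingly.\<close>
  let ?B1 = "if ?\<beta> then bx else bz" and ?B2 = "if ?\<beta> then bz else bx"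
    and ?C1 = "if ?\<gamma> then cy else cz" and ?C2 = "if ?\<gamma> then cz else cy"
  have b: "(if ?\<beta> then ?B1 else ?B2) = bx" "(if ?\<beta> then ?B2 else ?B1) = bz"
    and c: "(if ?\<gamma> then ?C1 else ?C2) = cy" "(if ?\<gamma> then ?C2 else ?C1) = cz" by auto
  have set: "{A1, A2, ?B1, ?B2, ?C1, ?C2} = {A1, A2, bx, bz, cy, cz}" by auto
  show ?thesis
    by (rule alex_third_move[OF wf tr, where ?A1.0 = A1 and ?A2.0 = A2 and ?B1.0 = ?B1 and ?B2.0 = ?B2 and
          ?C1.0 = ?C1 and ?C2.0 = ?C2 and \<beta> = ?\<beta> and \<gamma> = ?\<gamma> and ex = ex and ey = ey and ez = ez])
      (simp_all only: b c set M M' S S' O O' mem same,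
        use dist nxA nxB nxC in \<open>auto\<close>)
qed

text \<open>The windows are the time intervals of the strands in the disc. If two points were
  exchanged, one would have to jump over the other; as no point leaves its window, both would lie in
  the same window, where the order is kept.\<close>

lemma windows_mono:
  fixes \<phi> :: "real \<Rightarrow> real" and \<alpha> \<beta> :: "'i \<Rightarrow> real"
  assumes short: "\<And>i. i \<in> I \<Longrightarrow> \<beta> i < \<alpha> i + 1"
    and disj: "\<And>i j t t'. i \<in> I \<Longrightarrow> j \<in> I \<Longrightarrow> i \<noteq> j \<Longrightarrow> \<alpha> i \<le> t \<Longrightarrow> t \<le> \<beta> i \<Longrightarrow> \<alpha> j \<le> t' \<Longrightarrow> t' \<le> \<beta> j \<Longrightarrow>
      frac t \<noteq> frac t'"
    and shift: "\<And>z n. z \<in> X \<Longrightarrow> z + of_int n \<in> X \<and> \<phi> (z + of_int n) = \<phi> z + of_int n"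
    and window: "\<And>i z. i \<in> I \<Longrightarrow> z \<in> X \<Longrightarrow> \<alpha> i \<le> z \<Longrightarrow> z \<le> \<beta> i \<Longrightarrow> \<alpha> i \<le> \<phi> z \<and> \<phi> z \<le> \<beta> i"
    and inside: "\<And>i z z'. i \<in> I \<Longrightarrow> z \<in> X \<Longrightarrow> z' \<in> X \<Longrightarrow> \<alpha> i \<le> z \<Longrightarrow> z < z' \<Longrightarrow> z' \<le> \<beta> i \<Longrightarrow> \<phi> z < \<phi> z'"
    and outside: "\<And>z. z \<in> X \<Longrightarrow> (\<And>i. i \<in> I \<Longrightarrow> off (\<alpha> i) (\<beta> i) z) \<Longrightarrow> \<phi> z = z"
    and z: "z \<in> X" "z' \<in> X" "z < z'"
  shows "\<phi> z < \<phi> z'"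
proof (cases "\<exists>i\<in>I. \<exists>n::int. \<alpha> i \<le> z + of_int n \<and> z' + of_int n \<le> \<beta> i")
  case True
  then obtain i and n :: int where i: "i \<in> I" "\<alpha> i \<le> z + of_int n" "z' + of_int n \<le> \<beta> i" by blast
  have "\<phi> (z + of_int n) < \<phi> (z' + of_int n)"
    using inside[OF i(1), of "z + of_int n" "z' + of_int n"] shift[OF z(1), of n] shift[OF z(2), of n] z(3) i(2,3)
    by simp
  then show ?thesis using shift z by simp
next
  case False
  define win where "win i n x \<longleftrightarrow> i \<in> I \<and> \<alpha> i \<le> x + of_int n \<and> x + of_int n \<le> \<beta> i" for i and n :: int and x
  have apart: "\<not> (win i n z \<and> win i n z')" for i n
    using False z(3) unfolding win_def by auto
  have uniq: "i = j \<and> n = m" if w: "win i n x" "win j m x" for i j n m x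
  proof -
    have fr: "frac (x + of_int n) = frac (x + of_int m)" by simp
    have ij: "i = j"
      using disj[of i j "x + of_int n" "x + of_int m"] w fr unfolding win_def by blast
    then have "\<bar>real_of_int n - of_int m\<bar> < 1" using w short[of i] unfolding win_def by auto
    then have "\<bar>n - m\<bar> < 1" by linarith
    then show ?thesis using ij by simp
  qed
  have cell: "win i n (\<phi> x)" if "x \<in> X" "win i n x" for i n x
    using window[of i "x + of_int n"] shift[OF that(1), of n] that(2) unfolding win_def by auto
  have conv: "win i n y" if "win i n x" "win i n x'" "x \<le> y" "y \<le> x'" for i n x x' y
    using that unfolding win_def by auto
  have free: "\<phi> x = x" if x: "x \<in> X" "\<And>i n. \<not> win i n x" for x
    by (rule outside[OF x(1)]) (use x(2) in \<open>auto simp: off_def win_def\<close>)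
  \<comment> \<open>If \<open>\<phi> z\<close> reached \<open>z'\<close>, then \<open>z'\<close>
    would lie between \<open>z\<close> and \<open>\<phi> z\<close> and hence in the window of
    \<open>z\<close>.\<close>
  have 1: "\<phi> z < z'"
  proof (rule ccontr)
    assume g: "\<not> \<phi> z < z'"
    show False
    proof (cases "\<exists>i n. win i n z")
      case True
      then obtain i n where w: "win i n z" by blast
      have "win i n z'" by (rule conv[OF w cell[OF z(1) w]]) (use g z(3) in auto)
      then show False using apart w by blast
    next
      case False
      then show False using free[OF z(1)] g z(3) by auto
    qed
  qed
  show ?thesis
  proof (rule ccontr)
    assume g: "\<not> \<phi> z < \<phi> z'"
    show False
    proof (cases "\<exists>i n. win i n z'")
      case True
      then obtain i n where w: "win i n z'" by blast
      have w2: "win i n (\<phi> z)" by (rule conv[OF cell[OF z(2) w] w]) (use g 1 in auto)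
      show False
      proof (cases "\<exists>j m. win j m z")
        case True
        then obtain j m where v: "win j m z" by blast
        then show False using uniq[OF w2 cell[OF z(1) v]] apart[of i n] w by blast
      next
        case False
        then show False using free[OF z(1)] w2 apart[of i n] w by auto
      qed
    next
      case False
      then show False using free[OF z(2)] g 1 by auto
    qed
  qed
qed

subsection \<open>Configurations of third moves\<close>

text \<open>One side of a third move. The data are symmetric in the two fixed strands
  (\<open>third_config_swap\<close>), so facts shown for the strand along \<open>v\<close> also
  serve for the one along \<open>w\<close>.\<close>

definition third_config ::
    "diagram \<Rightarrow> complex \<Rightarrow> real \<Rightarrow> complex \<Rightarrow> complex \<Rightarrow> (real \<Rightarrow> real) \<Rightarrow> (real \<Rightarrow> real) \<Rightarrow>
     real \<Rightarrow> real \<Rightarrow> real \<Rightarrow> real \<Rightarrow> real \<Rightarrow> real \<Rightarrow> real \<Rightarrow> real \<Rightarrow> bool" where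
  "third_config E c r v w g h a b a1 b1 a2 b2 p q \<longleftrightarrow>
     disc_strands E c r {(a, b), (a1, b1), (a2, b2)} \<and>
     oriented_strand E c r v g a1 b1 \<and> oriented_strand E c r w h a2 b2 \<and>
     Im (cnj v * w) \<noteq> 0 \<and> inj_on (curve E) {a..b} \<and> a < p \<and> p < b \<and> a < q \<and> q < b \<and>
     {t \<in> {a..b}. side c v (curve E t) = 0} = {p} \<and> {t \<in> {a..b}. side c w (curve E t) = 0} = {q}"

lemma Im_cnj_swap: "Im (cnj v * w) = - Im (cnj w * v)"
  by simp

lemma neg_iff_product_sign:
  fixes x y :: real
  shows "y \<noteq> 0 \<Longrightarrow> - (x * y) \<noteq> 0 \<Longrightarrow> x < 0 \<longleftrightarrow> (- (x * y) > 0 \<longleftrightarrow> y > 0)"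
  by (auto simp: zero_less_mult_iff mult_less_0_iff)

lemma third_config_swap:
  "third_config E c r v w g h a b a1 b1 a2 b2 p q \<Longrightarrow> third_config E c r w v h g a b a2 b2 a1 b1 q p"
proof -
  assume T: "third_config E c r v w g h a b a1 b1 a2 b2 p q"
  then have "Im (cnj v * w) \<noteq> 0" unfolding third_config_def by blast
  then have "Im (cnj w * v) \<noteq> 0" using Im_cnj_swap[of v w] by linarith
  moreover have "{(a, b), (a2, b2), (a1, b1)} = {(a, b), (a1, b1), (a2, b2)}" by auto
  ultimately show ?thesis using T unfolding third_config_def by metis
qed

text \<open>A common time in the interior of one interval can be shifted a little inside both. The
  second common time so obtained contradicts the uniqueness of a meeting point in
  \<open>third_disjoint\<close> and \<open>third_disjoint12\<close>.\<close>

lemma interval_overlap: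
  fixes x :: real
  assumes "\<alpha> < x" "x < \<beta>" "a1 \<le> x'" "x' \<le> b1" "a1 < b1"
  obtains \<delta> where "\<delta> \<noteq> 0" "\<alpha> < x + \<delta>" "x + \<delta> < \<beta>" "a1 \<le> x' + \<delta>" "x' + \<delta> \<le> b1"
proof (cases "x' < b1")
  case True
  define \<delta> where "\<delta> = min ((\<beta> - x) / 2) (b1 - x')"
  have "\<delta> > 0" using True assms by (simp add: \<delta>_def)
  moreover have "\<delta> \<le> (\<beta> - x) / 2" "\<delta> \<le> b1 - x'"
    unfolding \<delta>_def by (rule min.cobounded1, rule min.cobounded2)
  ultimately have "\<delta> > 0" "\<delta> < \<beta> - x" "\<delta> \<le> b1 - x'" using assms(2) by auto
  then show ?thesis using assms by (intro that[of \<delta>]) auto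
next
  case False
  define \<delta> where "\<delta> = min ((x - \<alpha>) / 2) (x' - a1)"
  have "\<delta> > 0" using False assms by (simp add: \<delta>_def)
  moreover have "\<delta> \<le> (x - \<alpha>) / 2" "\<delta> \<le> x' - a1"
    unfolding \<delta>_def by (rule min.cobounded1, rule min.cobounded2)
  ultimately have "\<delta> > 0" "\<delta> < x - \<alpha>" "\<delta> \<le> x' - a1" using assms(1) by auto
  then show ?thesis using assms by (intro that[of "- \<delta>"]) auto
qed

context
  fixes E c r v w g h a b a1 b1 a2 b2 p q
  assumes E: "virtual_diagram E" and T: "third_config E c r v w g h a b a1 b1 a2 b2 p q"
begin

lemma third_disc: "disc_strands E c r {(a, b), (a1, b1), (a2, b2)}"
  and third_v: "oriented_strand E c r v g a1 b1" and third_w: "oriented_strand E c r w h a2 b2"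
  and third_omega: "Im (cnj v * w) \<noteq> 0" and third_inj: "inj_on (curve E) {a..b}"
  and third_pq: "a < p" "p < b" "a < q" "q < b"
  and third_zero_v: "{t \<in> {a..b}. side c v (curve E t) = 0} = {p}"
  using T unfolding third_config_def by blast+

lemma third_ab: "a < b" "b < a + 1" "a1 < b1" "b1 < a1 + 1" "a2 < b2" "b2 < a2 + 1"
  using disc_strandsD(2)[OF third_disc, of a b] disc_strandsD(2)[OF third_disc, of a1 b1]
    disc_strandsD(2)[OF third_disc, of a2 b2] by auto

lemma third_r: "r > 0" by (rule disc_strandsD(1)[OF third_disc])

lemma third_zero: "a \<le> t \<Longrightarrow> t \<le> b \<Longrightarrow> side c v (curve E t) = 0 \<longleftrightarrow> t = p"
  using third_zero_v by auto

text \<open>At a common time of the two strands \<open>side\<close> vanishes on the moving strand,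
  so this time is \<open>p\<close>; a nearby second one would be another zero.\<close>

lemma third_disjoint:
  assumes t: "a \<le> t" "t \<le> b" "a1 \<le> t'" "t' \<le> b1"
  shows "frac t \<noteq> frac t'"
proof
  assume fr: "frac t = frac t'"
  then obtain n :: int where n: "t' = t + of_int n" unfolding frac_eq_iff by (metis frac_eq_iff)
  have "side c v (curve E t) = 0"
    using oriented_strandD(4)[OF third_v t(3,4)] curve_cong_frac[OF E fr] by simp
  then have tp: "t = p" using third_zero t by simp
  obtain \<delta> where \<delta>: "\<delta> \<noteq> 0" "a < t + \<delta>" "t + \<delta> < b" "a1 \<le> t' + \<delta>" "t' + \<delta> \<le> b1"
    using interval_overlap[of a t b a1 t' b1] third_pq tp t third_ab by metis
  have "t' + \<delta> = (t + \<delta>) + of_int n" using n by simp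
  then have "curve E (t + \<delta>) = curve E (t' + \<delta>)" using curve_periodic[OF E] by metis
  then have "side c v (curve E (t + \<delta>)) = 0" using oriented_strandD(4)[OF third_v \<delta>(4,5)] by simp
  then have "t + \<delta> = p" using third_zero \<delta> by simp
  then show False using tp \<delta>(1) by simp
qed

lemma third_off: "a1 \<le> t \<Longrightarrow> t \<le> b1 \<Longrightarrow> off a b t"
proof (rule ccontr)
  assume t: "a1 \<le> t" "t \<le> b1" and "\<not> off a b t"
  then obtain t' where "frac t' = frac t" "a \<le> t'" "t' \<le> b" by (blast elim: not_offE)
  then show False using third_disjoint[of t' t] t by auto
qed

text \<open>The two lines are not parallel and meet only in \<open>c\<close>.\<close>

lemma third_both_sides:
  assumes x: "a1 \<le> x" "x \<le> b1" and w0: "side c w (curve E x) = 0"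
  shows "curve E x = c"
proof -
  have "curve E x - c = of_real (g x) * v" using oriented_strandD(2)[OF third_v x] by simp
  then have "side c w (curve E x) = g x * Im (cnj w * v)" unfolding side_def by (simp add: algebra_simps)
  then have "g x * Im (cnj w * v) = 0" using w0 by metis
  moreover have "Im (cnj w * v) \<noteq> 0" using third_omega Im_cnj_swap[of v w] by linarith
  ultimately have "g x = 0" by (metis mult_eq_0_iff)
  then show ?thesis using oriented_strandD(2)[OF third_v x] by simp
qed

lemma third_strand_centre:
  obtains t where "a1 < t" "t < b1" "curve E t = c"
proof -
  have "c \<in> cball c r" "side c v c = 0" using third_r by (auto simp: side_def)
  then obtain t where t: "a1 \<le> t" "t \<le> b1" "curve E t = c"
    using oriented_strandD(7)[OF third_v _ third_r] by blast
  have "curve E a1 \<noteq> c" "curve E b1 \<noteq> c"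
    using disc_strandsD(2)[OF third_disc, of a1 b1] third_r by auto
  then show ?thesis using that[of t] t by (metis order_le_less)
qed

lemma third_moving_mate:
  obtains x where "a1 < x" "x < b1" "curve E x = curve E p" "frac p \<noteq> frac x"
proof -
  have bp: "curve E p \<in> ball c r"
    using disc_strandsD(3)[OF third_disc, of a b p] third_pq by simp
  have "side c v (curve E p) = 0" using third_zero[of p] third_pq by simp
  then obtain x where x: "a1 \<le> x" "x \<le> b1" "curve E x = curve E p"
    using oriented_strandD(7)[OF third_v _ third_r] bp ball_subset_cball by blast
  have "curve E a1 \<notin> ball c r" "curve E b1 \<notin> ball c r"
    using disc_strandsD(2)[OF third_disc, of a1 b1] by auto
  then have x': "a1 < x" "x < b1" using x bp by (metis order_le_less)+
  show ?thesis using that[OF x' x(3)] third_disjoint[of p x] third_pq x by simp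
qed

end

context
  fixes E c r v w g h a b a1 b1 a2 b2 p q
  assumes E: "virtual_diagram E" and T: "third_config E c r v w g h a b a1 b1 a2 b2 p q"
begin

lemmas third_swapped = third_config_swap[OF T]

text \<open>At a common time the point lies on both lines, so it is \<open>c\<close>; two such times
  contradict injectivity along the strand.\<close>

lemma third_disjoint12:
  assumes t: "a1 \<le> t" "t \<le> b1" "a2 \<le> t'" "t' \<le> b2"
  shows "frac t \<noteq> frac t'"
proof
  assume fr: "frac t = frac t'"
  then obtain n :: int where n: "t' = t + of_int n" unfolding frac_eq_iff by (metis frac_eq_iff)
  have both: "curve E (t + \<delta>) = c"
    if "a1 \<le> t + \<delta>" "t + \<delta> \<le> b1" "a2 \<le> t' + \<delta>" "t' + \<delta> \<le> b2" for \<delta>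
  proof -
    have "t' + \<delta> = (t + \<delta>) + of_int n" using n by simp
    then have "curve E (t + \<delta>) = curve E (t' + \<delta>)" using curve_periodic[OF E] by metis
    then have "side c w (curve E (t + \<delta>)) = 0"
      using oriented_strandD(4)[OF third_w[OF E T] that(3,4)] by simp
    then show ?thesis by (rule third_both_sides[OF E T that(1,2)])
  qed
  have tc: "curve E t = c" using both[of 0] t by simp
  obtain t1 where t1: "a1 < t1" "t1 < b1" "curve E t1 = c" by (rule third_strand_centre[OF E T])
  have "t = t1" using oriented_strandD(6)[OF third_v[OF E T], of t t1] t t1 tc by simp
  then obtain \<delta> where \<delta>: "\<delta> \<noteq> 0" "a1 < t + \<delta>" "t + \<delta> < b1" "a2 \<le> t' + \<delta>" "t' + \<delta> \<le> b2"
    using interval_overlap[of a1 t b1 a2 t' b2] t1 t third_ab[OF E T] by metis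
  have "curve E (t + \<delta>) = curve E t" using both[of \<delta>] \<delta> tc by simp
  then show False using oriented_strandD(6)[OF third_v[OF E T], of "t + \<delta>" t] \<delta> t by simp
qed

lemma third_crossing_lift:
  assumes cr: "crossing E x y" and x: "curve E x \<in> cball c r"
  obtains y' where "frac y' = frac y" "curve E y' = curve E x" "y' \<noteq> x"
    "a \<le> y' \<and> y' \<le> b \<or> a1 \<le> y' \<and> y' \<le> b1 \<or> a2 \<le> y' \<and> y' \<le> b2"
proof -
  have "curve E y \<in> cball c r" using cr x by (simp add: crossing_def)
  then have "\<exists>(a', b')\<in>{(a, b), (a1, b1), (a2, b2)}. \<exists>y'. frac y' = frac y \<and> a' \<le> y' \<and> y' \<le> b'"
    by (rule disc_strandsD(5)[OF third_disc[OF E T]])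
  then have "(\<exists>y'. frac y' = frac y \<and> a \<le> y' \<and> y' \<le> b) \<or>
      (\<exists>y'. frac y' = frac y \<and> a1 \<le> y' \<and> y' \<le> b1) \<or> (\<exists>y'. frac y' = frac y \<and> a2 \<le> y' \<and> y' \<le> b2)"
    by simp
  then obtain y' where y': "frac y' = frac y"
    "a \<le> y' \<and> y' \<le> b \<or> a1 \<le> y' \<and> y' \<le> b1 \<or> a2 \<le> y' \<and> y' \<le> b2"
    by blast
  have "curve E y' = curve E x" using cr curve_cong_frac[OF E y'(1)] by (simp add: crossing_def)
  moreover have "y' \<noteq> x" using cr y'(1) by (auto simp: crossing_def)
  ultimately show ?thesis using that[of y'] y' by auto
qed

lemma third_moving_crossing:
  assumes cr: "crossing E x y" and x: "a \<le> x" "x \<le> b"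
  shows "x = p \<or> x = q"
proof -
  have "curve E x \<in> cball c r" using disc_strandsD(4)[OF third_disc[OF E T], of a b x] x by simp
  then obtain y' where y': "curve E y' = curve E x" "y' \<noteq> x"
    "a \<le> y' \<and> y' \<le> b \<or> a1 \<le> y' \<and> y' \<le> b1 \<or> a2 \<le> y' \<and> y' \<le> b2"
    using third_crossing_lift[OF cr] by metis
  have "\<not> (a \<le> y' \<and> y' \<le> b)" using inj_onD[OF third_inj[OF E T] y'(1)] x y'(2) by auto
  moreover have "x = p" if "a1 \<le> y' \<and> y' \<le> b1"
    using oriented_strandD(4)[OF third_v[OF E T], of y'] that y'(1) third_zero[OF E T x] by simp
  moreover have "x = q" if "a2 \<le> y' \<and> y' \<le> b2"
    using oriented_strandD(4)[OF third_w[OF E T], of y'] that y'(1) third_zero[OF E third_swapped x] by simp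
  ultimately show ?thesis using y'(3) by blast
qed

lemma third_strand_crossing:
  assumes cr: "crossing E x y" and x: "a1 \<le> x" "x \<le> b1"
  shows "curve E x = curve E p \<or> curve E x = c"
proof -
  have "curve E x \<in> cball c r" using disc_strandsD(4)[OF third_disc[OF E T], of a1 b1 x] x by simp
  then obtain y' where y': "curve E y' = curve E x" "y' \<noteq> x"
    "a \<le> y' \<and> y' \<le> b \<or> a1 \<le> y' \<and> y' \<le> b1 \<or> a2 \<le> y' \<and> y' \<le> b2"
    using third_crossing_lift[OF cr] by metis
  have "\<not> (a1 \<le> y' \<and> y' \<le> b1)" using oriented_strandD(6)[OF third_v[OF E T], of y' x] x y' by blast
  moreover have "curve E x = curve E p" if ay: "a \<le> y' \<and> y' \<le> b"
  proof -
    have "side c v (curve E y') = 0" using oriented_strandD(4)[OF third_v[OF E T] x] y'(1) by simp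
    then show ?thesis using third_zero[OF E T, of y'] ay y'(1) by simp
  qed
  moreover have "curve E x = c" if "a2 \<le> y' \<and> y' \<le> b2"
    by (rule third_both_sides[OF E T x]) (use oriented_strandD(4)[OF third_w[OF E T], of y'] that y'(1) in simp)
  ultimately show ?thesis using y'(3) by blast
qed

text \<open>The sign of the crossing is determined by the side from which the moving strand starts,
  and so is the side on which its other crossing lies, given the order of \<open>p\<close> and
  \<open>q\<close>.\<close>

lemma third_sign_moving:
  assumes x: "a1 < x" "x < b1" "curve E x = curve E p" "frac p \<noteq> frac x"
  shows "sign_at E p x = (if side c v (curve E a) > 0 then 1 else - 1)"
    and "side c v (curve E a) \<noteq> 0"
    and "p < q \<Longrightarrow> side c v (curve E q) > 0 \<longleftrightarrow> side c v (curve E a) < 0"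
    and "q < p \<Longrightarrow> side c v (curve E q) > 0 \<longleftrightarrow> side c v (curve E a) > 0"
proof -
  obtain l where l: "l > 0" "tangent E x = of_real l * v" using oriented_strandD(3)[OF third_v[OF E T] x(1,2)] by blast
  have "Im (cnj (tangent E x) * tangent E p) \<noteq> 0" using transverse[OF E x(3)] x(4) by metis
  then have d: "Im (cnj v * tangent E p) \<noteq> 0" unfolding l(2) by (auto simp: algebra_simps)
  note Z = single_zero[OF continuous_side[OF E] third_pq(1,2)[OF E T] side_derivative[OF E] d third_zero_v[OF E T]]
  show "sign_at E p x = (if side c v (curve E a) > 0 then 1 else - 1)"
    unfolding sign_at_straight[OF l(2,1)] using Z(1) by simp
  show "side c v (curve E a) \<noteq> 0" by (rule Z(4))
  show "side c v (curve E q) > 0 \<longleftrightarrow> side c v (curve E a) < 0" if "p < q"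
    using Z(3)[of q] that third_pq[OF E T] by simp
  show "side c v (curve E q) > 0 \<longleftrightarrow> side c v (curve E a) > 0" if "q < p"
    using Z(2)[of q] that third_pq[OF E T] by simp
qed

text \<open>On the first line, being before or after the centre amounts to lying on one side of the
  second line; the orientation of the pair \<open>v, w\<close> tells which side.\<close>

lemma third_order:
  assumes x: "a1 < x" "x < b1" "curve E x = curve E p" and t: "a1 < t" "t < b1" "curve E t = c"
    and pq: "p \<noteq> q"
  shows "x < t \<longleftrightarrow> (side c w (curve E p) > 0 \<longleftrightarrow> Im (cnj v * w) > 0)" "x \<noteq> t"
proof -
  have v0: "v \<noteq> 0" using oriented_strandD(1)[OF third_v[OF E T]] by auto
  have "g t = 0" using oriented_strandD(2)[OF third_v[OF E T], of t] t v0 by simp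
  then have lt: "x < t \<longleftrightarrow> g x < 0"
    using oriented_strandD(5)[OF third_v[OF E T], of x t] x t by simp
  have "curve E p - c = of_real (g x) * v" using oriented_strandD(2)[OF third_v[OF E T], of x] x by simp
  then have s: "side c w (curve E p) = - (g x * Im (cnj v * w))"
    unfolding side_def by (simp add: algebra_simps)
  have "side c w (curve E p) \<noteq> 0" using third_zero[OF E third_swapped, of p] third_pq[OF E T] pq by simp
  then show "x < t \<longleftrightarrow> (side c w (curve E p) > 0 \<longleftrightarrow> Im (cnj v * w) > 0)"
    unfolding lt s by (intro neg_iff_product_sign third_omega[OF E T])
  show "x \<noteq> t" using \<open>side c w (curve E p) \<noteq> 0\<close> x(3) t(3) by (auto simp: side_def)
qed

lemma third_sign_centre:
  assumes t: "a1 < t" "t < b1" and t': "a2 < t'" "t' < b2"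
  shows "sign_at E t t' = (if Im (cnj v * w) > 0 then 1 else - 1)"
proof -
  obtain l where l: "l > 0" "tangent E t = of_real l * v" using oriented_strandD(3)[OF third_v[OF E T] t] by blast
  obtain k where k: "k > 0" "tangent E t' = of_real k * w" using oriented_strandD(3)[OF third_w[OF E T] t'] by blast
  have "Im (cnj (tangent E t) * tangent E t') = (l * k) * Im (cnj v * w)"
    unfolding l(2) k(2) by (simp add: algebra_simps)
  moreover have "l * k > 0" using l(1) k(1) by simp
  ultimately have "0 < Im (cnj (tangent E t) * tangent E t') \<longleftrightarrow> 0 < Im (cnj v * w)"
    by (metis zero_less_mult_pos mult_pos_pos)
  then show ?thesis by (simp only: sign_at_def)
qed

text \<open>Otherwise the moving strand would pass through the centre and create a triple
  point.\<close>

lemma third_distinct: "p \<noteq> q"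
proof
  assume pq: "p = q"
  obtain x where x: "a1 < x" "x < b1" "curve E x = curve E p" by (rule third_moving_mate[OF E T])
  obtain t where t: "a2 < t" "t < b2" "curve E t = c" by (rule third_strand_centre[OF E third_swapped])
  have "side c w (curve E p) = 0" using third_zero[OF E third_swapped, of p] third_pq[OF E T] pq by simp
  then have "curve E x = c" using third_both_sides[OF E T, of x] x by simp
  then have "frac p = frac x \<or> frac x = frac t \<or> frac p = frac t" using no_triple[OF E, of p x t] x t by simp
  then show False
    using third_disjoint[OF E T, of p x] third_disjoint12[of x t] third_disjoint[OF E third_swapped, of p t] third_pq[OF E T] x t
    by auto
qed

end

lemma frac_neq_of_close: "x \<noteq> y \<Longrightarrow> x < y + 1 \<Longrightarrow> y < x + 1 \<Longrightarrow> frac x \<noteq> frac (y::real)"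
  using frac_neq[of x y] frac_neq[of y x] by (cases x y rule: linorder_cases) auto

lemma frac_translate: "frac z = frac s \<Longrightarrow> frac (z + (u - s)) = frac (u::real)"
proof -
  assume "frac z = frac s"
  then obtain n :: int where "z = s + of_int n" unfolding frac_eq_iff by (metis frac_eq_iff)
  then have eq: "z + (u - s) = u + of_int n" by simp
  show ?thesis unfolding eq by (rule frac_add_int)
qed

lemma third_outer:
  assumes E: "virtual_diagram E" and T: "third_config E c r v w g h a b a1 b1 a2 b2 p q"
    and x1: "a1 < x1" "x1 < b1" "curve E x1 = curve E p" and t1: "a1 < t1" "t1 < b1" "curve E t1 = c"
    and x2: "a2 < x2" "x2 < b2" "curve E x2 = curve E q" and t2: "a2 < t2" "t2 < b2" "curve E t2 = c"
    and cr: "crossing E z y"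
  shows "a \<le> z \<Longrightarrow> z \<le> b \<Longrightarrow> z = p \<or> z = q" "a1 \<le> z \<Longrightarrow> z \<le> b1 \<Longrightarrow> z = x1 \<or> z = t1"
    "a2 \<le> z \<Longrightarrow> z \<le> b2 \<Longrightarrow> z = x2 \<or> z = t2"
proof -
  note sw = third_config_swap[OF T]
  show "a \<le> z \<Longrightarrow> z \<le> b \<Longrightarrow> z = p \<or> z = q" by (rule third_moving_crossing[OF E T cr])
  show "z = x1 \<or> z = t1" if z: "a1 \<le> z" "z \<le> b1"
    using third_strand_crossing[OF E T cr z] oriented_strandD(6)[OF third_v[OF E T], of z x1]
      oriented_strandD(6)[OF third_v[OF E T], of z t1] z x1 t1 by auto
  show "z = x2 \<or> z = t2" if z: "a2 \<le> z" "z \<le> b2"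
    using third_strand_crossing[OF E sw cr z] oriented_strandD(6)[OF third_w[OF E T], of z x2]
      oriented_strandD(6)[OF third_w[OF E T], of z t2] z x2 t2 by auto
qed

lemma off_of_window:
  assumes E: "virtual_diagram E" and cr: "crossing E z y"
    and only: "\<And>z. crossing E z y \<Longrightarrow> \<alpha> \<le> z \<Longrightarrow> z \<le> \<beta> \<Longrightarrow> z = s \<or> z = t"
    and z: "frac z \<noteq> frac s" "frac z \<noteq> frac t"
  shows "off \<alpha> \<beta> z"
proof (rule ccontr)
  assume "\<not> off \<alpha> \<beta> z"
  then obtain z' where z': "frac z' = frac z" "\<alpha> \<le> z'" "z' \<le> \<beta>" by (rule not_offE)
  have "crossing E z' y" using cr crossing_cong[OF E z'(1) refl] by simp
  then have "z' = s \<or> z' = t" using only z' by blast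
  then show False using z z'(1) by auto
qed

lemma nx_of_window:
  assumes E: "virtual_diagram E" and s: "\<alpha> \<le> s" "s < t" "t \<le> \<beta>" "\<beta> < \<alpha> + 1"
    and t: "crossing E t t'" and only: "\<And>z y. crossing E z y \<Longrightarrow> \<alpha> \<le> z \<Longrightarrow> z \<le> \<beta> \<Longrightarrow> z = s \<or> z = t"
  shows "nx (gC (gauss_of E)) (frac s) = frac t"
proof -
  note C = wf_finite[OF wf_gauss_of[OF E]] wf_unit[OF wf_gauss_of[OF E]]
  have ft: "frac t \<in> gC (gauss_of E)" using t gC_frac[OF E] by blast
  have "adjacent (gC (gauss_of E)) s t"
    unfolding adjacent_def
  proof (intro conjI allI impI)
    fix z assume z: "s < z \<and> z < t"
    show "frac z \<notin> gC (gauss_of E)"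
    proof
      assume "frac z \<in> gC (gauss_of E)"
      then obtain y where "crossing E z y" using gC_frac[OF E] by blast
      then have "z = s \<or> z = t" by (rule only) (use z s in auto)
      then show False using z by auto
    qed
  qed (use s ft in auto)
  then have "nx (gC (gauss_of E)) s = frac t" by (rule nx_adjacent[OF C(1)])
  moreover have "nx (gC (gauss_of E)) (frac s) = nx (gC (gauss_of E)) s"
    by (rule nx_frac[OF C]) (use ft in auto)
  ultimately show ?thesis by simp
qed

text \<open>The normalised third move. The moving strand is \<open>A\<close>, the strand along
  \<open>v\<close> is \<open>B\<close>, and the strand along \<open>w\<close>, below it at the
  centre, is \<open>C\<close>. The crossings at \<open>p\<close>, \<open>q\<close> and the centre
  are \<open>x\<close>, \<open>y\<close> and \<open>z\<close>.\<close>

lemma alex_third_core: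
  assumes D: "virtual_diagram D" "virtual_diagram D'" and agree: "agree_off D D' a b"
    and T: "third_config D c r v w g h a b a1 b1 a2 b2 p q"
    and T': "third_config D' c r v w g h a b a1 b1 a2 b2 p' q'"
    and order: "p < q" "q' < p'" and over: "{p, q} \<subseteq> over_times D" "{p', q'} \<subseteq> over_times D'"
    and centre: "\<And>t. a1 \<le> t \<Longrightarrow> t \<le> b1 \<Longrightarrow> curve D t = c \<Longrightarrow> t \<in> over_times D"
  shows "alex (gauss_of D') = alex (gauss_of D)"
proof -
  let ?G = "gauss_of D" and ?G' = "gauss_of D'"
  note sw = third_config_swap[OF T] and sw' = third_config_swap[OF T']
  note ab = third_ab[OF D(1) T] and pq = third_pq[OF D(1) T] and pq' = third_pq[OF D(2) T']
  note d01 = third_disjoint[OF D(1) T] and d02 = third_disjoint[OF D(1) sw]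
    and d12 = third_disjoint12[OF D(1) T]
  note off1 = third_off[OF D(1) T] and off2 = third_off[OF D(1) sw]
  obtain x1 where x1: "a1 < x1" "x1 < b1" "curve D x1 = curve D p" "frac p \<noteq> frac x1"
    by (rule third_moving_mate[OF D(1) T])
  obtain x2 where x2: "a2 < x2" "x2 < b2" "curve D x2 = curve D q" "frac q \<noteq> frac x2"
    by (rule third_moving_mate[OF D(1) sw])
  obtain y1 where y1: "a1 < y1" "y1 < b1" "curve D' y1 = curve D' p'" "frac p' \<noteq> frac y1"
    by (rule third_moving_mate[OF D(2) T'])
  obtain y2 where y2: "a2 < y2" "y2 < b2" "curve D' y2 = curve D' q'" "frac q' \<noteq> frac y2"
    by (rule third_moving_mate[OF D(2) sw'])
  obtain t1 where t1: "a1 < t1" "t1 < b1" "curve D t1 = c" by (rule third_strand_centre[OF D(1) T])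
  obtain t2 where t2: "a2 < t2" "t2 < b2" "curve D t2 = c" by (rule third_strand_centre[OF D(1) sw])
  have o: "off a b t1" "off a b t2" using off1[of t1] off2[of t2] t1 t2 by auto
  have t1': "curve D' t1 = c" and t2': "curve D' t2 = c"
    using agree_off_eq(1)[OF agree o(1)] agree_off_eq(1)[OF agree o(2)] t1 t2 by auto
  have ov1: "t1 \<in> over_times D" "t1 \<in> over_times D'"
    using centre[of t1] t1 agree_off_eq(2)[OF agree o(1)] by auto
  have f12: "frac t1 \<noteq> frac t2" using d12[of t1 t2] t1 t2 by auto
  have cp: "crossing D p x1" and cq: "crossing D q x2" and ct: "crossing D t1 t2"
    using crossingI[OF D(1), of p x1] crossingI[OF D(1), of q x2] crossingI[OF D(1), of t1 t2]
      over x1 x2 t1 t2 f12 ov1 by auto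
  have cp': "crossing D' p' y1" and cq': "crossing D' q' y2" and ct': "crossing D' t1 t2"
    using crossingI[OF D(2), of p' y1] crossingI[OF D(2), of q' y2] crossingI[OF D(2), of t1 t2]
      over y1 y2 t1' t2' f12 ov1 by auto
  let ?\<omega> = "Im (cnj v * w)"
  have om: "?\<omega> \<noteq> 0" by (rule third_omega[OF D(1) T])
  have om': "Im (cnj w * v) = - ?\<omega>" by (rule Im_cnj_swap)
  have Da: "curve D' a = curve D a" by (rule agree_off_ends[OF agree ab(1,2)])
  note m1 = third_sign_moving[OF D(1) T x1] and m2 = third_sign_moving[OF D(1) sw x2]
    and m1' = third_sign_moving[OF D(2) T' y1] and m2' = third_sign_moving[OF D(2) sw' y2]
  note ne = third_distinct[OF D(1) T] and ne' = third_distinct[OF D(2) T']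
  note r1 = third_order[OF D(1) T x1(1-3) t1 ne] and r2 = third_order[OF D(1) sw x2(1-3) t2 ne[symmetric]]
    and r1' = third_order[OF D(2) T' y1(1-3) t1(1,2) t1' ne']
    and r2' = third_order[OF D(2) sw' y2(1-3) t2(1,2) t2' ne'[symmetric]]
  define ex ey ez where "ex = sign_at D p x1" and "ey = sign_at D q x2" and "ez = sign_at D t1 t2"
  have ez: "ez = (if ?\<omega> > 0 then 1 else - 1)" "sign_at D' t1 t2 = ez"
    using third_sign_centre[OF D(1) T t1(1,2) t2(1,2)] third_sign_centre[OF D(2) T' t1(1,2) t2(1,2)]
    by (simp_all only: ez_def)
  have ex: "ex = (if side c v (curve D a) > 0 then 1 else - 1)" "sign_at D' p' y1 = ex"
    using m1(1) m1'(1) Da by (simp_all add: ex_def)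
  have ey: "ey = (if side c w (curve D a) > 0 then 1 else - 1)" "sign_at D' q' y2 = ey"
    using m2(1) m2'(1) Da by (simp_all add: ey_def)
  \<comment> \<open>The conditions \<beta> and \<gamma> of \<open>third_move_identities\<close>. The
    side on which a crossing lies follows from the order along the moving strand; this order is
    reversed in \<open>D'\<close>, and so are the orders on the fixed strands.\<close>
  have ord1: "x1 < t1 \<longleftrightarrow> ey = ez" "y1 < t1 \<longleftrightarrow> \<not> ey = ez"
    using r1(1) r1'(1) m2(4)[OF order(1)] m2'(3)[OF order(2)] m2(2) om unfolding ey(1) ez(1) Da by auto
  have ord2: "x2 < t2 \<longleftrightarrow> ex = ez" "y2 < t2 \<longleftrightarrow> \<not> ex = ez"
    using r2(1) r2'(1) m1(3)[OF order(1)] m1'(4)[OF order(2)] m1(2) om unfolding ex(1) ez(1) Da om' by auto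
  note only = third_outer[OF D(1) T x1(1-3) t1 x2(1-3) t2]
    and only' = third_outer[OF D(2) T' y1(1-3) t1(1,2) t1' y2(1-3) t2(1,2) t2']
  have dist: "frac p \<noteq> frac q" "frac p \<noteq> frac x1" "frac p \<noteq> frac t1" "frac p \<noteq> frac x2" "frac p \<noteq> frac t2"
    "frac q \<noteq> frac x1" "frac q \<noteq> frac t1" "frac q \<noteq> frac x2" "frac q \<noteq> frac t2"
    "frac x1 \<noteq> frac t1" "frac x1 \<noteq> frac x2" "frac x1 \<noteq> frac t2" "frac t1 \<noteq> frac x2" "frac t1 \<noteq> frac t2"
    "frac x2 \<noteq> frac t2"
  proof -
    have c: "a \<le> p" "p \<le> b" "a \<le> q" "q \<le> b" "a1 \<le> x1" "x1 \<le> b1" "a1 \<le> t1" "t1 \<le> b1"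
      "a2 \<le> x2" "x2 \<le> b2" "a2 \<le> t2" "t2 \<le> b2" using pq x1 t1 x2 t2 by linarith+
    show "frac p \<noteq> frac q" by (rule frac_neq_of_close[OF ne]) (use pq ab in linarith)+
    show "frac x1 \<noteq> frac t1" by (rule frac_neq_of_close[OF r1(2)]) (use x1 t1 ab in linarith)+
    show "frac x2 \<noteq> frac t2" by (rule frac_neq_of_close[OF r2(2)]) (use x2 t2 ab in linarith)+
    show "frac p \<noteq> frac x1" "frac p \<noteq> frac t1" "frac q \<noteq> frac x1" "frac q \<noteq> frac t1"
      by (rule d01; rule c)+
    show "frac p \<noteq> frac x2" "frac p \<noteq> frac t2" "frac q \<noteq> frac x2" "frac q \<noteq> frac t2"
      by (rule d02; rule c)+
    show "frac x1 \<noteq> frac x2" "frac x1 \<noteq> frac t2" "frac t1 \<noteq> frac x2" "frac t1 \<noteq> frac t2"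
      by (rule d12; rule c)+
  qed
  note dist' = dist dist[THEN not_sym]
  \<comment> \<open>Displacement of each passage to the one in the same position after the move:
    first goes to first and second to second on every strand. As all three orders are reversed, the
    crossings are exchanged.\<close>
  define \<delta> where "\<delta> k = (if k = frac p then q' - p else if k = frac q then p' - q
    else if k = frac x1 then t1 - x1 else if k = frac t1 then y1 - t1
    else if k = frac x2 then t2 - x2 else if k = frac t2 then y2 - t2 else 0)" for k
  define \<phi> where "\<phi> z = z + \<delta> (frac z)" for z
  have dp: "\<delta> (frac p) = q' - p" "\<delta> (frac q) = p' - q" "\<delta> (frac x1) = t1 - x1" "\<delta> (frac t1) = y1 - t1"
    "\<delta> (frac x2) = t2 - x2" "\<delta> (frac t2) = y2 - t2"
    using dist' by (simp_all add: \<delta>_def)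
  have \<phi>v: "\<phi> p = q'" "\<phi> q = p'" "\<phi> x1 = t1" "\<phi> t1 = y1" "\<phi> x2 = t2" "\<phi> t2 = y2"
    by (simp_all add: \<phi>_def dp)
  have \<phi>f: "frac (\<phi> z) = frac (\<phi> s)" if "frac z = frac s" for z s
  proof -
    have "\<phi> z = z + (\<phi> s - s)" using that by (simp add: \<phi>_def)
    then show ?thesis using frac_translate[OF that] by simp
  qed
  let ?S = "{frac p, frac q, frac x1, frac t1, frac x2, frac t2}"
  have \<phi>id: "\<phi> z = z" if "frac z \<notin> ?S" for z using that by (simp add: \<phi>_def \<delta>_def)
  have mateS: "frac z \<in> ?S" if "crossing D z y" "frac y \<in> ?S" for z y
  proof -
    have cyz: "crossing D y z" by (rule crossing_sym[OF that(1)])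
    have "frac z = frac s'" if "crossing D s s'" "frac y = frac s" for s s'
      by (rule crossing_unique[OF D(1) _ that(1)]) (use cyz crossing_cong[OF D(1) that(2) refl] in simp)
    note k = this[OF cp] this[OF cq] this[OF ct] this[OF crossing_sym[OF cp]]
      this[OF crossing_sym[OF cq]] this[OF crossing_sym[OF ct]]
    show ?thesis
      using that(2) by (elim insertE emptyE) (drule k, simp)+
  qed
  have outer: "off a b z \<and> off a1 b1 z \<and> off a2 b2 z" if "crossing D z y" "frac z \<notin> ?S" for z y
    using off_of_window[OF D(1) that(1) only(1)] off_of_window[OF D(1) that(1) only(2)]
      off_of_window[OF D(1) that(1) only(3)] that(2) by simp
  have inS: "frac z \<notin> ?S" if "off a b z" "off a1 b1 z" "off a2 b2 z" for z
    using off_not_in[OF that(1), of p] off_not_in[OF that(1), of q] off_not_in[OF that(2), of x1]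
      off_not_in[OF that(2), of t1] off_not_in[OF that(3), of x2] off_not_in[OF that(3), of t2]
      pq x1 t1 x2 t2 by auto
  let ?S' = "{frac p', frac q', frac y1, frac t1, frac y2, frac t2}"
  have mateS': "frac z \<in> ?S'" if "crossing D' z y" "frac y \<in> ?S'" for z y
  proof -
    have cyz: "crossing D' y z" by (rule crossing_sym[OF that(1)])
    have "frac z = frac s'" if "crossing D' s s'" "frac y = frac s" for s s'
      by (rule crossing_unique[OF D(2) _ that(1)]) (use cyz crossing_cong[OF D(2) that(2) refl] in simp)
    note k = this[OF cp'] this[OF cq'] this[OF ct'] this[OF crossing_sym[OF cp']]
      this[OF crossing_sym[OF cq']] this[OF crossing_sym[OF ct']]
    show ?thesis
      using that(2) by (elim insertE emptyE) (drule k, simp)+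
  qed
  have outer': "off a b z \<and> off a1 b1 z \<and> off a2 b2 z" if "crossing D' z y" "frac z \<notin> ?S'" for z y
    using off_of_window[OF D(2) that(1) only'(1)] off_of_window[OF D(2) that(1) only'(2)]
      off_of_window[OF D(2) that(1) only'(3)] that(2) by simp
  have gC: "?S \<subseteq> gC ?G"
    using cp cq ct crossing_sym[OF cp] crossing_sym[OF cq] crossing_sym[OF ct] gC_frac[OF D(1)] by blast
  have gC': "?S' \<subseteq> gC ?G'"
    using cp' cq' ct' crossing_sym[OF cp'] crossing_sym[OF cq'] crossing_sym[OF ct'] gC_frac[OF D(2)] by blast
  have agreeG: "k \<in> gC ?G'" "gM ?G' k = gM ?G k \<and> gS ?G' k = gS ?G k \<and> (k \<in> gO ?G' \<longleftrightarrow> k \<in> gO ?G)"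
    "frac k = k" "frac (gM ?G k) \<notin> ?S"
    if k: "k \<in> gC ?G" "k \<notin> ?S" for k
  proof -
    obtain y where fk: "frac k = k" and y: "crossing D k y" using k(1) unfolding gC_crossing[OF D(1)] by blast
    have o: "off a b k \<and> off a b y" if c: "crossing D k y" for y
    proof -
      have "frac y \<notin> ?S" using mateS[OF c] k(2) fk by auto
      then show ?thesis using outer[OF c] outer[OF crossing_sym[OF c]] k(2) fk by simp
    qed
    show "k \<in> gC ?G'" "gM ?G' k = gM ?G k \<and> gS ?G' k = gS ?G k \<and> (k \<in> gO ?G' \<longleftrightarrow> k \<in> gO ?G)"
      using gauss_agree[OF D agree ab(1,2) k(1) o] by blast+
    show "frac k = k" by (rule fk)
    have "gM ?G k = frac y" using crossing_mate[OF D(1) y] fk by simp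
    then show "frac (gM ?G k) \<notin> ?S" using mateS[OF y] k(2) fk by auto
  qed
  \<comment> \<open>The strands as windows for \<open>windows_mono\<close>: 0 is the moving one, 1
    and 2 are the fixed ones.\<close>
  define al where "al i = (if i = 0 then a else if i = 1 then a1 else a2)" for i :: nat
  define be where "be i = (if i = 0 then b else if i = 1 then b1 else b2)" for i :: nat
  have al: "al 0 = a" "al (Suc 0) = a1" "al 2 = a2" "be 0 = b" "be (Suc 0) = b1" "be 2 = b2"
    by (simp_all add: al_def be_def)
  have cr_of: "\<exists>y. crossing D z y" if "frac z \<in> gC ?G" for z using that gC_frac[OF D(1)] by blast
  have in0: "z = p \<or> z = q" if "frac z \<in> gC ?G" "a \<le> z" "z \<le> b" for z using cr_of[OF that(1)] only(1) that by blast
  have in1: "z = x1 \<or> z = t1" if "frac z \<in> gC ?G" "a1 \<le> z" "z \<le> b1" for z using cr_of[OF that(1)] only(2) that by blast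
  have in2: "z = x2 \<or> z = t2" if "frac z \<in> gC ?G" "a2 \<le> z" "z \<le> b2" for z using cr_of[OF that(1)] only(3) that by blast
  have mono: "\<phi> z < \<phi> z'" if zz: "frac z \<in> gC ?G" "frac z' \<in> gC ?G" "z < z'" for z z'
  proof (rule windows_mono[where \<phi> = \<phi> and I = "{0, 1, 2}" and \<alpha> = al and \<beta> = be and X = "{z. frac z \<in> gC ?G}"])
    show "be i < al i + 1" if "i \<in> {0, 1, 2}" for i using that ab by (auto simp: al_def be_def)
    show "frac t \<noteq> frac t'" if ij: "i \<in> {0, 1, 2}" "j \<in> {0, 1, 2}" "i \<noteq> j"
      and t: "al i \<le> t" "t \<le> be i" "al j \<le> t'" "t' \<le> be j" for i j t t'
    proof -
      consider "i = 0" "j = 1" | "i = 0" "j = 2" | "i = 1" "j = 0" | "i = 1" "j = 2" | "i = 2" "j = 0" | "i = 2" "j = 1"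
        using ij by auto
      then show ?thesis
      proof cases
        case 1 then show ?thesis using d01[of t t'] t by (simp add: al)
      next
        case 2 then show ?thesis using d02[of t t'] t by (simp add: al)
      next
        case 3 then show ?thesis using d01[of t' t] t by (simp add: al)
      next
        case 4 then show ?thesis using d12[of t t'] t by (simp add: al)
      next
        case 5 then show ?thesis using d02[of t' t] t by (simp add: al)
      next
        case 6 then show ?thesis using d12[of t' t] t by (simp add: al)
      qed
    qed
    show "z + of_int n \<in> {z. frac z \<in> gC ?G} \<and> \<phi> (z + of_int n) = \<phi> z + of_int n"
      if "z \<in> {z. frac z \<in> gC ?G}" for z and n :: int using that by (simp add: \<phi>_def)
    show "al i \<le> \<phi> z \<and> \<phi> z \<le> be i"
      if i: "i \<in> {0, 1, 2}" and z: "z \<in> {z. frac z \<in> gC ?G}" "al i \<le> z" "z \<le> be i" for i z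
    proof -
      have fz: "frac z \<in> gC ?G" using z by simp
      consider "i = 0" | "i = 1" | "i = 2" using i by auto
      then show ?thesis
      proof cases
        case 1
        then have "z = p \<or> z = q" using in0[OF fz] z by (simp add: al)
        then show ?thesis using 1 pq' \<phi>v by (auto simp: al)
      next
        case 2
        then have "z = x1 \<or> z = t1" using in1[OF fz] z by (simp add: al)
        then show ?thesis using 2 y1 t1 \<phi>v by (auto simp: al)
      next
        case 3
        then have "z = x2 \<or> z = t2" using in2[OF fz] z by (simp add: al)
        then show ?thesis using 3 y2 t2 \<phi>v by (auto simp: al)
      qed
    qed
    show "\<phi> z < \<phi> z'"
      if i: "i \<in> {0, 1, 2}" and z: "z \<in> {z. frac z \<in> gC ?G}" "z' \<in> {z. frac z \<in> gC ?G}" "al i \<le> z" "z < z'" "z' \<le> be i"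
      for i z z'
    proof -
      have fz: "frac z \<in> gC ?G" "frac z' \<in> gC ?G" using z by simp_all
      have zb: "z \<le> be i" "al i \<le> z'" using z by auto
      consider "i = 0" | "i = 1" | "i = 2" using i by auto
      then show ?thesis
      proof cases
        case 1
        then have "z = p \<or> z = q" "z' = p \<or> z' = q" using in0[OF fz(1)] in0[OF fz(2)] z zb by (simp_all add: al)
        then show ?thesis using z(4) order \<phi>v by auto
      next
        case 2
        then have "z = x1 \<or> z = t1" "z' = x1 \<or> z' = t1" using in1[OF fz(1)] in1[OF fz(2)] z zb by (simp_all add: al)
        then show ?thesis using z(4) ord1 r1'(2) \<phi>v by auto
      next
        case 3
        then have "z = x2 \<or> z = t2" "z' = x2 \<or> z' = t2" using in2[OF fz(1)] in2[OF fz(2)] z zb by (simp_all add: al)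
        then show ?thesis using z(4) ord2 r2'(2) \<phi>v by auto
      qed
    qed
    show "\<phi> z = z" if "\<And>i. i \<in> {0, 1, 2} \<Longrightarrow> off (al i) (be i) z" for z
      by (rule \<phi>id, rule inS) (use that[of 0] that[of 1] that[of 2] in \<open>simp_all add: al\<close>)
  qed (use zz in simp_all)
  have tr: "transports \<phi> (gC ?G) (gC ?G')"
    unfolding transports_def
  proof (intro conjI allI impI)
    fix z assume z: "frac z \<in> gC ?G"
    show "frac (\<phi> z) \<in> gC ?G'"
    proof (cases "frac z \<in> ?S")
      case True
      then have "frac (\<phi> z) \<in> ?S'"
        using \<phi>f[of z p] \<phi>f[of z q] \<phi>f[of z x1] \<phi>f[of z t1] \<phi>f[of z x2] \<phi>f[of z t2] \<phi>v by auto
      then show ?thesis using gC' by blast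
    next
      case False
      then show ?thesis using agreeG(1)[OF z] \<phi>id[OF False] by simp
    qed
  next
    fix y assume y: "frac y \<in> gC ?G'"
    show "\<exists>x. frac x \<in> gC ?G \<and> \<phi> x = y"
    proof (cases "frac y \<in> ?S'")
      case True
      \<comment> \<open>Displacements depend only on the class modulo 1, so the preimage is found by
        undoing the displacement of \<open>s\<close>.\<close>
      have pre: "\<exists>x. frac x \<in> gC ?G \<and> \<phi> x = y" if s: "frac s \<in> ?S" "frac y = frac (\<phi> s)" for s
      proof -
        define x where "x = y + (s - \<phi> s)"
        have fx: "frac x = frac s" unfolding x_def by (rule frac_translate[OF s(2)])
        have "\<phi> x = x + (\<phi> s - s)" using fx by (simp add: \<phi>_def)
        then have "\<phi> x = y" by (simp add: x_def)
        moreover have "frac x \<in> gC ?G" unfolding fx using s(1) gC by blast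
        ultimately show ?thesis by blast
      qed
      have "frac y = frac (\<phi> q) \<or> frac y = frac (\<phi> p) \<or> frac y = frac (\<phi> t1) \<or> frac y = frac (\<phi> x1) \<or>
          frac y = frac (\<phi> t2) \<or> frac y = frac (\<phi> x2)"
        using True unfolding \<phi>v by blast
      then show ?thesis
        using pre[of q] pre[of p] pre[of t1] pre[of x1] pre[of t2] pre[of x2]
        by (elim disjE) simp_all
    next
      case False
      obtain z where z: "crossing D' y z" using y gC_frac[OF D(2)] by blast
      have fz: "frac z \<notin> ?S'" using mateS'[OF z] False by blast
      note oy = outer'[OF z False] and oz = outer'[OF crossing_sym[OF z] fz]
      have "crossing D y z"
        using crossing_agree(1)[OF D(2) D(1) agree_off_sym[OF agree] ab(1,2) z] oy oz by blast
      then have "frac y \<in> gC ?G" using gC_frac[OF D(1)] by blast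
      moreover have "\<phi> y = y" using \<phi>id[OF inS] oy by blast
      ultimately show ?thesis by blast
    qed
  next
    fix x y assume "frac x \<in> gC ?G" "frac y \<in> gC ?G" "x < y"
    then show "\<phi> x < \<phi> y" by (rule mono)
  next
    fix x and n :: int
    show "\<phi> (x + of_int n) = \<phi> x + of_int n" by (simp add: \<phi>_def)
  qed
  have \<psi>: "frac (\<phi> (frac p)) = frac q'" "frac (\<phi> (frac q)) = frac p'" "frac (\<phi> (frac x1)) = frac t1"
    "frac (\<phi> (frac t1)) = frac y1" "frac (\<phi> (frac x2)) = frac t2" "frac (\<phi> (frac t2)) = frac y2"
    using \<phi>f[of "frac p" p] \<phi>f[of "frac q" q] \<phi>f[of "frac x1" x1] \<phi>f[of "frac t1" t1]
      \<phi>f[of "frac x2" x2] \<phi>f[of "frac t2" t2] \<phi>v by simp_all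
  have nxA: "nx (gC ?G) (frac p) = frac q"
    by (rule nx_of_window[OF D(1) _ order(1) _ ab(2) cq only(1)]) (use pq in auto)
  have nxB: "nx (gC ?G) (frac x1) = frac t1" if "x1 < t1"
    by (rule nx_of_window[OF D(1) _ that _ ab(4) ct only(2)]) (use x1 t1 in auto)
  have only2: "z = t1 \<or> z = x1" if "crossing D z y" "a1 \<le> z" "z \<le> b1" for z y using only(2)[OF that] by blast
  have nxB': "nx (gC ?G) (frac t1) = frac x1" if "t1 < x1"
    by (rule nx_of_window[OF D(1) _ that _ ab(4) crossing_sym[OF cp] only2]) (use x1 t1 in auto)
  have nxC: "nx (gC ?G) (frac x2) = frac t2" if "x2 < t2"
    by (rule nx_of_window[OF D(1) _ that _ ab(6) crossing_sym[OF ct] only(3)]) (use x2 t2 in auto)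
  have only3: "z = t2 \<or> z = x2" if "crossing D z y" "a2 \<le> z" "z \<le> b2" for z y using only(3)[OF that] by blast
  have nxC': "nx (gC ?G) (frac t2) = frac x2" if "t2 < x2"
    by (rule nx_of_window[OF D(1) _ that _ ab(6) crossing_sym[OF cq] only3]) (use x2 t2 in auto)
  have ltB: "t1 < x1" if "\<not> x1 < t1" using that r1(2) by simp
  have ltC: "t2 < x2" if "\<not> x2 < t2" using that r2(2) by simp
  note mates = crossing_mate[OF D(1) cp] crossing_mate[OF D(1) cq] crossing_mate[OF D(1) ct]
    crossing_mate[OF D(2) cp'] crossing_mate[OF D(2) cq'] crossing_mate[OF D(2) ct']
  have ovf: "frac s \<in> gO (gauss_of E)" if "virtual_diagram E" "s \<in> over_times E" for s E
    using over_frac[OF that(1)] that(2) frac_in_unit[of s] by simp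
  show ?thesis
  proof (rule alex_third_move'[OF wf_gauss_of[OF D(1)] wf_gauss_of[OF D(2)] tr, where ?A1.0 = "frac p" and
        ?A2.0 = "frac q" and bx = "frac x1" and bz = "frac t1" and cy = "frac x2" and cz = "frac t2" and
        ex = ex and ey = ey and ez = ez])
    show "{frac p, frac q, frac x1, frac t1, frac x2, frac t2} \<subseteq> gC ?G" by (rule gC)
    show "distinct [frac p, frac q, frac x1, frac t1, frac x2, frac t2]" using dist by simp
    show "nx (gC ?G) (frac p) = frac q" by (rule nxA)
    show "if ey = ez then nx (gC ?G) (frac x1) = frac t1 else nx (gC ?G) (frac t1) = frac x1"
      using nxB nxB' ltB ord1(1) by (auto simp del: gauss_of_simps)
    show "if ex = ez then nx (gC ?G) (frac x2) = frac t2 else nx (gC ?G) (frac t2) = frac x2"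
      using nxC nxC' ltC ord2(1) by (auto simp del: gauss_of_simps)
    show "gM ?G (frac p) = frac x1" "gM ?G (frac q) = frac x2" "gM ?G (frac t1) = frac t2"
      using mates by simp_all
    show "gM ?G' (frac (\<phi> (frac p))) = frac (\<phi> (frac t2))" "gM ?G' (frac (\<phi> (frac q))) = frac (\<phi> (frac t1))"
      "gM ?G' (frac (\<phi> (frac x1))) = frac (\<phi> (frac x2))"
      using mates unfolding \<psi> by simp_all
    show "{frac p, frac q, frac t1} \<subseteq> gO ?G" using ovf[OF D(1)] over(1) ov1 by blast
    show "{frac (\<phi> (frac p)), frac (\<phi> (frac q)), frac (\<phi> (frac x1))} \<subseteq> gO ?G'"
      unfolding \<psi> using ovf[OF D(2)] over(2) ov1 by blast
    show "gS ?G (frac p) = ex" "gS ?G (frac q) = ey" "gS ?G (frac t1) = ez"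
      using crossing_sign[OF D(1) cp] crossing_sign[OF D(1) cq] crossing_sign[OF D(1) ct] over(1) ov1
      by (simp_all add: ex_def ey_def ez_def del: gauss_of_simps)
    show "gS ?G' (frac (\<phi> (frac q))) = ex" "gS ?G' (frac (\<phi> (frac p))) = ey" "gS ?G' (frac (\<phi> (frac x1))) = ez"
      unfolding \<psi> using crossing_sign[OF D(2) cp'] crossing_sign[OF D(2) cq'] crossing_sign[OF D(2) ct'] over(2) ov1
        ex(2) ey(2) ez(2) by (simp_all del: gauss_of_simps)
    fix k assume "k \<in> gC ?G - {frac p, frac q, frac x1, frac t1, frac x2, frac t2}"
    then have k: "k \<in> gC ?G" "k \<notin> ?S" by blast+
    note ag = agreeG[OF k]
    have "\<phi> k = k" using \<phi>id[of k] k(2) ag(3) by simp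
    moreover have "\<phi> (gM ?G k) = gM ?G k" by (rule \<phi>id[OF ag(4)])
    moreover have "frac (gM ?G k) = gM ?G k"
      using wf_gauss_of[OF D(1)] k(1) frac_unit unfolding wf_gauss_def by (meson subsetD)
    ultimately show "gM ?G' (frac (\<phi> k)) = frac (\<phi> (gM ?G k)) \<and> gS ?G' (frac (\<phi> k)) = gS ?G k \<and>
      (frac (\<phi> k) \<in> gO ?G' \<longleftrightarrow> k \<in> gO ?G)"
      using ag(2,3) by (simp del: gauss_of_simps)
  qed
qed

lemma third_data:
  assumes D: "virtual_diagram D" "virtual_diagram D'" and move: "slides_across_crossing D D' c P Q"
  obtains r v w g h a b a1 b1 a2 b2 p1 p2 q1 q2 where "agree_off D D' a b"
    "third_config D c r v w g h a b a1 b1 a2 b2 p1 p2" "third_config D' c r v w g h a b a1 b1 a2 b2 q1 q2"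
    "p1 < p2 \<longleftrightarrow> q2 < q1" "P = {p1, p2}" "Q = {q1, q2}"
proof -
  obtain r u1 u2 a b a1 b1 a2 b2 p1 p2 q1 q2 where
    disc: "disc_strands D c r {(a, b), (a1, b1), (a2, b2)}"
    and disc': "disc_strands D' c r {(a, b), (a1, b1), (a2, b2)}" and agree: "agree_off D D' a b"
    and st: "straight_strand D c r u1 a1 b1" "straight_strand D c r u2 a2 b2"
    and om: "Im (cnj u1 * u2) \<noteq> 0" and inj: "inj_on (curve D) {a..b}" "inj_on (curve D') {a..b}"
    and mem: "{p1, p2, q1, q2} \<subseteq> {a<..<b}"
    and zeros: "{t \<in> {a..b}. curve D t \<in> diameter_of c r u1} = {p1}"
      "{t \<in> {a..b}. curve D t \<in> diameter_of c r u2} = {p2}"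
      "{t \<in> {a..b}. curve D' t \<in> diameter_of c r u1} = {q1}"
      "{t \<in> {a..b}. curve D' t \<in> diameter_of c r u2} = {q2}"
    and order: "p1 < p2 \<longleftrightarrow> q2 < q1" and PQ: "P = {p1, p2}" "Q = {q1, q2}"
    using move unfolding slides_across_crossing_def by (elim exE conjE) (rule that)
  have ab: "a < b" "b < a + 1" "a1 < b1" "a2 < b2"
    using disc_strandsD(2)[OF disc, of a b] disc_strandsD(2)[OF disc, of a1 b1]
      disc_strandsD(2)[OF disc, of a2 b2] by simp_all
  have r: "r > 0" by (rule disc_strandsD(1)[OF disc])
  obtain v g where v: "v = u1 \<or> v = - u1" and ov: "oriented_strand D c r v g a1 b1"
    by (rule straight_imp_oriented[OF D(1) ab(3) st(1)])
  obtain w h where w: "w = u2 \<or> w = - u2" and ow: "oriented_strand D c r w h a2 b2"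
    by (rule straight_imp_oriented[OF D(1) ab(4) st(2)])
  have om': "Im (cnj v * w) \<noteq> 0" using v w om by auto
  have dv: "diameter_of c r u1 = diameter_of c r v" and dw: "diameter_of c r u2 = diameter_of c r w"
    using v w diameter_of_uminus by auto
  have side: "curve E t \<in> diameter_of c r x \<longleftrightarrow> side c x (curve E t) = 0"
    if "disc_strands E c r {(a, b), (a1, b1), (a2, b2)}" "norm x = 1" "t \<in> {a..b}" for E t x
    by (rule diameter_of_iff[OF that(2) r disc_strandsD(4)[OF that(1), of a b]]) (use that(3) in auto)
  have zero_iff: "{t \<in> {a..b}. side c x (curve E t) = 0} = {t \<in> {a..b}. curve E t \<in> diameter_of c r x}"
    if "disc_strands E c r {(a, b), (a1, b1), (a2, b2)}" "norm x = 1" for E x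
    by (rule Collect_cong) (use side[OF that] in blast)
  note nv = oriented_strandD(1)[OF ov] and nw = oriented_strandD(1)[OF ow]
  have T: "third_config D c r v w g h a b a1 b1 a2 b2 p1 p2"
    unfolding third_config_def zero_iff[OF disc nv] zero_iff[OF disc nw] dv[symmetric] dw[symmetric]
    using disc ov ow om' inj(1) mem zeros(1,2) by simp
  have ov': "oriented_strand D' c r v g a1 b1"
    by (rule oriented_strand_agree[OF D(1) agree ab(1,2) third_off[OF D(1) T] ov])
  have ow': "oriented_strand D' c r w h a2 b2"
    by (rule oriented_strand_agree[OF D(1) agree ab(1,2) third_off[OF D(1) third_config_swap[OF T]] ow])
  have T': "third_config D' c r v w g h a b a1 b1 a2 b2 q1 q2"
    unfolding third_config_def zero_iff[OF disc' nv] zero_iff[OF disc' nw] dv[symmetric] dw[symmetric]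
    using disc' ov' ow' om' inj(2) mem zeros(3,4) by simp
  show ?thesis by (rule that[OF agree T T' order PQ])
qed

text \<open>Only crossings on the moving strand could change, and these are virtual, whatever the
  crossing at the centre is. So the mixed move is covered as well.\<close>

theorem alex_virtual3:
  assumes D: "virtual_diagram D" "virtual_diagram D'" and move: "slides_across_crossing D D' c P Q"
    and virt: "P \<inter> classical_times D = {}" "Q \<inter> classical_times D' = {}"
  shows "alex (gauss_of D') = alex (gauss_of D)"
proof -
  obtain r v w g h a b a1 b1 a2 b2 p1 p2 q1 q2 where agree: "agree_off D D' a b"
    and T: "third_config D c r v w g h a b a1 b1 a2 b2 p1 p2"
    and T': "third_config D' c r v w g h a b a1 b1 a2 b2 q1 q2"
    and PQ: "P = {p1, p2}" "Q = {q1, q2}"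
    by (rule third_data[OF D move])
  have off: "off a b x"
    if E: "virtual_diagram E" "third_config E c r v w g h a b a1 b1 a2 b2 s t"
      and n: "{s, t} \<inter> classical_times E = {}" and cr: "crossing E x y" for E s t x y
  proof (rule ccontr)
    assume "\<not> off a b x"
    then obtain x' where x': "frac x' = frac x" "a \<le> x'" "x' \<le> b" by (rule not_offE)
    have cr': "crossing E x' y" using crossing_cong[OF E(1) x'(1) refl] cr by simp
    have "x' = s \<or> x' = t" by (rule third_moving_crossing[OF E cr' x'(2,3)])
    moreover have "x' \<in> classical_times E" using cr' by (simp add: crossing_def)
    ultimately show False using n by auto
  qed
  show ?thesis
    by (rule alex_local_eq[OF D agree third_ab(1,2)[OF D(1) T]])
      (use off[OF D(1) T] off[OF D(2) T'] virt PQ in simp_all)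
qed

text \<open>Four cases: which fixed strand is on top at the centre, and which one the moving strand
  meets first. Swapping the fixed strands or the two diagrams brings each case into the form of
  \<open>alex_third_core\<close>.\<close>

theorem alex_reidemeister3:
  assumes D: "virtual_diagram D" "virtual_diagram D'" and move: "slides_across_crossing D D' c P Q"
    and c: "c \<in> curve D ` over_times D" and over: "P \<subseteq> over_times D" "Q \<subseteq> over_times D'"
  shows "alex (gauss_of D') = alex (gauss_of D)"
proof -
  obtain r v w g h a b a1 b1 a2 b2 p1 p2 q1 q2 where agree: "agree_off D D' a b"
    and T: "third_config D c r v w g h a b a1 b1 a2 b2 p1 p2"
    and T': "third_config D' c r v w g h a b a1 b1 a2 b2 q1 q2"
    and order: "p1 < p2 \<longleftrightarrow> q2 < q1" and PQ: "P = {p1, p2}" "Q = {q1, q2}"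
    by (rule third_data[OF D move])
  note sw = third_config_swap[OF T] and sw' = third_config_swap[OF T']
  note agree' = agree_off_sym[OF agree]
  have p: "{p1, p2} \<subseteq> over_times D" "{p2, p1} \<subseteq> over_times D" and q: "{q1, q2} \<subseteq> over_times D'" "{q2, q1} \<subseteq> over_times D'"
    using over PQ by auto
  note np = third_distinct[OF D(1) T] and nq = third_distinct[OF D(2) T']
  \<comment> \<open>Fixed strands keep their points and over-times, so the upper strand at the
    centre is the same in \<open>D'\<close>.\<close>
  have same: "t \<in> over_times D'" if E: "third_config D c r v w g h a b \<alpha> \<beta> a3 b3 s s'"
    and cen: "\<And>t. \<alpha> \<le> t \<Longrightarrow> t \<le> \<beta> \<Longrightarrow> curve D t = c \<Longrightarrow> t \<in> over_times D"
    and t: "\<alpha> \<le> t" "t \<le> \<beta>" "curve D' t = c" for v w g h \<alpha> \<beta> a3 b3 s s' t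
  proof -
    have "off a b t" by (rule third_off[OF D(1) E t(1,2)])
    then show ?thesis using agree_off_eq[OF agree] cen[OF t(1,2)] t(3) by simp
  qed
  obtain t1 where t1: "a1 < t1" "t1 < b1" "curve D t1 = c" by (rule third_strand_centre[OF D(1) T])
  obtain t2 where t2: "a2 < t2" "t2 < b2" "curve D t2 = c" by (rule third_strand_centre[OF D(1) sw])
  obtain s where s: "s \<in> over_times D" "curve D s = c" using c by blast
  have "frac t1 \<noteq> frac t2" using third_disjoint12[OF D(1) T, of t1 t2] t1 t2 by simp
  then have "frac s = frac t1 \<or> frac s = frac t2" using no_triple[OF D(1), of s t1 t2] s t1 t2 by auto
  then have "t1 \<in> over_times D \<or> t2 \<in> over_times D"
    using s(1) over_frac[OF D(1), of s] over_frac[OF D(1), of t1] over_frac[OF D(1), of t2] by auto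
  then show ?thesis
  proof
    assume o: "t1 \<in> over_times D"
    have cen: "t \<in> over_times D" if "a1 \<le> t" "t \<le> b1" "curve D t = c" for t
      using oriented_strandD(6)[OF third_v[OF D(1) T], of t t1] that t1 o by simp
    note cen' = same[OF T cen]
    show ?thesis
    proof (cases "p1 < p2")
      case True
      then show ?thesis using alex_third_core[OF D agree T T' True _ p(1) q(1) cen] order by blast
    next
      case False
      then have "q1 < q2" "p2 < p1" using order np nq by auto
      then have "alex (gauss_of D) = alex (gauss_of D')"
        by (intro alex_third_core[OF D(2,1) agree' T' T _ _ q(1) p(1) cen'])
      then show ?thesis by simp
    qed
  next
    assume o: "t2 \<in> over_times D"
    have cen: "t \<in> over_times D" if "a2 \<le> t" "t \<le> b2" "curve D t = c" for t
      using oriented_strandD(6)[OF third_w[OF D(1) T], of t t2] that t2 o by simp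
    note cen' = same[OF sw cen]
    show ?thesis
    proof (cases "p1 < p2")
      case True
      then have "q2 < q1" using order by simp
      then have "alex (gauss_of D) = alex (gauss_of D')"
        using True by (intro alex_third_core[OF D(2,1) agree' sw' sw _ _ q(2) p(2) cen'])
      then show ?thesis by simp
    next
      case False
      then have "q1 < q2" "p2 < p1" using order np nq by auto
      then show ?thesis by (intro alex_third_core[OF D agree sw sw' _ _ p(2) q(2) cen])
    qed
  qed
qed

theorem alex_move_invariant:
  assumes D: "virtual_diagram D" "virtual_diagram D'" and move: "diagram_move D D'"
  shows "unit_equiv (alex (gauss_of D')) (alex (gauss_of D))"
  using move
proof cases
  case isotopy
  then show ?thesis using alex_isotopy[OF D] unit_equiv_refl by simp
next
  case (reidemeister1 s t)
  then show ?thesis using alex_reidemeister1[OF D] by blast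
next
  case (reidemeister2 p q)
  then show ?thesis using alex_reidemeister2[OF D] unit_equiv_refl by simp
next
  case (reidemeister3 c P Q)
  then show ?thesis using alex_reidemeister3[OF D] unit_equiv_refl by simp
next
  case (virtual1 s t)
  then show ?thesis using alex_virtual1[OF D] unit_equiv_refl by simp
next
  case (virtual2 p q)
  then show ?thesis using alex_virtual2[OF D] unit_equiv_refl by simp
next
  case (virtual3 c P Q)
  then show ?thesis using alex_virtual3[OF D] unit_equiv_refl by simp
next
  case (mixed c P Q)
  then show ?thesis using alex_virtual3[OF D] unit_equiv_refl by simp
qed

theorem theorem2p3:
  fixes K :: "diagram set" and p :: laurent3 and e :: int
  assumes "K \<in> virtual_knots"
    and "p \<in> z_parity_alexander K"
    and "e = z_extent p"
  shows "(even e \<longrightarrow> e \<le> int (min_odd_crossings K)) \<and>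
         (odd e \<longrightarrow> e + 1 \<le> int (min_odd_crossings K))"
  by (rule z_extent_bound_of_invariance[OF alex_move_invariant assms])


end
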